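(* Let $a>0$, $\alpha\in\mathbb{F}_a$, and $t\in\mathbb{R}$. If $a\ge c>0$, then $$\int_{\mathbb{R}}(1+itx)^{-c}\,\mu_\alpha(dx)=\int_{[0,1]}\exp\left\{-\int_{\mathbb{R}}\log(1+iutx)\,\alpha(dx)\right\}B(du;c,a-c).$$ If $c>a>0$, then $$\int_{\mathbb{R}}(1+itx)^{-c}\,\mu_\alpha(dx)=\frac{\Gamma(c-a+1)\Gamma(a)}{2\pi i\,\Gamma(c)}\int_0^{(1+)}\exp\left\{-\int_{\mathbb{R}}\log(1+iwtx)\,\alpha(dx)\right\}w^{c-1}(w-1)^{a-c-1}\,dw.$$
   Context: For $a>0$, $\mathbb{F}_a$ is the set of finite measures $\alpha$ on $(\mathbb{R},\mathscr{B}(\mathbb{R}))$ with $\alpha(\mathbb{R})=a$ and $\int_{\mathbb{R}}\log(1+|x|)\,\alpha(dx)<+\infty$. A random probability measure $\tilde\varphi$ on $\mathbb{R}$ is a Dirichlet process with parameter $\alpha$ (law $\mathscr{D}_\alpha$) if, for every finite measurable partition $C_1,\ldots,C_{n+1}$ of $\mathbb{R}$, $(\tilde\varphi(C_1),\ldots,\tilde\varphi(C_n))$ has the Dirichlet distribution with parameter $(\alpha(C_1),\ldots,\alpha(C_{n+1}))$ (components with $\alpha(C_i)=0$ being a.s. $0$). For $\alpha\in\mathbb{F}_a$, $\int|x|\,\tilde\varphi(dx)<\infty$ a.s., and $\mu_\alpha$ is the probability distribution of $\tilde\varphi(I)=\int x\,\tilde\varphi(dx)$ under $\mathscr{D}_\alpha$.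 $\log z=\log|z|+i\arg z$ with $\arg z\in(-\pi,\pi]$ is the principal logarithm; powers are principal. For $a>c>0$, $B(\cdot;c,a-c)$ is the beta distribution on $(0,1)$ with density $\frac{\Gamma(a)}{\Gamma(c)\Gamma(a-c)}u^{c-1}(1-u)^{a-c-1}$; for $a=c$, $B(\cdot;c,0)=\delta_1$, the unit mass at $1$. $\int_0^{(1+)}$ denotes integration along a contour which starts at the origin, lies (except for its endpoints) in $\{\mathrm{Re}\,w>0\}$, encircles the point $1$ once counterclockwise without crossing the segment $(0,1]$, and returns to the origin; e.g. it goes along a path just below the segment $(0,1-\varepsilon)$, then along the circle $1+\varepsilon e^{i\theta}$ with $\theta$ increasing from near $-\pi$ to near $\pi$, then back along a path just above the segment. Along it $(w-1)^{a-c-1}$ has $\arg(w-1)\in(-\pi,\pi)$. *)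

theory Defs
  imports "HOL-Probability.Probability" "HOL-Complex_Analysis.Complex_Analysis"
begin

definition log_finite_measures :: "real \<Rightarrow> real measure set" where
  "log_finite_measures a =
    {\<alpha>. sets \<alpha> = sets borel \<and> finite_measure \<alpha> \<and> measure \<alpha> UNIV = a \<and>
         integrable \<alpha> (\<lambda>x. ln (1 + \<bar>x\<bar>))}"

text \<open>The gamma law with shape \<open>s \<ge> 0\<close> and scale 1, where shape 0 means the unit mass at 0.\<close>

definition gamma_measure :: "real \<Rightarrow> real measure" where
  "gamma_measure s =
    (if s = 0 then return borel 0
     else density lborel (\<lambda>x. ennreal (if 0 < x then x powr (s - 1) * exp (- x) / Gamma s else 0)))"

text \<open>The Dirichlet law with parameter \<open>(p 1, \<dots>, p (n + 1))\<close>, \<open>p i \<ge> 0\<close> with positive sum, in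
  its first \<open>n\<close> coordinates (the last one is 1 minus their sum). This is Ferguson's definition by
  normalising independent gamma variables: if all \<open>p i > 0\<close> it is the law with the usual Dirichlet
  density on the simplex, and components with \<open>p i = 0\<close> vanish almost surely.\<close>

definition dirichlet_measure :: "nat \<Rightarrow> (nat \<Rightarrow> real) \<Rightarrow> (nat \<Rightarrow> real) measure" where
  "dirichlet_measure n p =
    distr (\<Pi>\<^sub>M i\<in>{1..n+1}. gamma_measure (p i)) (\<Pi>\<^sub>M i\<in>{1..n}. borel)
      (\<lambda>z. \<lambda>i\<in>{1..n}. z i / (\<Sum>j\<in>{1..n+1}. z j))"

definition dirichlet_process ::
    "'w measure \<Rightarrow> ('w \<Rightarrow> real measure) \<Rightarrow> real measure \<Rightarrow> bool" where
  "dirichlet_process M \<phi> \<alpha> \<longleftrightarrow>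
    prob_space M \<and> \<phi> \<in> measurable M (prob_algebra borel) \<and>
    (\<forall>n (C :: nat \<Rightarrow> real set).
       (\<forall>i\<in>{1..n+1}. C i \<in> sets borel) \<longrightarrow> disjoint_family_on C {1..n+1} \<longrightarrow>
       (\<Union>i\<in>{1..n+1}. C i) = UNIV \<longrightarrow>
       distr M (\<Pi>\<^sub>M i\<in>{1..n}. borel) (\<lambda>\<omega>. \<lambda>i\<in>{1..n}. measure (\<phi> \<omega>) (C i)) =
         dirichlet_measure n (\<lambda>i. measure \<alpha> (C i)))"

text \<open>The law of the mean of a random probability measure. The finite-dimensional laws determine
  the law of a Dirichlet process, so for such \<open>\<phi>\<close> it depends only on the parameter; the mean exists
  almost surely when that parameter lies in \<^const>\<open>log_finite_measures\<close>.\<close>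

definition mean_distribution :: "'w measure \<Rightarrow> ('w \<Rightarrow> real measure) \<Rightarrow> real measure" where
  "mean_distribution M \<phi> = distr M borel (\<lambda>\<omega>. LINT x|\<phi> \<omega>. x)"

definition beta_measure :: "real \<Rightarrow> real \<Rightarrow> real measure" where
  "beta_measure p q =
    (if q = 0 then return borel 1
     else density lborel (\<lambda>u. ennreal (if 0 < u \<and> u < 1
       then Gamma (p + q) / (Gamma p * Gamma q) * u powr (p - 1) * (1 - u) powr (q - 1) else 0)))"

text \<open>The contours denoted by \<open>\<integral>\<^sub>0\<^bsup>(1+)\<^esup>\<close>. As the contour stays in the right half-plane and avoids
  the segment from 0 to 1, winding number 1 forces it to leave the origin below the segment and to
  return above it.\<close>

definition loop_from_0_around_1 :: "(real \<Rightarrow> complex) \<Rightarrow> bool" where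
  "loop_from_0_around_1 \<gamma> \<longleftrightarrow>
    valid_path \<gamma> \<and> pathstart \<gamma> = 0 \<and> pathfinish \<gamma> = 0 \<and>
    (\<forall>s\<in>{0<..<1}. 0 < Re (\<gamma> s) \<and> \<gamma> s \<notin> closed_segment 0 1) \<and>
    winding_number \<gamma> 1 = 1"

end

theory Submission
  imports Defs
begin

text \<open>Write \<open>X\<close> for the mean of the Dirichlet process and
  \<open>F w = exp (- \<integral> Log (1 + i w t x) \<alpha>(dx))\<close>; this function is holomorphic in the right half-plane.

  The case \<open>c = a\<close> is the Markov-Krein identity \<open>E (1 + i u X) powr - a = exp (- \<integral> Log (1 + i u x) \<alpha>(dx))\<close>.
  Normalised independent gamma variables \<open>z i\<close>, multiplied by an independent gamma variable of
  shape \<open>a\<close>, are again independent gamma variables (\<open>distr_gamma_dirichlet\<close>). For a simple function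
  \<open>h\<close> with values \<open>h i\<close>, computing the Laplace transform of \<open>\<Sum> h i * z i\<close> in both pictures gives
  the identity for the integral of \<open>h\<close> (\<open>dirichlet_process_simple_transform\<close>). Its version for
  \<open>h\<close> near the absolute value shows that the mean exists almost surely, because the logarithmic
  moment of \<open>\<alpha>\<close> is finite; dominated convergence then gives the identity for the mean
  (\<open>markov_krein_dirichlet\<close>).

  For \<open>c < a\<close> average the identity for \<open>u t\<close> in place of \<open>t\<close> over a beta variable \<open>u\<close>: by
  Euler's integral, \<open>(1 + i t x) powr - c\<close> is the beta mean of \<open>(1 + i u t x) powr - a\<close>
  (\<open>beta_integral_powr\<close>), and Fubini's theorem finishes the proof.

  For \<open>c > a\<close> the argument is analytic continuation in the exponent \<open>c\<close>. The integrand of the loop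
  is holomorphic in the right half-plane slit along \<open>(0, 1]\<close>, which is simply connected, so it has a
  primitive there. The primitive has a limit at 0 from below and one from above, and the loop
  integral is the difference of the two limits. This makes it independent of the loop, even for
  loops that leave or reach 0 tangentially to the imaginary axis, where \<open>F\<close> can be unbounded. The
  same difference is an integral over a fixed triangle with a corner at 0, and in this form it is
  holomorphic in \<open>c\<close> for \<open>Re c > 0\<close>. For real \<open>c\<close> with \<open>a - 1 < c < a\<close> the loop can be
  collapsed onto the two sides of the segment, where \<open>(w - 1) powr (a - c - 1)\<close> differs from
  \<open>(1 - w) powr (a - c - 1)\<close> by conjugate phases. The result is \<open>2 i sin (\<pi> (a - c))\<close> times a beta
  integral of \<open>F\<close>, and the reflection formula for the gamma function turns the claim into the case
  \<open>c < a\<close>. The identity theorem extends it to all \<open>c > a\<close>.\<close>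

section \<open>Holomorphic dependence of integrals on a parameter\<close>

text \<open>By Cauchy's inequality the local integrable bound on the functions is, up to a constant, also a
  bound on their derivatives, hence on the difference quotients. So dominated convergence applies to
  the latter.\<close>

lemma holomorphic_on_lebesgue_integral:
  fixes g :: "complex \<Rightarrow> 'a \<Rightarrow> complex"
  assumes "open S"
    and meas: "\<And>z. z \<in> S \<Longrightarrow> g z \<in> borel_measurable \<mu>"
    and hol: "\<And>x. x \<in> space \<mu> \<Longrightarrow> (\<lambda>z. g z x) holomorphic_on S"
    and bound: "\<And>z. z \<in> S \<Longrightarrow> \<exists>r>0. \<exists>b. integrable \<mu> b \<and> cball z r \<subseteq> S \<and>
                  (\<forall>w\<in>cball z r. \<forall>x\<in>space \<mu>. norm (g w x) \<le> b x)"
  shows "(\<lambda>z. LINT x|\<mu>. g z x) holomorphic_on S"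
proof (rule holomorphic_onI)
  fix z assume z: "z \<in> S"
  obtain r b where r: "r > 0" and b: "integrable \<mu> b" and cb: "cball z r \<subseteq> S"
    and bd: "\<And>w x. w \<in> cball z r \<Longrightarrow> x \<in> space \<mu> \<Longrightarrow> norm (g w x) \<le> b x"
    using bound[OF z] by blast
  have deriv_bound: "norm (deriv (\<lambda>z. g z x) w) \<le> 2 * b x / r"
    if x: "x \<in> space \<mu>" and w: "w \<in> ball z (r/2)" for x w
  proof -
    have sub: "cball w (r/2) \<subseteq> cball z r"
      using w by (intro cball_subset_cball_iff[THEN iffD2]) (auto simp: dist_commute)
    have holx: "(\<lambda>z. g z x) holomorphic_on cball w (r/2)"
      using hol[OF x] sub cb by (meson holomorphic_on_subset subset_trans)
    have "norm ((deriv ^^ 1) (\<lambda>z. g z x) w) \<le> fact 1 * b x / (r/2) ^ 1"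
    proof (rule Cauchy_inequality)
      show "(\<lambda>z. g z x) holomorphic_on ball w (r/2)"
        using holx ball_subset_cball holomorphic_on_subset by blast
      show "continuous_on (cball w (r/2)) (\<lambda>z. g z x)"
        using holx by (rule holomorphic_on_imp_continuous_on)
      show "norm (g v x) \<le> b x" if "norm (w - v) = r/2" for v
        using that sub by (intro bd[OF _ x]) (auto simp: dist_norm)
    qed (use r in auto)
    then show ?thesis by (simp add: mult.commute)
  qed
  have lip: "norm (g w x - g z x) \<le> 2 * b x / r * norm (w - z)"
    if x: "x \<in> space \<mu>" and w: "w \<in> ball z (r/2)" for x w
  proof (rule field_differentiable_bound[where S="ball z (r/2)" and f'="deriv (\<lambda>z. g z x)"])
    fix v assume v: "v \<in> ball z (r/2)"
    have "v \<in> S" using v cb r by auto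
    then show "((\<lambda>z. g z x) has_field_derivative deriv (\<lambda>z. g z x) v) (at v within ball z (r / 2))"
      using hol[OF x] \<open>open S\<close> by (meson has_field_derivative_at_within holomorphic_derivI)
  qed (use w r deriv_bound[OF x] in auto)
  have intg: "integrable \<mu> (g w)" if "w \<in> cball z r" for w
    using that b bd cb meas
    by (intro Bochner_Integration.integrable_bound[OF b]) (force intro!: AE_I2 order_trans[OF _ abs_ge_self])+
  have "((\<lambda>z. LINT x|\<mu>. g z x) has_field_derivative (LINT x|\<mu>. deriv (\<lambda>z. g z x) z)) (at z within ball z (r/2))"
    unfolding has_field_derivative_iff tendsto_at_iff_sequentially comp_def
  proof (intro allI impI)
    fix X assume XS: "\<forall>i. X i \<in> ball z (r/2) - {z}" and X: "X \<longlonglongrightarrow> z"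
    define s where "s = (\<lambda>i x. (g (X i) x - g z x) / (X i - z))"
    have XS': "X i \<in> S" "X i \<in> cball z r" for i
      using XS[rule_format, of i] cb r by auto
    have smeas: "s i \<in> borel_measurable \<mu>" for i
      unfolding s_def using meas XS' z by (intro borel_measurable_divide borel_measurable_diff) auto
    have lim: "(\<lambda>i. s i x) \<longlonglongrightarrow> deriv (\<lambda>z. g z x) z" if x: "x \<in> space \<mu>" for x
    proof -
      have "((\<lambda>z. g z x) has_field_derivative deriv (\<lambda>z. g z x) z) (at z)"
        using hol[OF x] \<open>open S\<close> z by (meson holomorphic_derivI)
      then show ?thesis
        using XS X unfolding has_field_derivative_iff tendsto_at_iff_sequentially comp_def s_def by auto
    qed
    have "(\<lambda>i. LINT x|\<mu>. s i x) \<longlonglongrightarrow> (LINT x|\<mu>. deriv (\<lambda>z. g z x) z)"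
    proof (rule integral_dominated_convergence[where w="\<lambda>x. 2 * b x / r"])
      show "(\<lambda>x. deriv (\<lambda>z. g z x) z) \<in> borel_measurable \<mu>"
        by (rule borel_measurable_LIMSEQ_metric[OF smeas lim])
      show "AE x in \<mu>. norm (s i x) \<le> 2 * b x / r" for i
      proof (intro AE_I2)
        fix x assume x: "x \<in> space \<mu>"
        have "norm (X i - z) > 0" using XS by auto
        then show "norm (s i x) \<le> 2 * b x / r"
          using lip[OF x, of "X i"] XS by (simp add: s_def norm_divide pos_divide_le_eq)
      qed
    qed (use b smeas lim in auto)
    moreover have "(LINT x|\<mu>. s i x) = ((LINT x|\<mu>. g (X i) x) - (LINT x|\<mu>. g z x)) / (X i - z)" for i
      unfolding s_def using intg XS' r by (simp add: Bochner_Integration.integral_diff)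
    ultimately show "(\<lambda>i. ((LINT x|\<mu>. g (X i) x) - (LINT x|\<mu>. g z x)) / (X i - z))
        \<longlonglongrightarrow> (LINT x|\<mu>. deriv (\<lambda>z. g z x) z)" by simp
  qed
  then show "(\<lambda>z. LINT x|\<mu>. g z x) field_differentiable at z within S"
    using r at_within_open[of z "ball z (r/2)"]
    by (metis centre_in_ball field_differentiable_at_within field_differentiable_def half_gt_zero open_ball)
qed

lemma half_Re_cball:
  assumes "0 < Re z" "w \<in> cball z (Re z / 2)"
  shows "Re z / 2 \<le> Re w" and "norm w \<le> norm z + Re z / 2"
proof -
  have d: "norm (z - w) \<le> Re z / 2" using assms(2) by (simp add: dist_norm)
  then have "Re (z - w) \<le> Re z / 2" using complex_Re_le_cmod[of "z - w"] by linarith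
  then show "Re z / 2 \<le> Re w" by simp
  show "norm w \<le> norm z + Re z / 2"
    using norm_triangle_sub[of w z] d by (simp add: norm_minus_commute)
qed

lemma norm_Ln_le: "u \<noteq> 0 \<Longrightarrow> norm (Ln u) \<le> \<bar>ln (norm u)\<bar> + pi"
  using cmod_le[of "Ln u"] mpi_less_Im_Ln[of u] Im_Ln_le_pi[of u] by (auto simp: abs_if split: if_splits)

lemma islimpt_of_real_interval:
  assumes "x \<in> {u<..<v :: real}"
  shows "complex_of_real x islimpt complex_of_real ` {u<..<v}"
proof -
  have "x islimpt {u<..<v}"
    using assms by (intro interior_limit_point) (simp add: interior_open)
  then show ?thesis
    by (force simp: islimpt_approachable dist_of_real)
qed

section \<open>Gamma and beta laws\<close>

lemma sets_gamma_measure [simp, measurable_cong]: "sets (gamma_measure p) = sets borel"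
  by (simp add: gamma_measure_def)

lemma space_gamma_measure [simp]: "space (gamma_measure p) = UNIV"
  by (simp add: gamma_measure_def)

lemma nn_integral_gamma_measure:
  assumes "p > 0" and [measurable]: "f \<in> borel_measurable borel"
  shows "(\<integral>\<^sup>+x. f x \<partial>gamma_measure p) =
    (\<integral>\<^sup>+x. ennreal (if 0 < x then x powr (p - 1) * exp (- x) / Gamma p else 0) * f x \<partial>lborel)"
  using assms(1) by (simp add: gamma_measure_def nn_integral_density)

lemma nn_integral_gamma_density:
  assumes "p > 0"
  shows "(\<integral>\<^sup>+x. ennreal (if 0 < x then x powr (p - 1) * exp (- x) else 0) \<partial>lborel) = Gamma p"
proof -
  have "(\<integral>\<^sup>+x. ennreal (if 0 < x then x powr (p - 1) * exp (- x) else 0) \<partial>lborel) =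
      (\<integral>\<^sup>+x. ennreal (indicator {0..} x * x powr (p - 1) / exp x) \<partial>lborel)"
    by (intro nn_integral_cong_AE AE_I[where N="{0}"]) (auto simp: indicator_def exp_minus divide_simps)
  then show ?thesis using Gamma_conv_nn_integral_real[OF assms] by simp
qed

lemma prob_space_gamma_measure:
  assumes "p \<ge> 0" shows "prob_space (gamma_measure p)"
proof (cases "p = 0")
  case True
  then show ?thesis by (simp add: gamma_measure_def prob_space_return)
next
  case False
  with assms have p: "p > 0" by simp
  have "emeasure (gamma_measure p) (space (gamma_measure p)) = (\<integral>\<^sup>+x. 1 \<partial>gamma_measure p)"
    by simp
  also have "\<dots> = (\<integral>\<^sup>+x. ennreal (1 / Gamma p) * ennreal (if 0 < x then x powr (p - 1) * exp (- x) else 0) \<partial>lborel)"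
    using p by (subst nn_integral_gamma_measure) (auto intro!: nn_integral_cong simp flip: ennreal_mult'')
  also have "\<dots> = ennreal (1 / Gamma p) * ennreal (Gamma p)"
    by (subst nn_integral_cmult) (auto simp: nn_integral_gamma_density[OF p])
  also have "\<dots> = 1"
    using Gamma_real_pos[OF p] by (subst ennreal_mult[symmetric]) (auto simp del: Gamma_real_pos)
  finally show ?thesis by (rule prob_spaceI)
qed

lemma AE_gamma_measure_nonneg: "AE x in gamma_measure p. 0 \<le> x"
  unfolding gamma_measure_def by (cases "p = 0") (simp_all add: AE_return AE_density)

lemma AE_gamma_measure_pos: "p > 0 \<Longrightarrow> AE x in gamma_measure p. 0 < x"
  unfolding gamma_measure_def by (simp add: AE_density)

text \<open>Rescaling a gamma variable only tilts its law by an exponential. Together with its product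
  version below this is the one property of the gamma densities from which the Laplace transform
  and the independence of the total and the proportions are derived.\<close>

lemma gamma_measure_scale:
  assumes "p \<ge> 0" "r > 0" and [measurable]: "f \<in> borel_measurable borel"
  shows "(\<integral>\<^sup>+x. ennreal (r powr p * exp (- (r - 1) * x)) * f (r * x) \<partial>gamma_measure p) =
    (\<integral>\<^sup>+x. f x \<partial>gamma_measure p)"
proof (cases "p = 0")
  case True
  then show ?thesis using \<open>r > 0\<close> by (simp add: gamma_measure_def nn_integral_return)
next
  case False
  with assms have p: "p > 0" by simp
  let ?D = "\<lambda>x. (if 0 < x then x powr (p - 1) * exp (- x) / Gamma p else 0)"
  have D: "r * ?D (r * x) = ?D x * (r powr p * exp (- (r - 1) * x))" for x
  proof (cases "x > 0")
    case True
    have "r powr p = r * r powr (p - 1)" using \<open>r > 0\<close> by (simp add: powr_mult_base)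
    moreover have "exp (- (r * x)) = exp (-x) * exp (- (r - 1) * x)"
      by (simp add: algebra_simps flip: exp_add)
    ultimately show ?thesis using True \<open>r > 0\<close> by (simp add: powr_mult)
  qed (use \<open>r > 0\<close> in \<open>auto simp: zero_less_mult_iff\<close>)
  have Dpos: "?D x \<ge> 0" for x using Gamma_real_pos[OF p] by auto
  have "(\<integral>\<^sup>+x. f x \<partial>gamma_measure p) = (\<integral>\<^sup>+x. ennreal (?D x) * f x \<partial>lborel)"
    using p by (simp add: nn_integral_gamma_measure)
  also have "\<dots> = ennreal r * (\<integral>\<^sup>+x. ennreal (?D (0 + r * x)) * f (0 + r * x) \<partial>lborel)"
    using \<open>r > 0\<close> by (subst nn_integral_real_affine[where c=r and t=0]) auto
  also have "\<dots> = (\<integral>\<^sup>+x. ennreal r * (ennreal (?D (r * x)) * f (r * x)) \<partial>lborel)"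
    by (subst nn_integral_cmult) (simp_all only: add_0, measurable)
  also have "\<dots> = (\<integral>\<^sup>+x. ennreal (?D x) * (ennreal (r powr p * exp (- (r - 1) * x)) * f (r * x)) \<partial>lborel)"
  proof (intro nn_integral_cong)
    fix x
    have "ennreal r * ennreal (?D (r * x)) = ennreal (?D x) * ennreal (r powr p * exp (- (r - 1) * x))"
      using Dpos \<open>r > 0\<close> D[of x] by (subst (1 2) ennreal_mult[symmetric]) auto
    then show "ennreal r * (ennreal (?D (r * x)) * f (r * x)) =
        ennreal (?D x) * (ennreal (r powr p * exp (- (r - 1) * x)) * f (r * x))"
      by (metis mult.assoc)
  qed
  also have "\<dots> = (\<integral>\<^sup>+x. ennreal (r powr p * exp (- (r - 1) * x)) * f (r * x) \<partial>gamma_measure p)"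
    using p by (simp add: nn_integral_gamma_measure)
  finally show ?thesis ..
qed

text \<open>For real arguments this is the previous lemma with \<open>f = 1\<close>; both sides are holomorphic, so the
  identity theorem gives the complex arguments.\<close>

lemma gamma_measure_laplace:
  assumes "p \<ge> 0" "Re z > -1"
  shows "integrable (gamma_measure p) (\<lambda>x. exp (- z * complex_of_real x))"
    and "(LINT x|gamma_measure p. exp (- z * complex_of_real x)) = (1 + z) powr (- complex_of_real p)"
proof -
  interpret prob_space "gamma_measure p" by (rule prob_space_gamma_measure) fact
  have real: "integrable (gamma_measure p) (\<lambda>x. exp (- y * x))"
      "(LINT x|gamma_measure p. exp (- y * x)) = (1 + y) powr (- p)" if y: "y > -1" for y :: real
  proof -
    have "ennreal ((1 + y) powr p) * (\<integral>\<^sup>+x. ennreal (exp (- y * x)) \<partial>gamma_measure p)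
      = (\<integral>\<^sup>+x. ennreal ((1 + y) powr p * exp (- y * x)) \<partial>gamma_measure p)"
      by (subst nn_integral_cmult[symmetric]) (auto simp: ennreal_mult)
    also have "\<dots> = 1"
      using gamma_measure_scale[of p "1 + y" "\<lambda>_. 1"] assms y by (simp add: emeasure_space_1[simplified])
    finally have 1: "ennreal ((1 + y) powr p) * (\<integral>\<^sup>+x. ennreal (exp (- y * x)) \<partial>gamma_measure p) = 1" .
    have "(\<integral>\<^sup>+x. ennreal (exp (- y * x)) \<partial>gamma_measure p) =
        ennreal ((1 + y) powr (-p) * (1 + y) powr p) * (\<integral>\<^sup>+x. ennreal (exp (- y * x)) \<partial>gamma_measure p)"
      using y by (simp flip: powr_add)
    also have "\<dots> = ennreal ((1 + y) powr (-p))"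
      using 1 by (subst ennreal_mult) (auto simp: mult.assoc)
    finally have 2: "(\<integral>\<^sup>+x. ennreal (exp (- y * x)) \<partial>gamma_measure p) = ennreal ((1 + y) powr (-p))" .
    show "integrable (gamma_measure p) (\<lambda>x. exp (- y * x))"
      using 2 by (intro integrableI_nonneg) auto
    show "(LINT x|gamma_measure p. exp (- y * x)) = (1 + y) powr (- p)"
      using 2 by (subst integral_eq_nn_integral) auto
  qed
  let ?S = "{z :: complex. Re z > -1}"
  have opS: "open ?S" by (rule open_halfspace_Re_gt)
  have int: "integrable (gamma_measure p) (\<lambda>x. exp (- z * complex_of_real x))" if "z \<in> ?S" for z
  proof (rule Bochner_Integration.integrable_bound[OF real(1)[of "Re z"]])
    show "-1 < Re z" using that by simp
  qed auto
  then show "integrable (gamma_measure p) (\<lambda>x. exp (- z * complex_of_real x))" using assms by auto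
  \<comment> \<open>The gamma law lives on the nonnegative numbers; the absolute value makes the integrand
    bounded at every real \<open>x\<close>, not only almost everywhere.\<close>
  have abs: "(LINT x|gamma_measure p. exp (- z * complex_of_real x)) =
      (LINT x|gamma_measure p. exp (- z * complex_of_real \<bar>x\<bar>))" for z
    by (intro integral_cong_AE) (use AE_gamma_measure_nonneg[of p] in auto)
  have hol: "(\<lambda>z. LINT x|gamma_measure p. exp (- z * complex_of_real \<bar>x\<bar>)) holomorphic_on ?S"
  proof (rule holomorphic_on_lebesgue_integral[OF opS])
    fix z :: complex assume z: "z \<in> ?S"
    define r where "r = (Re z + 1) / 2"
    have r: "r > 0" and r': "Re z - r > -1" using z by (auto simp: r_def field_simps)
    have bd: "Re w \<ge> Re z - r" if "w \<in> cball z r" for w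
      using that abs_Re_le_cmod[of "z - w"] by (auto simp: dist_norm)
    have "integrable (gamma_measure p) (\<lambda>x. exp (- (Re z - r) * \<bar>x\<bar>))"
    proof (rule Bochner_Integration.integrable_cong_AE[THEN iffD1, rotated 3, OF real(1)[OF r']])
      show "AE x in gamma_measure p. exp (- (Re z - r) * x) = exp (- (Re z - r) * \<bar>x\<bar>)"
        using AE_gamma_measure_nonneg[of p] by eventually_elim simp
    qed auto
    moreover have "cball z r \<subseteq> ?S" using bd r' by force
    moreover have "norm (exp (- w * complex_of_real \<bar>x\<bar>)) \<le> exp (- (Re z - r) * \<bar>x\<bar>)"
      if "w \<in> cball z r" for w x
      using bd[OF that] mult_right_mono[of "Re z - r" "Re w" "\<bar>x\<bar>"] by (simp add: algebra_simps)
    ultimately show "\<exists>r>0. \<exists>b. integrable (gamma_measure p) b \<and> cball z r \<subseteq> ?S \<and>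
       (\<forall>w\<in>cball z r. \<forall>x\<in>space (gamma_measure p). norm (exp (- w * complex_of_real \<bar>x\<bar>)) \<le> b x)"
      using r by blast
  qed (auto intro!: holomorphic_intros)
  let ?d = "\<lambda>z. (LINT x|gamma_measure p. exp (- z * complex_of_real \<bar>x\<bar>)) - (1 + z) powr (- complex_of_real p)"
  have "?d z = 0"
  proof (rule analytic_continuation[of ?d ?S "complex_of_real ` {0<..<2}" 1])
    show "?d holomorphic_on ?S"
      by (intro holomorphic_on_diff hol holomorphic_intros) (auto simp: complex_nonpos_Reals_iff)
    show "connected ?S" by (intro convex_connected convex_halfspace_Re_gt)
    show "1 islimpt complex_of_real ` {0<..<2}"
      using islimpt_of_real_interval[of 1 0 2] by simp
    show "?d w = 0" if "w \<in> complex_of_real ` {0<..<2}" for w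
    proof -
      from that obtain y where y: "w = of_real y" "y > 0" by auto
      have "(LINT x|gamma_measure p. exp (- w * complex_of_real x)) = of_real (LINT x|gamma_measure p. exp (- y * x))"
        unfolding integral_complex_of_real[symmetric] y(1) by (simp add: exp_of_real[symmetric])
      also have "\<dots> = (1 + w) powr (- complex_of_real p)"
        using y by (subst real(2)) (auto simp: powr_of_real[symmetric])
      finally show ?thesis using abs by simp
    qed
  qed (use opS assms in auto)
  then show "(LINT x|gamma_measure p. exp (- z * complex_of_real x)) = (1 + z) powr (- complex_of_real p)"
    using abs by simp
qed

lemma PiM_gamma_scale:
  assumes I: "finite I" and p: "\<And>i. i \<in> I \<Longrightarrow> 0 \<le> p i" and r: "r > 0"
    and f [measurable]: "f \<in> borel_measurable (\<Pi>\<^sub>M i\<in>I. gamma_measure (p i))"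
  shows "(\<integral>\<^sup>+z. ennreal (r powr (\<Sum>i\<in>I. p i) * exp (- (r - 1) * (\<Sum>i\<in>I. z i))) * f (\<lambda>i\<in>I. r * z i)
      \<partial>(\<Pi>\<^sub>M i\<in>I. gamma_measure (p i))) = (\<integral>\<^sup>+z. f z \<partial>(\<Pi>\<^sub>M i\<in>I. gamma_measure (p i)))"
proof -
  let ?P = "\<Pi>\<^sub>M i\<in>I. gamma_measure (p i)"
  let ?w = "\<lambda>z. ennreal (r powr (\<Sum>i\<in>I. p i) * exp (- (r - 1) * (\<Sum>i\<in>I. z i)))"
  define p' where "p' i = (if i \<in> I then p i else 0)" for i
  have PP: "?P = (\<Pi>\<^sub>M i\<in>I. gamma_measure (p' i))"
    by (intro PiM_cong) (auto simp: p'_def)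
  interpret product_sigma_finite "\<lambda>i. gamma_measure (p' i)"
    unfolding product_sigma_finite_def
    using p by (auto simp: p'_def intro!: prob_space_imp_sigma_finite prob_space_gamma_measure)
  have w: "?w z = (\<Prod>i\<in>I. ennreal (r powr p' i * exp (- (r - 1) * z i)))" for z
  proof -
    have "r powr (\<Sum>i\<in>I. p i) * exp (- (r - 1) * (\<Sum>i\<in>I. z i)) = (\<Prod>i\<in>I. r powr p' i * exp (- (r - 1) * z i))"
      using I r by (simp add: prod.distrib powr_sum exp_sum sum_distrib_left p'_def)
    then show ?thesis by (simp add: prod_ennreal)
  qed
  have [measurable]: "?w \<in> borel_measurable ?P" unfolding PP by measurable
  have [measurable]: "(\<lambda>z. \<lambda>i\<in>I. r * z i) \<in> ?P \<rightarrow>\<^sub>M ?P" unfolding PP by measurable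
  have "distr (density ?P ?w) ?P (\<lambda>z. \<lambda>i\<in>I. r * z i) = (\<Pi>\<^sub>M i\<in>I. gamma_measure (p' i))"
  proof (rule PiM_eqI[OF I])
    show "sets (distr (density ?P ?w) ?P (\<lambda>z. \<lambda>i\<in>I. r * z i)) = sets (Pi\<^sub>M I (\<lambda>i. gamma_measure (p' i)))"
      unfolding PP by simp
    fix A assume A: "\<And>i. i \<in> I \<Longrightarrow> A i \<in> sets (gamma_measure (p' i))"
    have mA: "Pi\<^sub>E I A \<in> sets ?P" unfolding PP using A by (intro sets_PiM_I_finite I)
    have "emeasure (distr (density ?P ?w) ?P (\<lambda>z. \<lambda>i\<in>I. r * z i)) (Pi\<^sub>E I A) =
        (\<integral>\<^sup>+z. indicator (Pi\<^sub>E I A) z \<partial>distr (density ?P ?w) ?P (\<lambda>z. \<lambda>i\<in>I. r * z i))"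
      using mA by simp
    also have "\<dots> = (\<integral>\<^sup>+z. ?w z * indicator (Pi\<^sub>E I A) (\<lambda>i\<in>I. r * z i) \<partial>?P)"
      using mA by (subst nn_integral_distr) (auto simp: nn_integral_density)
    also have "\<dots> = (\<integral>\<^sup>+z. (\<Prod>i\<in>I. ennreal (r powr p' i * exp (- (r - 1) * z i)) * indicator (A i) (r * z i)) \<partial>?P)"
    proof (intro nn_integral_cong)
      fix z
      have "indicator (Pi\<^sub>E I A) (\<lambda>i\<in>I. r * z i) = (\<Prod>i\<in>I. indicator (A i) (r * z i) :: ennreal)"
        using I by (auto simp: indicator_def PiE_iff prod_zero_iff)
      then show "?w z * indicator (Pi\<^sub>E I A) (\<lambda>i\<in>I. r * z i) =
          (\<Prod>i\<in>I. ennreal (r powr p' i * exp (- (r - 1) * z i)) * indicator (A i) (r * z i))"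
        unfolding w by (simp add: prod.distrib)
    qed
    also have "\<dots> = (\<Prod>i\<in>I. \<integral>\<^sup>+x. ennreal (r powr p' i * exp (- (r - 1) * x)) * indicator (A i) (r * x) \<partial>gamma_measure (p' i))"
      unfolding PP using A I by (intro product_nn_integral_prod) auto
    also have "\<dots> = (\<Prod>i\<in>I. emeasure (gamma_measure (p' i)) (A i))"
    proof (intro prod.cong refl)
      fix i assume i: "i \<in> I"
      then show "(\<integral>\<^sup>+x. ennreal (r powr p' i * exp (- (r - 1) * x)) * indicator (A i) (r * x) \<partial>gamma_measure (p' i)) =
          emeasure (gamma_measure (p' i)) (A i)"
        using A[OF i] p r by (subst gamma_measure_scale) (auto simp: p'_def)
    qed
    finally show "emeasure (distr (density ?P ?w) ?P (\<lambda>z. \<lambda>i\<in>I. r * z i)) (Pi\<^sub>E I A) =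
        (\<Prod>i\<in>I. emeasure (gamma_measure (p' i)) (A i))" .
  qed
  then have eq: "distr (density ?P ?w) ?P (\<lambda>z. \<lambda>i\<in>I. r * z i) = ?P" unfolding PP .
  have "(\<integral>\<^sup>+z. f z \<partial>?P) = (\<integral>\<^sup>+z. f z \<partial>distr (density ?P ?w) ?P (\<lambda>z. \<lambda>i\<in>I. r * z i))"
    unfolding eq ..
  also have "\<dots> = (\<integral>\<^sup>+z. ?w z * f (\<lambda>i\<in>I. r * z i) \<partial>?P)"
    by (subst nn_integral_distr) (auto simp: nn_integral_density)
  finally show ?thesis ..
qed

lemma AE_PiM_gamma_nonneg:
  assumes "finite I" "\<And>i. i \<in> I \<Longrightarrow> 0 \<le> p i"
  shows "AE z in (\<Pi>\<^sub>M i\<in>I. gamma_measure (p i)). \<forall>i\<in>I. 0 \<le> z i"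
  using assms
  by (intro AE_finite_allI AE_PiM_component prob_space_gamma_measure AE_gamma_measure_nonneg) auto

lemma AE_PiM_gamma_sum_pos:
  assumes "finite I" and p: "\<And>i. i \<in> I \<Longrightarrow> 0 \<le> p i" and "(\<Sum>i\<in>I. p i) > 0"
  shows "AE z in (\<Pi>\<^sub>M i\<in>I. gamma_measure (p i)). 0 < (\<Sum>i\<in>I. z i)"
proof -
  obtain j where j: "j \<in> I" "p j > 0"
    using assms by (meson linorder_not_le sum_nonpos)
  have "AE z in (\<Pi>\<^sub>M i\<in>I. gamma_measure (p i)). 0 < z j"
    using j p by (intro AE_PiM_component prob_space_gamma_measure AE_gamma_measure_pos) auto
  moreover have "AE z in (\<Pi>\<^sub>M i\<in>I. gamma_measure (p i)). \<forall>i\<in>I. 0 \<le> z i"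
    by (rule AE_PiM_gamma_nonneg[OF assms(1) p])
  ultimately show ?thesis
    by eventually_elim (use j assms(1) in \<open>auto intro!: sum_pos2\<close>)
qed

text \<open>The substitution \<open>s = Z r\<close>.\<close>

lemma nn_integral_gamma_rescale:
  assumes "a > 0" "Z > 0" and [measurable]: "h \<in> borel_measurable borel"
  shows "(\<integral>\<^sup>+s. h (s / Z) \<partial>gamma_measure a) =
    (\<integral>\<^sup>+r. ennreal (if 0 < r then Z powr a * r powr (a - 1) * exp (- (Z * r)) / Gamma a else 0) * h r \<partial>lborel)"
proof -
  have "(\<integral>\<^sup>+s. h (s / Z) \<partial>gamma_measure a) =
     (\<integral>\<^sup>+x. ennreal (if 0 < x then x powr (a - 1) * exp (- x) / Gamma a else 0) * h (x / Z) \<partial>lborel)"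
    using assms by (subst nn_integral_gamma_measure) auto
  also have "\<dots> = ennreal Z * (\<integral>\<^sup>+r. ennreal (if 0 < 0 + Z * r then (0 + Z * r) powr (a - 1) * exp (- (0 + Z * r)) / Gamma a else 0) * h ((0 + Z * r) / Z) \<partial>lborel)"
    using assms by (subst nn_integral_real_affine[where c=Z and t=0]) auto
  also have "\<dots> = (\<integral>\<^sup>+r. ennreal Z * (ennreal (if 0 < 0 + Z * r then (0 + Z * r) powr (a - 1) * exp (- (0 + Z * r)) / Gamma a else 0) * h ((0 + Z * r) / Z)) \<partial>lborel)"
    by (subst nn_integral_cmult) (simp_all only: add_0, measurable)
  also have "\<dots> = (\<integral>\<^sup>+r. ennreal (if 0 < r then Z powr a * r powr (a - 1) * exp (- (Z * r)) / Gamma a else 0) * h r \<partial>lborel)"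
  proof (rule nn_integral_cong)
    fix r
    have "Z powr a = Z * Z powr (a - 1)" using \<open>Z > 0\<close> by (simp add: powr_mult_base)
    then have "ennreal Z * ennreal (if 0 < Z * r then (Z * r) powr (a - 1) * exp (- (Z * r)) / Gamma a else 0) =
       ennreal (if 0 < r then Z powr a * r powr (a - 1) * exp (- (Z * r)) / Gamma a else 0)"
      using assms Gamma_real_pos[of a]
      by (subst ennreal_mult[symmetric]) (auto simp: powr_mult zero_less_mult_iff)
    then show "ennreal Z * (ennreal (if 0 < 0 + Z * r then (0 + Z * r) powr (a - 1) * exp (- (0 + Z * r)) / Gamma a else 0) * h ((0 + Z * r) / Z)) =
      ennreal (if 0 < r then Z powr a * r powr (a - 1) * exp (- (Z * r)) / Gamma a else 0) * h r"
      using \<open>Z > 0\<close> by (simp only: add_0 mult.assoc[symmetric]) simp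
  qed
  finally show ?thesis .
qed

text \<open>A vector of independent gamma variables has the same law as its own normalisation multiplied by
  an independent gamma variable \<open>s\<close> whose shape is the sum of the shapes. To see it, put \<open>Z\<close> for the
  sum of the coordinates and substitute \<open>s = Z r\<close>. For fixed \<open>r\<close> rescale the coordinates by \<open>r\<close>;
  what remains of the integral over \<open>r\<close> is a weight that depends on \<open>Z\<close> alone, and the substitution
  \<open>r \<mapsto> Z r\<close> shows that it does not depend on \<open>Z\<close> either. So both sides agree up to a constant factor,
  which must be 1 as both are probability measures.\<close>

lemma nn_integral_gamma_dirichlet:
  fixes p :: "'i \<Rightarrow> real"
  defines "P \<equiv> \<lambda>I. \<Pi>\<^sub>M i\<in>I. gamma_measure (p i)"
  assumes I: "finite I" and p: "\<And>i. i \<in> I \<Longrightarrow> 0 \<le> p i" and a: "a = (\<Sum>i\<in>I. p i)" "a > 0"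
    and f: "f \<in> borel_measurable (P I)"
  shows "(\<integral>\<^sup>+z. (\<integral>\<^sup>+s. f (\<lambda>i\<in>I. s * (z i / (\<Sum>i\<in>I. z i))) \<partial>gamma_measure a) \<partial>P I) = (\<integral>\<^sup>+z. f z \<partial>P I)"
proof -
  have [measurable_cong]: "sets (P I) = sets (\<Pi>\<^sub>M i\<in>I. borel)"
    unfolding P_def by (intro sets_PiM_cong) auto
  interpret P: prob_space "P I"
    unfolding P_def using p by (intro prob_space_PiM prob_space_gamma_measure) auto
  interpret PL: pair_sigma_finite "P I" lborel ..
  define k where "k = (\<lambda>y r. ennreal (if 0 < r then y powr a * r powr (- a - 1) * exp (- (y / r)) / Gamma a else 0))"
  define d where "d = (\<lambda>y r. ennreal (if 0 < r then y powr a * r powr (a - 1) * exp (- (y * r)) / Gamma a else 0))"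
  have [measurable]: "(\<lambda>x. k (g x) (h x)) \<in> borel_measurable M" "(\<lambda>x. d (g x) (h x)) \<in> borel_measurable M"
    if [measurable]: "g \<in> borel_measurable M" "h \<in> borel_measurable M" for g h and M :: "'x measure"
    unfolding k_def d_def by measurable
  have pos: "AE z in P I. 0 < (\<Sum>i\<in>I. z i)"
    unfolding P_def using a by (intro AE_PiM_gamma_sum_pos I p) auto
  have Gam: "Gamma a > 0" using a by simp
  define \<kappa> where "\<kappa> = (\<integral>\<^sup>+r. k 1 r \<partial>lborel)"
  have kappa: "(\<integral>\<^sup>+r. k y r \<partial>lborel) = \<kappa>" if "y > 0" for y
  proof -
    have "(\<integral>\<^sup>+r. k y r \<partial>lborel) = ennreal y * (\<integral>\<^sup>+r. k y (0 + y * r) \<partial>lborel)"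
      using that by (subst nn_integral_real_affine[where c=y and t=0]) auto
    also have "\<dots> = (\<integral>\<^sup>+r. ennreal y * k y (y * r) \<partial>lborel)"
      by (subst nn_integral_cmult) (simp_all only: add_0, measurable)
    also have "\<dots> = \<kappa>"
      unfolding \<kappa>_def
    proof (rule nn_integral_cong)
      fix r
      have "y * (y powr a * (y * r) powr (- a - 1)) = r powr (-a-1)" if "r > 0"
        using \<open>y > 0\<close> that by (simp add: powr_mult powr_diff powr_minus field_simps)
      then show "ennreal y * k y (y * r) = k 1 r"
        unfolding k_def using \<open>y > 0\<close> Gam
        by (subst ennreal_mult[symmetric]) (auto simp: zero_less_mult_iff mult.assoc[symmetric] intro!: arg_cong[where f=ennreal])
    qed
    finally show ?thesis .
  qed
  have main: "(\<integral>\<^sup>+z. (\<integral>\<^sup>+s. f (\<lambda>i\<in>I. s * (z i / (\<Sum>i\<in>I. z i))) \<partial>gamma_measure a) \<partial>P I) = \<kappa> * (\<integral>\<^sup>+z. f z \<partial>P I)"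
    if [measurable]: "f \<in> borel_measurable (P I)" for f
  proof -
    have "(\<integral>\<^sup>+z. (\<integral>\<^sup>+s. f (\<lambda>i\<in>I. s * (z i / (\<Sum>i\<in>I. z i))) \<partial>gamma_measure a) \<partial>P I) =
        (\<integral>\<^sup>+z. (\<integral>\<^sup>+r. d (\<Sum>i\<in>I. z i) r * f (\<lambda>i\<in>I. r * z i) \<partial>lborel) \<partial>P I)"
      using pos
    proof (intro nn_integral_cong_AE, eventually_elim)
      case (elim z)
      have [measurable]: "(\<lambda>r. f (\<lambda>i\<in>I. r * z i)) \<in> borel_measurable borel"
        by (intro measurable_compose[OF _ that] measurable_restrict) measurable
      have "0 < (\<Sum>i\<in>I. z i)" using elim by simp
      then show ?case
        using nn_integral_gamma_rescale[OF a(2), of "\<Sum>i\<in>I. z i" "\<lambda>r. f (\<lambda>i\<in>I. r * z i)"]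
        by (simp add: d_def)
    qed
    also have "\<dots> = (\<integral>\<^sup>+r. (\<integral>\<^sup>+z. d (\<Sum>i\<in>I. z i) r * f (\<lambda>i\<in>I. r * z i) \<partial>P I) \<partial>lborel)"
      by (rule PL.Fubini'[symmetric]) measurable
    also have "\<dots> = (\<integral>\<^sup>+r. (\<integral>\<^sup>+z. k (\<Sum>i\<in>I. z i) r * f z \<partial>P I) \<partial>lborel)"
    proof (rule nn_integral_cong)
      fix r
      show "(\<integral>\<^sup>+z. d (\<Sum>i\<in>I. z i) r * f (\<lambda>i\<in>I. r * z i) \<partial>P I) = (\<integral>\<^sup>+z. k (\<Sum>i\<in>I. z i) r * f z \<partial>P I)"
      proof (cases "r > 0")
        case False
        then show ?thesis by (simp add: k_def d_def)
      next
        case True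
        have "(\<integral>\<^sup>+z. k (\<Sum>i\<in>I. z i) r * f z \<partial>P I) =
          (\<integral>\<^sup>+z. ennreal (r powr (\<Sum>i\<in>I. p i) * exp (- (r - 1) * (\<Sum>i\<in>I. z i))) *
             (k (\<Sum>i\<in>I. (\<lambda>i\<in>I. r * z i) i) r * f (\<lambda>i\<in>I. r * z i)) \<partial>P I)"
          using I p True unfolding P_def
          by (subst PiM_gamma_scale) (auto simp: P_def[symmetric])
        also have "\<dots> = (\<integral>\<^sup>+z. d (\<Sum>i\<in>I. z i) r * f (\<lambda>i\<in>I. r * z i) \<partial>P I)"
          using pos
        proof (intro nn_integral_cong_AE, eventually_elim)
          case (elim z)
          define Z where "Z = (\<Sum>i\<in>I. z i)"
          have Z: "Z > 0" using elim by (simp add: Z_def)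
          have rZ: "(\<Sum>i\<in>I. (\<lambda>i\<in>I. r * z i) i) = r * Z" by (simp add: Z_def sum_distrib_left)
          have "r powr a * exp (- (r - 1) * Z) * ((r * Z) powr a * r powr (- a - 1) * exp (- (r * Z / r)) / Gamma a) =
             Z powr a * (r powr a * r powr a * r powr (- a - 1)) * (exp (- (r - 1) * Z) * exp (-Z)) / Gamma a"
            using True Z by (simp add: powr_mult)
          also have "r powr a * r powr a * r powr (- a - 1) = r powr (a - 1)"
            using True by (simp flip: powr_add)
          also have "exp (- (r - 1) * Z) * exp (-Z) = exp (- (Z * r))"
            by (simp add: algebra_simps flip: exp_add)
          finally have "ennreal (r powr a * exp (- (r - 1) * Z)) * k (r * Z) r = d Z r"
            unfolding k_def d_def using True Gam by (subst ennreal_mult[symmetric]) auto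
          then show ?case
            unfolding rZ Z_def[symmetric] a(1)[symmetric] by (metis mult.assoc)
        qed
        finally show ?thesis ..
      qed
    qed
    also have "\<dots> = (\<integral>\<^sup>+z. (\<integral>\<^sup>+r. k (\<Sum>i\<in>I. z i) r * f z \<partial>lborel) \<partial>P I)"
      by (rule PL.Fubini') measurable
    also have "\<dots> = (\<integral>\<^sup>+z. \<kappa> * f z \<partial>P I)"
      using pos by (intro nn_integral_cong_AE, eventually_elim) (simp add: nn_integral_multc kappa)
    also have "\<dots> = \<kappa> * (\<integral>\<^sup>+z. f z \<partial>P I)"
      by (intro nn_integral_cmult that)
    finally show ?thesis .
  qed
  interpret G: prob_space "gamma_measure a"
    using a by (intro prob_space_gamma_measure) auto
  have "\<kappa> = 1"
    using main[of "\<lambda>_. 1"] by (simp add: P.emeasure_space_1 G.emeasure_space_1[simplified])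
  then show ?thesis using main[OF f] by simp
qed

lemma distr_gamma_dirichlet:
  fixes p :: "'i \<Rightarrow> real" and I :: "'i set"
  defines "P \<equiv> \<Pi>\<^sub>M i\<in>I. gamma_measure (p i)"
  assumes I: "finite I" and p: "\<And>i. i \<in> I \<Longrightarrow> 0 \<le> p i" and a: "a = (\<Sum>i\<in>I. p i)" "a > 0"
  shows "distr (P \<Otimes>\<^sub>M gamma_measure a) P (\<lambda>(z, s). \<lambda>i\<in>I. s * (z i / (\<Sum>i\<in>I. z i))) = P"
proof (rule measure_eqI)
  have [measurable_cong]: "sets P = sets (\<Pi>\<^sub>M i\<in>I. borel)"
    unfolding P_def by (intro sets_PiM_cong) auto
  interpret P: prob_space P
    unfolding P_def using p by (intro prob_space_PiM prob_space_gamma_measure) auto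
  interpret G: prob_space "gamma_measure a"
    using a by (intro prob_space_gamma_measure) auto
  fix A assume "A \<in> sets (distr (P \<Otimes>\<^sub>M gamma_measure a) P (\<lambda>(z, s). \<lambda>i\<in>I. s * (z i / (\<Sum>i\<in>I. z i))))"
  then have A [measurable]: "A \<in> sets P" by simp
  have [measurable]: "(\<lambda>(z, s). \<lambda>i\<in>I. s * (z i / (\<Sum>i\<in>I. z i))) \<in> P \<Otimes>\<^sub>M gamma_measure a \<rightarrow>\<^sub>M P"
    by measurable
  have "emeasure (distr (P \<Otimes>\<^sub>M gamma_measure a) P (\<lambda>(z, s). \<lambda>i\<in>I. s * (z i / (\<Sum>i\<in>I. z i)))) A =
      (\<integral>\<^sup>+x. indicator A ((\<lambda>(z, s). \<lambda>i\<in>I. s * (z i / (\<Sum>i\<in>I. z i))) x) \<partial>(P \<Otimes>\<^sub>M gamma_measure a))"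
    by (subst nn_integral_indicator[symmetric], simp, subst nn_integral_distr) auto
  also have "\<dots> = (\<integral>\<^sup>+z. (\<integral>\<^sup>+s. indicator A (\<lambda>i\<in>I. s * (z i / (\<Sum>i\<in>I. z i))) \<partial>gamma_measure a) \<partial>P)"
    by (subst G.nn_integral_fst[symmetric]) auto
  also have "\<dots> = (\<integral>\<^sup>+z. indicator A z \<partial>P)"
    using I p a A unfolding P_def by (intro nn_integral_gamma_dirichlet) auto
  finally show "emeasure (distr (P \<Otimes>\<^sub>M gamma_measure a) P (\<lambda>(z, s). \<lambda>i\<in>I. s * (z i / (\<Sum>i\<in>I. z i)))) A = emeasure P A"
    by simp
qed simp

text \<open>A gamma variable times an independent beta variable is a gamma variable of smaller shape: substitute
  \<open>x = u s\<close> for \<open>u\<close> and then \<open>s = x + v\<close> for \<open>s\<close>, after which the powers of \<open>s\<close> cancel and the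
  integral over \<open>v\<close> is a gamma integral.\<close>

lemma nn_integral_beta_gamma:
  assumes c: "c > 0" and b: "b > 0" and f [measurable]: "f \<in> borel_measurable borel"
  shows "(\<integral>\<^sup>+u. (\<integral>\<^sup>+s. f (u * s) \<partial>gamma_measure (c + b)) \<partial>beta_measure c b) = (\<integral>\<^sup>+x. f x \<partial>gamma_measure c)"
proof -
  define B where "B = (\<lambda>u. ennreal (if 0 < u \<and> u < 1
       then Gamma (c + b) / (Gamma c * Gamma b) * u powr (c - 1) * (1 - u) powr (b - 1) else 0))"
  define D where "D = (\<lambda>a x. ennreal (if 0 < x then x powr (a - 1) * exp (- x) / Gamma a else 0))"
  have [measurable]: "B \<in> borel_measurable borel" "D a \<in> borel_measurable borel" for a
    unfolding B_def D_def by measurable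
  have G: "Gamma c > 0" "Gamma b > 0" "Gamma (c + b) > 0" using b c by auto
  have "(\<integral>\<^sup>+u. (\<integral>\<^sup>+s. f (u * s) \<partial>gamma_measure (c + b)) \<partial>beta_measure c b) =
      (\<integral>\<^sup>+u. B u * (\<integral>\<^sup>+s. D (c + b) s * f (u * s) \<partial>lborel) \<partial>lborel)"
    using b c unfolding beta_measure_def B_def D_def
    by (simp add: nn_integral_density nn_integral_gamma_measure)
  also have "\<dots> = (\<integral>\<^sup>+u. (\<integral>\<^sup>+s. B u * (D (c + b) s * f (u * s)) \<partial>lborel) \<partial>lborel)"
    by (intro nn_integral_cong) (simp add: nn_integral_cmult)
  also have "\<dots> = (\<integral>\<^sup>+s. (\<integral>\<^sup>+u. B u * (D (c + b) s * f (u * s)) \<partial>lborel) \<partial>lborel)"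
    by (rule lborel_pair.Fubini'[symmetric]) measurable
  also have "\<dots> = (\<integral>\<^sup>+s. (\<integral>\<^sup>+x. ennreal (inverse s) * (B (x / s) * (D (c + b) s * f x)) \<partial>lborel) \<partial>lborel)"
  proof (rule nn_integral_cong)
    fix s :: real
    show "(\<integral>\<^sup>+u. B u * (D (c + b) s * f (u * s)) \<partial>lborel) = (\<integral>\<^sup>+x. ennreal (inverse s) * (B (x / s) * (D (c + b) s * f x)) \<partial>lborel)"
    proof (cases "s > 0")
      case False
      then show ?thesis by (simp add: D_def)
    next
      case True
      have "(\<integral>\<^sup>+u. B u * (D (c + b) s * f (u * s)) \<partial>lborel) =
          ennreal (inverse s) * (\<integral>\<^sup>+x. B (0 + inverse s * x) * (D (c + b) s * f ((0 + inverse s * x) * s)) \<partial>lborel)"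
        using True by (subst nn_integral_real_affine[where c="inverse s" and t=0]) auto
      also have "\<dots> = ennreal (inverse s) * (\<integral>\<^sup>+x. B (x / s) * (D (c + b) s * f x) \<partial>lborel)"
      proof -
        have "0 + inverse s * x = x / s" "x / s * s = x" for x
          using True by (auto simp: field_simps)
        then show ?thesis by (simp only:)
      qed
      finally show ?thesis by (simp add: nn_integral_cmult)
    qed
  qed
  also have "\<dots> = (\<integral>\<^sup>+x. (\<integral>\<^sup>+s. ennreal (inverse s) * (B (x / s) * (D (c + b) s * f x)) \<partial>lborel) \<partial>lborel)"
    by (rule lborel_pair.Fubini') measurable
  also have "\<dots> = (\<integral>\<^sup>+x. D c x * f x \<partial>lborel)"
  proof (rule nn_integral_cong)
    fix x :: real
    show "(\<integral>\<^sup>+s. ennreal (inverse s) * (B (x / s) * (D (c + b) s * f x)) \<partial>lborel) = D c x * f x"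
    proof (cases "x > 0")
      case False
      have "ennreal (inverse s) * (B (x / s) * (D (c + b) s * f x)) = 0" for s
        using False by (cases "s > 0") (auto simp: B_def D_def zero_less_divide_iff)
      moreover have "D c x = 0" using False by (simp add: D_def)
      ultimately show ?thesis by (simp only:) simp
    next
      case True
      define E where "E = (\<lambda>v. ennreal (if 0 < v then v powr (b - 1) * exp (- v) else 0))"
      have [measurable]: "E \<in> borel_measurable borel" unfolding E_def by measurable
      have "(\<integral>\<^sup>+s. ennreal (inverse s) * (B (x / s) * (D (c + b) s * f x)) \<partial>lborel) =
         (\<integral>\<^sup>+v. ennreal (inverse (x + v)) * (B (x / (x + v)) * (D (c + b) (x + v) * f x)) \<partial>lborel)"
        by (subst nn_integral_real_affine[where c=1 and t=x]) auto
      also have "\<dots> = (\<integral>\<^sup>+v. D c x * f x * ennreal (1 / Gamma b) * E v \<partial>lborel)"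
      proof (rule nn_integral_cong)
        fix v :: real
        show "ennreal (inverse (x + v)) * (B (x / (x + v)) * (D (c + b) (x + v) * f x)) =
            D c x * f x * ennreal (1 / Gamma b) * E v"
        proof (cases "v > 0")
          case False
          then have "D (c + b) (x + v) = 0 \<or> B (x / (x + v)) = 0"
            using True by (cases "x + v > 0") (auto simp: B_def D_def less_divide_eq)
          then show ?thesis using False by (auto simp: E_def)
        next
          case v: True
          define s where "s = x + v"
          have s: "s > 0" "v = s - x" "x < s" using True v by (auto simp: s_def)
          have 1: "(x / s) powr (c - 1) = x powr (c - 1) * s powr (1 - c)"
            using True s by (simp add: powr_divide powr_minus_divide[symmetric] powr_diff)
          have "(1 - x / s) = v / s" using s by (simp add: field_simps)
          then have 2: "(1 - x / s) powr (b - 1) = v powr (b - 1) * s powr (1 - b)"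
            using v s by (simp add: powr_divide powr_diff)
          have 3: "inverse s * (s powr (1 - c) * s powr (1 - b) * s powr (c + b - 1)) = 1"
            using s by (simp add: powr_minus_divide[symmetric] flip: powr_add)
          have "inverse s * (Gamma (c + b) / (Gamma c * Gamma b) * (x / s) powr (c - 1) * (1 - x / s) powr (b - 1) *
              (s powr (c + b - 1) * exp (- s) / Gamma (c + b))) =
              (inverse s * (s powr (1 - c) * s powr (1 - b) * s powr (c + b - 1))) *
               (x powr (c - 1) * v powr (b - 1) * exp (- s) / (Gamma c * Gamma b))"
            unfolding 1 2 using G by simp
          also have "\<dots> = (x powr (c - 1) * exp (- x) / Gamma c) * (1 / Gamma b) * (v powr (b - 1) * exp (- v))"
            unfolding 3 by (simp add: s_def exp_diff exp_minus exp_add field_simps)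
          finally have "ennreal (inverse s) * (B (x / s) * D (c + b) s) = D c x * ennreal (1 / Gamma b) * E v"
            unfolding B_def D_def E_def using G s True v
            by (simp add: ennreal_mult[symmetric])
          then show ?thesis
            unfolding s_def[symmetric] by (metis (no_types) mult.assoc mult.commute)
        qed
      qed
      also have "\<dots> = D c x * f x * ennreal (1 / Gamma b) * ennreal (Gamma b)"
        using nn_integral_gamma_density[OF b] by (subst nn_integral_cmult) (auto simp: E_def)
      also have "ennreal (1 / Gamma b) * ennreal (Gamma b) = 1"
        using G by (subst ennreal_mult[symmetric]) auto
      then have "D c x * f x * ennreal (1 / Gamma b) * ennreal (Gamma b) = D c x * f x"
        by (simp add: mult.assoc)
      finally show ?thesis .
    qed
  qed
  also have "\<dots> = (\<integral>\<^sup>+x. f x \<partial>gamma_measure c)"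
    using c by (simp add: nn_integral_gamma_measure D_def)
  finally show ?thesis .
qed

lemma sets_beta_measure [simp, measurable_cong]: "sets (beta_measure c b) = sets borel"
  by (simp add: beta_measure_def)

lemma space_beta_measure [simp]: "space (beta_measure c b) = UNIV"
  by (simp add: beta_measure_def)

lemma prob_space_beta_measure:
  assumes "c > 0" "b > 0" shows "prob_space (beta_measure c b)"
proof -
  interpret A: prob_space "gamma_measure (c + b)" using assms by (intro prob_space_gamma_measure) auto
  interpret C: prob_space "gamma_measure c" using assms by (intro prob_space_gamma_measure) auto
  show ?thesis
    using nn_integral_beta_gamma[OF assms, of "\<lambda>_. 1"]
    by (intro prob_spaceI) (simp add: A.emeasure_space_1[simplified] C.emeasure_space_1[simplified])
qed

lemma AE_beta_measure:
  "b \<noteq> 0 \<Longrightarrow> AE u in beta_measure c b. 0 < u \<and> u < 1"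
  unfolding beta_measure_def by (simp add: AE_density)

lemma distr_beta_gamma:
  assumes c: "c > 0" and b: "b > 0"
  shows "distr (beta_measure c b \<Otimes>\<^sub>M gamma_measure (c + b)) borel (\<lambda>(u, s). u * s) = gamma_measure c"
proof (rule measure_eqI)
  interpret A: prob_space "gamma_measure (c + b)" using assms by (intro prob_space_gamma_measure) auto
  fix A assume "A \<in> sets (distr (beta_measure c b \<Otimes>\<^sub>M gamma_measure (c + b)) borel (\<lambda>(u, s). u * s))"
  then have A [measurable]: "A \<in> sets borel" by simp
  have "emeasure (distr (beta_measure c b \<Otimes>\<^sub>M gamma_measure (c + b)) borel (\<lambda>(u, s). u * s)) A =
      (\<integral>\<^sup>+x. indicator A ((\<lambda>(u, s). u * s) x) \<partial>(beta_measure c b \<Otimes>\<^sub>M gamma_measure (c + b)))"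
    by (subst nn_integral_indicator[symmetric], simp, subst nn_integral_distr) auto
  also have "\<dots> = (\<integral>\<^sup>+u. (\<integral>\<^sup>+s. indicator A (u * s) \<partial>gamma_measure (c + b)) \<partial>beta_measure c b)"
    by (subst A.nn_integral_fst[symmetric]) auto
  also have "\<dots> = (\<integral>\<^sup>+x. indicator A x \<partial>gamma_measure c)"
    by (intro nn_integral_beta_gamma assms) auto
  finally show "emeasure (distr (beta_measure c b \<Otimes>\<^sub>M gamma_measure (c + b)) borel (\<lambda>(u, s). u * s)) A = emeasure (gamma_measure c) A"
    by simp
qed simp

text \<open>Euler's integral: both sides are the Laplace transform of the gamma law of shape \<open>c\<close>, the left one
  through its representation as a product.\<close>

lemma beta_integral_powr:
  assumes c: "c > 0" and b: "b > 0" and z: "Re z \<ge> 0"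
  shows "(LINT u|beta_measure c b. (1 + z * complex_of_real u) powr (- complex_of_real (c + b))) =
    (1 + z) powr (- complex_of_real c)"
proof -
  interpret B: prob_space "beta_measure c b" by (intro prob_space_beta_measure assms)
  interpret A: prob_space "gamma_measure (c + b)" using assms by (intro prob_space_gamma_measure) auto
  interpret BA: pair_prob_space "beta_measure c b" "gamma_measure (c + b)" ..
  let ?h = "\<lambda>x. exp (- z * complex_of_real x)"
  have "(1 + z) powr (- complex_of_real c) = (LINT x|gamma_measure c. ?h x)"
    using assms by (subst gamma_measure_laplace(2)) auto
  also have "\<dots> = (LINT x|(beta_measure c b \<Otimes>\<^sub>M gamma_measure (c + b)). ?h (fst x * snd x))"
    by (subst distr_beta_gamma[OF c b, symmetric], subst integral_distr) (auto simp: case_prod_beta)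
  also have "\<dots> = (LINT u|beta_measure c b. LINT s|gamma_measure (c + b). ?h (u * s))"
  proof -
    have "integrable (gamma_measure c) ?h"
      using assms by (intro gamma_measure_laplace(1)) auto
    then have "integrable (distr (beta_measure c b \<Otimes>\<^sub>M gamma_measure (c + b)) borel (\<lambda>(u, s). u * s)) ?h"
      by (simp only: distr_beta_gamma[OF c b])
    then have "integrable (beta_measure c b \<Otimes>\<^sub>M gamma_measure (c + b)) (\<lambda>(u, s). ?h (u * s))"
      by (subst (asm) integrable_distr_eq) (auto simp: case_prod_beta')
    from BA.integral_fst'[OF this] show ?thesis by (simp add: case_prod_beta')
  qed
  also have "\<dots> = (LINT u|beta_measure c b. (1 + z * complex_of_real u) powr (- complex_of_real (c + b)))"
  proof (rule integral_cong_AE)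
    show "AE u in beta_measure c b. (LINT s|gamma_measure (c + b). ?h (u * s)) =
        (1 + z * complex_of_real u) powr (- complex_of_real (c + b))"
      using AE_beta_measure[OF less_imp_neq[OF b, symmetric], of c]
    proof eventually_elim
      case (elim u)
      then have "Re (z * complex_of_real u) \<ge> 0" using z by auto
      then show ?case
        using gamma_measure_laplace(2)[of "c + b" "z * complex_of_real u"] b c by (simp add: mult.assoc)
    qed
  qed auto
  finally show ?thesis ..
qed

section \<open>The Markov-Krein identity\<close>

text \<open>Both sides are the Laplace transform at \<open>z\<close> of \<open>\<Sum> h i * x i\<close> for independent gamma variables
  \<open>x i\<close>: the right one factor by factor, the left one by writing the variables as a gamma
  variable times proportions and integrating that gamma variable first. The condition on
  \<open>h\<close> keeps all exponentials bounded by 1.\<close>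

lemma dirichlet_ratio_transform:
  fixes p h :: "'i \<Rightarrow> real" and I :: "'i set" and z :: complex
  defines "P \<equiv> \<Pi>\<^sub>M i\<in>I. gamma_measure (p i)"
  assumes I: "finite I" and p: "\<And>i. 0 \<le> p i" and a: "a = (\<Sum>i\<in>I. p i)" "a > 0"
    and h: "\<And>i. i \<in> I \<Longrightarrow> 0 \<le> Re (z * complex_of_real (h i))"
  shows "(LINT x|P. (1 + z * complex_of_real ((\<Sum>i\<in>I. h i * x i) / (\<Sum>i\<in>I. x i))) powr (- complex_of_real a)) =
    (\<Prod>i\<in>I. (1 + z * complex_of_real (h i)) powr (- complex_of_real (p i)))"
proof -
  have [measurable_cong]: "sets P = sets (\<Pi>\<^sub>M i\<in>I. borel)"
    unfolding P_def by (intro sets_PiM_cong) auto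
  interpret PS: product_sigma_finite "\<lambda>i. gamma_measure (p i)"
    unfolding product_sigma_finite_def
    using p by (auto intro!: prob_space_imp_sigma_finite prob_space_gamma_measure)
  interpret P: prob_space P
    unfolding P_def using p by (intro prob_space_PiM prob_space_gamma_measure)
  interpret G: prob_space "gamma_measure a"
    using a by (intro prob_space_gamma_measure) auto
  interpret PG: pair_prob_space P "gamma_measure a" ..
  define E where "E = (\<lambda>x. exp (- (z * complex_of_real (\<Sum>i\<in>I. h i * x i))))"
  define m where "m = (\<lambda>x. (\<Sum>i\<in>I. h i * x i) / (\<Sum>i\<in>I. x i))"
  let ?T = "\<lambda>(x, s). \<lambda>i\<in>I. s * (x i / (\<Sum>i\<in>I. x i))"
  have [measurable]: "E \<in> borel_measurable P" "m \<in> borel_measurable P"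
    unfolding E_def m_def by measurable
  have T [measurable]: "?T \<in> P \<Otimes>\<^sub>M gamma_measure a \<rightarrow>\<^sub>M P" by measurable
  have nonneg: "AE x in P. \<forall>i\<in>I. 0 \<le> x i"
    unfolding P_def using I p by (rule AE_PiM_gamma_nonneg)
  have re: "0 \<le> Re (z * complex_of_real (\<Sum>i\<in>I. h i * x i))" if "\<forall>i\<in>I. 0 \<le> x i" for x
  proof -
    have "Re (z * complex_of_real (\<Sum>i\<in>I. h i * x i)) = (\<Sum>i\<in>I. Re (z * complex_of_real (h i)) * x i)"
      by (simp add: sum_distrib_left algebra_simps)
    also have "\<dots> \<ge> 0" using that h by (intro sum_nonneg mult_nonneg_nonneg) auto
    finally show ?thesis .
  qed
  have intE: "integrable P E"
  proof (rule P.integrable_const_bound[where B=1])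
    show "AE x in P. norm (E x) \<le> 1"
      using nonneg by eventually_elim (use re in \<open>simp add: E_def\<close>)
  qed simp
  have "(\<Prod>i\<in>I. (1 + z * complex_of_real (h i)) powr (- complex_of_real (p i))) =
      (\<Prod>i\<in>I. LINT x|gamma_measure (p i). exp (- (z * complex_of_real (h i)) * complex_of_real x))"
  proof (intro prod.cong refl)
    fix i assume "i \<in> I"
    then show "(1 + z * complex_of_real (h i)) powr (- complex_of_real (p i)) =
       (LINT x|gamma_measure (p i). exp (- (z * complex_of_real (h i)) * complex_of_real x))"
      using gamma_measure_laplace(2)[OF p, of "z * complex_of_real (h i)" i] h[of i] by simp
  qed
  also have "\<dots> = (LINT x|P. (\<Prod>i\<in>I. exp (- (z * complex_of_real (h i)) * complex_of_real (x i))))"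
    unfolding P_def
  proof (intro PS.product_integral_prod[symmetric] I)
    fix i assume "i \<in> I"
    then show "integrable (gamma_measure (p i)) (\<lambda>x. exp (- (z * complex_of_real (h i)) * complex_of_real x))"
      using h[of i] by (intro gamma_measure_laplace(1) p) auto
  qed
  also have "\<dots> = (LINT x|P. E x)"
    unfolding E_def using I by (simp add: exp_sum sum_distrib_left sum_negf[symmetric] mult.assoc)
  also have "\<dots> = (LINT y|(P \<Otimes>\<^sub>M gamma_measure a). E (?T y))"
    using distr_gamma_dirichlet[OF I p a] integral_distr[OF T, of E] by (simp add: P_def[symmetric])
  also have "\<dots> = (LINT y|(P \<Otimes>\<^sub>M gamma_measure a). exp (- (z * complex_of_real (m (fst y))) * complex_of_real (snd y)))"
  proof (intro Bochner_Integration.integral_cong refl)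
    fix y :: "('i \<Rightarrow> real) \<times> real"
    have "(\<Sum>i\<in>I. h i * (?T y) i) = m (fst y) * snd y"
      by (simp add: m_def case_prod_beta sum_divide_distrib sum_distrib_right sum_distrib_left mult_ac)
    then show "E (?T y) = exp (- (z * complex_of_real (m (fst y))) * complex_of_real (snd y))"
      unfolding E_def by (simp add: mult.assoc)
  qed
  also have "\<dots> = (LINT x|P. LINT s|gamma_measure a. exp (- (z * complex_of_real (m x)) * complex_of_real s))"
  proof -
    have "integrable (distr (P \<Otimes>\<^sub>M gamma_measure a) P ?T) E"
      using distr_gamma_dirichlet[OF I p a] intE by (simp add: P_def[symmetric])
    then have "integrable (P \<Otimes>\<^sub>M gamma_measure a) (\<lambda>y. E (?T y))"
      by (subst (asm) integrable_distr_eq) auto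
    also have "(\<lambda>y. E (?T y)) = (\<lambda>(x, s). exp (- (z * complex_of_real (m x)) * complex_of_real s))"
    proof (intro ext)
      fix y :: "('i \<Rightarrow> real) \<times> real"
      have "(\<Sum>i\<in>I. h i * (?T y) i) = m (fst y) * snd y"
        by (simp add: m_def case_prod_beta sum_divide_distrib sum_distrib_right sum_distrib_left mult_ac)
      then show "E (?T y) = (case y of (x, s) \<Rightarrow> exp (- (z * complex_of_real (m x)) * complex_of_real s))"
        unfolding E_def by (simp add: mult.assoc case_prod_beta)
    qed
    finally show ?thesis by (subst PG.integral_fst'[symmetric]) (auto simp: case_prod_beta)
  qed
  also have "\<dots> = (LINT x|P. (1 + z * complex_of_real (m x)) powr (- complex_of_real a))"
  proof (rule integral_cong_AE)
    show "AE x in P. (LINT s|gamma_measure a. exp (- (z * complex_of_real (m x)) * complex_of_real s)) =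
        (1 + z * complex_of_real (m x)) powr (- complex_of_real a)"
      using nonneg
    proof eventually_elim
      case (elim x)
      have "Re (z * complex_of_real (m x)) = Re (z * complex_of_real (\<Sum>i\<in>I. h i * x i)) / (\<Sum>i\<in>I. x i)"
        by (simp add: m_def)
      also have "\<dots> \<ge> 0" using elim re[OF elim] by (intro divide_nonneg_nonneg sum_nonneg) auto
      finally show ?case using a by (intro gamma_measure_laplace(2)) auto
    qed
  qed auto
  finally show ?thesis unfolding m_def ..
qed

text \<open>The level sets of a simple function form a finite partition, to which the definition of the
  Dirichlet process applies. That definition gives the law of all but one of the masses of the
  parts; the last mass is recovered from the total mass 1.\<close>

lemma dirichlet_process_simple_transform:
  fixes h :: "real \<Rightarrow> real" and z :: complex
  assumes dp: "dirichlet_process M \<phi> \<alpha>" and sets_\<alpha>: "sets \<alpha> = sets borel" and fin: "finite_measure \<alpha>"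
    and a: "measure \<alpha> UNIV = a" "a > 0"
    and h: "simple_function borel h" and re: "\<And>x. 0 \<le> Re (z * complex_of_real (h x))"
  shows "(LINT \<omega>|M. (1 + z * complex_of_real (LINT x|\<phi> \<omega>. h x)) powr (- complex_of_real a)) =
    exp (- (LINT x|\<alpha>. Ln (1 + z * complex_of_real (h x))))"
proof -
  interpret M: prob_space M using dp by (simp add: dirichlet_process_def)
  interpret \<alpha>: finite_measure \<alpha> by fact
  have space_\<alpha>: "space \<alpha> = UNIV" using sets_eq_imp_space_eq[OF sets_\<alpha>] by simp
  note [measurable_cong] = sets_\<alpha>
  have \<phi> [measurable]: "\<phi> \<in> M \<rightarrow>\<^sub>M prob_algebra borel" using dp by (simp add: dirichlet_process_def)
  have [measurable]: "h \<in> borel_measurable borel" using h by (rule borel_measurable_simple_function)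
  have finr: "finite (range h)" using simple_functionD(1)[OF h] by simp
  define n where "n = card (range h) - 1"
  have "card (range h) > 0" using finr by (simp add: card_gt_0_iff)
  then have card: "card (range h) = n + 1" unfolding n_def by simp
  obtain e where e: "bij_betw e {1..n+1} (range h)"
    using ex_bij_betw_nat_finite_1[OF finr] unfolding card by blast
  define C where "C i = h -` {e i}" for i
  have C [measurable]: "C i \<in> sets borel" for i
    using simple_functionD(2)[OF h, of "{e i}"] by (simp add: C_def)
  have disj: "disjoint_family_on C {1..n+1}"
    using bij_betw_imp_inj_on[OF e] by (auto simp: disjoint_family_on_def C_def inj_on_def)
  have un: "(\<Union>i\<in>{1..n+1}. C i) = UNIV"
  proof -
    have "\<exists>i\<in>{1..n+1}. h x = e i" for x
      using bij_betw_imp_surj_on[OF e] by (metis imageE rangeI)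
    then show ?thesis by (auto simp: C_def)
  qed
  have hx: "g (h x) = (\<Sum>i\<in>{1..n+1}. indicator (C i) x *\<^sub>R g (e i))"
    for x and g :: "real \<Rightarrow> 'b::real_vector"
  proof -
    obtain j where j: "j \<in> {1..n+1}" "x \<in> C j" using un by blast
    have "indicator (C i) x *\<^sub>R g (e i) = (if i = j then g (h x) else 0)" if "i \<in> {1..n+1}" for i
      using j that bij_betw_imp_inj_on[OF e] by (auto simp: C_def indicator_def inj_on_def)
    then show ?thesis using j by simp
  qed
  have integral_h: "(LINT x|N. g (h x)) = (\<Sum>i\<in>{1..n+1}. measure N (C i) *\<^sub>R g (e i))"
    if N: "sets N = sets borel" "finite_measure N"
    for N :: "real measure" and g :: "real \<Rightarrow> 'b::{banach, second_countable_topology}"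
  proof -
    interpret N: finite_measure N by fact
    have "C i \<in> sets N" for i using C N by simp
    then show ?thesis
      unfolding hx[of g] by (subst Bochner_Integration.integral_sum) (auto simp: N.emeasure_eq_measure sets_eq_imp_space_eq[OF N(1)])
  qed
  have \<phi>_space: "sets (\<phi> \<omega>) = sets borel" "prob_space (\<phi> \<omega>)" if "\<omega> \<in> space M" for \<omega>
    using measurable_space[OF \<phi> that] by (auto simp: space_prob_algebra)
  have sum_1: "(\<Sum>i\<in>{1..n+1}. measure (\<phi> \<omega>) (C i)) = 1" if "\<omega> \<in> space M" for \<omega>
  proof -
    interpret prob_space "\<phi> \<omega>" by (rule \<phi>_space(2)[OF that])
    show ?thesis
      using integral_h[OF \<phi>_space(1)[OF that] finite_measure_axioms, of "\<lambda>_. 1::real"]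
      by (simp add: prob_space)
  qed
  define p where "p i = measure \<alpha> (C i)" for i
  have p: "p i \<ge> 0" for i by (simp add: p_def)
  have sum_p: "a = (\<Sum>i\<in>{1..n+1}. p i)"
    using integral_h[OF sets_\<alpha> fin, of "\<lambda>_. 1::real"] a space_\<alpha> by (simp add: p_def)
  define P where "P = (\<Pi>\<^sub>M i\<in>{1..n+1}. gamma_measure (p i))"
  have setsP [measurable_cong]: "sets P = sets (\<Pi>\<^sub>M i\<in>{1..n+1}. borel)"
    unfolding P_def by (intro sets_PiM_cong) auto
  let ?B = "\<Pi>\<^sub>M i\<in>{1..n}. (borel :: real measure)"
  have law: "distr M ?B (\<lambda>\<omega>. \<lambda>i\<in>{1..n}. measure (\<phi> \<omega>) (C i)) =
      distr P ?B (\<lambda>z. \<lambda>i\<in>{1..n}. z i / (\<Sum>j\<in>{1..n+1}. z j))"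
    using dp C disj un unfolding dirichlet_process_def dirichlet_measure_def P_def p_def by blast
  define G where "G d = (1 + z * complex_of_real ((\<Sum>i\<in>{1..n}. e i * d i) + e (n + 1) * (1 - (\<Sum>i\<in>{1..n}. d i))))
      powr (- complex_of_real a)" for d :: "nat \<Rightarrow> real"
  have [measurable]: "G \<in> borel_measurable ?B" unfolding G_def by measurable
  have [measurable]: "(\<lambda>\<omega>. \<lambda>i\<in>{1..n}. measure (\<phi> \<omega>) (C i)) \<in> M \<rightarrow>\<^sub>M ?B"
    by measurable
  have [measurable]: "(\<lambda>z. \<lambda>i\<in>{1..n}. z i / (\<Sum>j\<in>{1..n+1}. z j)) \<in> P \<rightarrow>\<^sub>M ?B"
    by measurable
  have "(LINT \<omega>|M. (1 + z * complex_of_real (LINT x|\<phi> \<omega>. h x)) powr (- complex_of_real a)) =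
      (LINT \<omega>|M. G (\<lambda>i\<in>{1..n}. measure (\<phi> \<omega>) (C i)))"
  proof (intro Bochner_Integration.integral_cong refl)
    fix \<omega> assume \<omega>: "\<omega> \<in> space M"
    interpret prob_space "\<phi> \<omega>" by (rule \<phi>_space(2)[OF \<omega>])
    have "(LINT x|\<phi> \<omega>. h x) = (\<Sum>i\<in>{1..n+1}. measure (\<phi> \<omega>) (C i) *\<^sub>R e i)"
      using integral_h[OF \<phi>_space(1)[OF \<omega>] finite_measure_axioms, of "\<lambda>x. x"] by simp
    also have "\<dots> = (\<Sum>i\<in>{1..n}. e i * measure (\<phi> \<omega>) (C i)) + e (n + 1) * (1 - (\<Sum>i\<in>{1..n}. measure (\<phi> \<omega>) (C i)))"
    proof -
      have "1 - (\<Sum>i\<in>{1..n}. measure (\<phi> \<omega>) (C i)) = measure (\<phi> \<omega>) (C (n + 1))"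
        using sum_1[OF \<omega>] by simp
      then show ?thesis by (simp add: mult.commute)
    qed
    finally show "(1 + z * complex_of_real (LINT x|\<phi> \<omega>. h x)) powr (- complex_of_real a) =
        G (\<lambda>i\<in>{1..n}. measure (\<phi> \<omega>) (C i))"
      by (simp add: G_def)
  qed
  also have "\<dots> = (LINT d|distr M ?B (\<lambda>\<omega>. \<lambda>i\<in>{1..n}. measure (\<phi> \<omega>) (C i)). G d)"
    by (intro integral_distr[symmetric]) measurable
  also have "\<dots> = (LINT x|P. G (\<lambda>i\<in>{1..n}. x i / (\<Sum>j\<in>{1..n+1}. x j)))"
    unfolding law by (intro integral_distr) measurable
  also have "\<dots> = (LINT x|P. (1 + z * complex_of_real ((\<Sum>i\<in>{1..n+1}. e i * x i) / (\<Sum>i\<in>{1..n+1}. x i))) powr (- complex_of_real a))"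
  proof (rule integral_cong_AE)
    have "AE x in P. 0 < (\<Sum>i\<in>{1..n+1}. x i)"
      unfolding P_def using p sum_p a by (intro AE_PiM_gamma_sum_pos) auto
    then show "AE x in P. G (\<lambda>i\<in>{1..n}. x i / (\<Sum>j\<in>{1..n+1}. x j)) =
        (1 + z * complex_of_real ((\<Sum>i\<in>{1..n+1}. e i * x i) / (\<Sum>i\<in>{1..n+1}. x i))) powr (- complex_of_real a)"
    proof eventually_elim
      case (elim x)
      define Z where "Z = (\<Sum>i\<in>{1..n+1}. x i)"
      have Z: "Z > 0" using elim by (simp add: Z_def)
      have "1 - (\<Sum>i\<in>{1..n}. x i / Z) = (Z - (\<Sum>i\<in>{1..n}. x i)) / Z"
        using Z by (simp add: sum_divide_distrib[symmetric] diff_divide_distrib)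
      also have "\<dots> = x (n + 1) / Z" by (simp add: Z_def)
      finally have "(\<Sum>i\<in>{1..n}. e i * (x i / Z)) + e (n + 1) * (1 - (\<Sum>i\<in>{1..n}. x i / Z)) =
          (\<Sum>i\<in>{1..n+1}. e i * x i) / Z"
        by (simp add: sum_divide_distrib add_divide_distrib)
      then show ?case unfolding G_def Z_def[symmetric] by simp
    qed
  qed (measurable)
  also have "\<dots> = (\<Prod>i\<in>{1..n+1}. (1 + z * complex_of_real (e i)) powr (- complex_of_real (p i)))"
    unfolding P_def
  proof (rule dirichlet_ratio_transform[OF _ p sum_p a(2)])
    fix i assume "i \<in> {1..n+1}"
    then have "e i \<in> range h" using e by (auto simp: bij_betw_def)
    then show "0 \<le> Re (z * complex_of_real (e i))" using re by auto
  qed simp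
  also have "\<dots> = (\<Prod>i\<in>{1..n+1}. exp (- (measure \<alpha> (C i) *\<^sub>R Ln (1 + z * complex_of_real (e i)))))"
  proof (intro prod.cong refl)
    fix i assume "i \<in> {1..n+1}"
    then have "e i \<in> range h" using e by (auto simp: bij_betw_def)
    then have "0 \<le> Re (z * complex_of_real (e i))" using re by auto
    then have "1 + z * complex_of_real (e i) \<noteq> 0"
      by (metis add_le_same_cancel1 add_0 not_one_le_zero plus_complex.sel(1) one_complex.sel(1) zero_complex.sel(1) add_increasing2 le_add_same_cancel1 order_refl)
    then show "(1 + z * complex_of_real (e i)) powr (- complex_of_real (p i)) =
        exp (- (measure \<alpha> (C i) *\<^sub>R Ln (1 + z * complex_of_real (e i))))"
      by (simp add: powr_def p_def scaleR_conv_of_real)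
  qed
  also have "\<dots> = exp (- (\<Sum>i\<in>{1..n+1}. measure \<alpha> (C i) *\<^sub>R Ln (1 + z * complex_of_real (e i))))"
    by (subst exp_sum[symmetric]) (simp_all only: sum_negf finite_atLeastAtMost)
  also have "\<dots> = exp (- (LINT x|\<alpha>. Ln (1 + z * complex_of_real (h x))))"
    by (subst integral_h[OF sets_\<alpha> fin, of "\<lambda>x. Ln (1 + z * complex_of_real x)"]) simp
  finally show ?thesis .
qed

text \<open>Let \<open>h i\<close> be simple functions tending to \<open>\<bar>x\<bar>\<close> and let \<open>N\<close> be the event that the integral of
  \<open>\<bar>x\<bar>\<close> is infinite. On \<open>N\<close> the integrals \<open>m i\<close> of \<open>h i\<close> tend to infinity by Fatou's lemma, so
  \<open>(1 + u m i) powr - a\<close> tends to 0 there. The expectations of these variables are bounded below by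
  \<open>exp (- \<integral> ln (1 + 2 u \<bar>x\<bar>) \<alpha>(dx))\<close> according to \<open>dirichlet_process_simple_transform\<close>, as
  \<open>h i x \<le> 2 \<bar>x\<bar>\<close>. Hence this is a lower bound for the probability of the complement of \<open>N\<close>, and it
  tends to 1 as \<open>u\<close> tends to 0.\<close>

lemma dirichlet_process_integrable_mean:
  assumes "a > 0" and \<alpha>: "\<alpha> \<in> log_finite_measures a" and dp: "dirichlet_process M \<phi> \<alpha>"
  shows "AE \<omega> in M. integrable (\<phi> \<omega>) (\<lambda>x. x)"
proof -
  have sets_\<alpha>: "sets \<alpha> = sets borel" and fin: "finite_measure \<alpha>" and a: "measure \<alpha> UNIV = a"
    and int_ln: "integrable \<alpha> (\<lambda>x. ln (1 + \<bar>x\<bar>))"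
    using \<alpha> by (auto simp: log_finite_measures_def)
  interpret M: prob_space M using dp by (simp add: dirichlet_process_def)
  interpret \<alpha>: finite_measure \<alpha> by fact
  note [measurable_cong] = sets_\<alpha>
  have \<phi> [measurable]: "\<phi> \<in> M \<rightarrow>\<^sub>M prob_algebra borel" using dp by (simp add: dirichlet_process_def)
  have \<phi>' [measurable]: "\<phi> \<in> M \<rightarrow>\<^sub>M subprob_algebra borel" using \<phi> by (rule measurable_prob_algebraD)
  have \<phi>_space: "sets (\<phi> \<omega>) = sets borel" "prob_space (\<phi> \<omega>)" if "\<omega> \<in> space M" for \<omega>
    using measurable_space[OF \<phi> that] by (auto simp: space_prob_algebra)
  obtain F :: "nat \<Rightarrow> real \<Rightarrow> real" where F: "\<And>i. simple_function borel (F i)"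
    "\<And>x. (\<lambda>i. F i x) \<longlonglongrightarrow> \<bar>x\<bar>" "\<And>i x. \<bar>F i x\<bar> \<le> 2 * \<bar>x\<bar>"
    using borel_measurable_implies_sequence_metric[of "\<lambda>x::real. \<bar>x\<bar>" borel 0] by auto
  define h where "h i x = \<bar>F i x\<bar>" for i x
  have h: "simple_function borel (h i)" "h i x \<ge> 0" "h i x \<le> 2 * \<bar>x\<bar>" for i x
    using F unfolding h_def by (auto intro: simple_function_compose1[where g=abs])
  have h_lim: "(\<lambda>i. h i x) \<longlonglongrightarrow> \<bar>x\<bar>" for x
    using tendsto_rabs[OF F(2)[of x]] by (simp add: h_def)
  have [measurable]: "h i \<in> borel_measurable borel" for i using h(1) by (rule borel_measurable_simple_function)
  define m where "m i \<omega> = (LINT x|\<phi> \<omega>. h i x)" for i \<omega>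
  have [measurable]: "m i \<in> borel_measurable M" for i
    unfolding m_def by measurable
  have m_nonneg: "m i \<omega> \<ge> 0" for i \<omega>
    unfolding m_def using h by (intro integral_nonneg_AE) auto
  define N where "N = {\<omega> \<in> space M. (\<integral>\<^sup>+x. ennreal \<bar>x\<bar> \<partial>\<phi> \<omega>) = \<infinity>}"
  have N [measurable]: "N \<in> sets M" unfolding N_def by measurable
  have int2: "integrable \<alpha> (\<lambda>x. ln (1 + 2 * u * \<bar>x\<bar>))"
    and int2': "\<And>x. \<bar>ln (1 + 2 * u * \<bar>x\<bar>)\<bar> \<le> ln 2 + ln (1 + \<bar>x\<bar>)" if u: "0 \<le> u" "u \<le> 1" for u
  proof -
    show bd: "\<bar>ln (1 + 2 * u * \<bar>x\<bar>)\<bar> \<le> ln 2 + ln (1 + \<bar>x\<bar>)" for x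
    proof -
      have "0 \<le> 2 * u * \<bar>x\<bar>" using u by simp
      moreover have "u * \<bar>x\<bar> \<le> 1 * \<bar>x\<bar>" using u by (intro mult_right_mono) auto
      ultimately have "\<bar>ln (1 + 2 * u * \<bar>x\<bar>)\<bar> \<le> ln (2 * (1 + \<bar>x\<bar>))" by simp
      moreover have "ln (2 * (1 + \<bar>x\<bar>)) = ln 2 + ln (1 + \<bar>x\<bar>)" by (intro ln_mult_pos) auto
      ultimately show ?thesis by linarith
    qed
    show "integrable \<alpha> (\<lambda>x. ln (1 + 2 * u * \<bar>x\<bar>))"
      by (rule Bochner_Integration.integrable_bound[of _ "\<lambda>x. ln 2 + ln (1 + \<bar>x\<bar>)"])
        (use int_ln bd in \<open>auto intro!: AE_I2 order_trans[OF bd]\<close>)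
  qed
  have lower: "exp (- (LINT x|\<alpha>. ln (1 + 2 * u * \<bar>x\<bar>))) \<le> M.prob (space M - N)" if u: "0 < u" "u \<le> 1" for u
  proof -
    define g where "g i \<omega> = (1 + u * m i \<omega>) powr (- a)" for i \<omega>
    have [measurable]: "g i \<in> borel_measurable M" for i unfolding g_def by measurable
    have g01: "0 \<le> g i \<omega>" "g i \<omega> \<le> 1" for i \<omega>
    proof -
      show "0 \<le> g i \<omega>" by (simp add: g_def)
      have "1 \<le> 1 + u * m i \<omega>" using m_nonneg[of i \<omega>] u by simp
      from powr_mono2'[OF _ _ this, of "- a"] show "g i \<omega> \<le> 1" using \<open>a > 0\<close> by (simp add: g_def)
    qed
    have int_g: "integrable M (g i)" for i
      using g01 by (intro M.integrable_const_bound[where B=1]) auto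
    have step: "exp (- (LINT x|\<alpha>. ln (1 + 2 * u * \<bar>x\<bar>))) \<le> (LINT \<omega>|M. g i \<omega>)" for i
    proof -
      have "complex_of_real (LINT \<omega>|M. g i \<omega>) =
          (LINT \<omega>|M. (1 + complex_of_real u * complex_of_real (LINT x|\<phi> \<omega>. h i x)) powr (- complex_of_real a))"
        unfolding integral_complex_of_real[symmetric] g_def m_def[symmetric]
        using m_nonneg[of i] u by (intro Bochner_Integration.integral_cong refl) (simp add: powr_of_real[symmetric])
      also have "\<dots> = exp (- (LINT x|\<alpha>. Ln (1 + complex_of_real u * complex_of_real (h i x))))"
        using h u by (intro dirichlet_process_simple_transform[OF dp sets_\<alpha> fin a \<open>a > 0\<close>]) auto
      also have "\<dots> = exp (- (LINT x|\<alpha>. complex_of_real (ln (1 + u * h i x))))"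
      proof -
        have "Ln (1 + complex_of_real u * complex_of_real (h i x)) = complex_of_real (ln (1 + u * h i x))" for x
        proof -
          have "1 + u * h i x > 0" using h(2)[of i x] u by (simp add: add_pos_nonneg)
          from Ln_of_real[OF this] show ?thesis by simp
        qed
        then show ?thesis by simp
      qed
      also have "\<dots> = complex_of_real (exp (- (LINT x|\<alpha>. ln (1 + u * h i x))))"
        unfolding integral_complex_of_real by (simp add: exp_of_real[symmetric])
      finally have "(LINT \<omega>|M. g i \<omega>) = exp (- (LINT x|\<alpha>. ln (1 + u * h i x)))"
        by (simp only: of_real_eq_iff)
      moreover have "(LINT x|\<alpha>. ln (1 + u * h i x)) \<le> (LINT x|\<alpha>. ln (1 + 2 * u * \<bar>x\<bar>))"
      proof (rule integral_mono')
        show "integrable \<alpha> (\<lambda>x. ln (1 + 2 * u * \<bar>x\<bar>))" using u by (intro int2) auto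
        fix x
        have "u * h i x \<le> 2 * u * \<bar>x\<bar>" using h(3)[of i x] u by (simp add: mult.commute mult.left_commute)
        moreover have "0 \<le> u * h i x" using h u by simp
        ultimately show "ln (1 + u * h i x) \<le> ln (1 + 2 * u * \<bar>x\<bar>)" "0 \<le> ln (1 + 2 * u * \<bar>x\<bar>)" by auto
      qed
      ultimately show ?thesis by simp
    qed
    have "(\<lambda>i. LINT \<omega>|M. indicator N \<omega> * g i \<omega>) \<longlonglongrightarrow> (LINT \<omega>|M. 0)"
    proof (rule integral_dominated_convergence[where w="\<lambda>_. 1"])
      show "AE \<omega> in M. (\<lambda>i. indicator N \<omega> * g i \<omega>) \<longlonglongrightarrow> 0"
      proof (intro AE_I2)
        fix \<omega> assume \<omega>: "\<omega> \<in> space M"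
        show "(\<lambda>i. indicator N \<omega> * g i \<omega>) \<longlonglongrightarrow> 0"
        proof (cases "\<omega> \<in> N")
          case True
          interpret prob_space "\<phi> \<omega>" by (rule \<phi>_space(2)[OF \<omega>])
          have meas_h [measurable]: "h i \<in> borel_measurable (\<phi> \<omega>)" for i
            by (simp add: measurable_cong_sets[OF \<phi>_space(1)[OF \<omega>] refl])
          have nn: "(\<integral>\<^sup>+x. ennreal (h i x) \<partial>\<phi> \<omega>) = ennreal (m i \<omega>)" for i
          proof -
            have "finite (range (h i))" using simple_functionD(1)[OF h(1), of i] by simp
            then have "bdd_above (range (h i))" by simp
            then obtain B where "\<And>x. h i x \<le> B" by (auto simp: bdd_above_def)
            then have "integrable (\<phi> \<omega>) (h i)" using h by (intro integrable_const_bound[where B=B] meas_h) auto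
            then show ?thesis unfolding m_def using h by (intro nn_integral_eq_integral) auto
          qed
          have "\<infinity> = (\<integral>\<^sup>+x. ennreal \<bar>x\<bar> \<partial>\<phi> \<omega>)" using True by (simp add: N_def)
          also have "\<dots> = (\<integral>\<^sup>+x. liminf (\<lambda>i. ennreal (h i x)) \<partial>\<phi> \<omega>)"
            using h_lim by (intro nn_integral_cong lim_imp_Liminf[symmetric]) (auto intro: tendsto_ennrealI)
          also have "\<dots> \<le> liminf (\<lambda>i. \<integral>\<^sup>+x. ennreal (h i x) \<partial>\<phi> \<omega>)"
            by (rule nn_integral_liminf) measurable
          finally have lim_inf: "liminf (\<lambda>i. ennreal (m i \<omega>)) = \<infinity>" by (simp add: nn top_unique)
          have "filterlim (\<lambda>i. m i \<omega>) at_top sequentially"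
            unfolding filterlim_at_top_dense
          proof
            fix K :: real
            have "ennreal K < liminf (\<lambda>i. ennreal (m i \<omega>))" using lim_inf by simp
            then have "\<forall>\<^sub>F i in sequentially. ennreal K < ennreal (m i \<omega>)"
              by (rule less_LiminfD)
            then show "\<forall>\<^sub>F i in sequentially. K < m i \<omega>"
            proof eventually_elim
              case (elim i)
              show ?case
              proof (cases "K \<ge> 0")
                case True
                with elim show ?thesis by (simp add: ennreal_less_iff)
              next
                case False
                with m_nonneg[of i \<omega>] show ?thesis by linarith
              qed
            qed
          qed
          then have "filterlim (\<lambda>i. 1 + u * m i \<omega>) at_top sequentially"
            using u by (intro filterlim_tendsto_add_at_top[OF tendsto_const] filterlim_tendsto_pos_mult_at_top[OF tendsto_const])
          then have "(\<lambda>i. g i \<omega>) \<longlonglongrightarrow> 0"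
            unfolding g_def using \<open>a > 0\<close> by (intro tendsto_neg_powr) auto
          then show ?thesis using True by simp
        qed simp
      qed
      show "AE \<omega> in M. norm (indicator N \<omega> * g i \<omega>) \<le> 1" for i
        using g01 by (intro AE_I2) (auto simp: indicator_def)
    qed auto
    then have lim0: "(\<lambda>i. LINT \<omega>|M. indicator N \<omega> * g i \<omega>) \<longlonglongrightarrow> 0"
      by (simp only: Bochner_Integration.integral_zero)
    have lim: "(\<lambda>i. M.prob (space M - N) + (LINT \<omega>|M. indicator N \<omega> * g i \<omega>)) \<longlonglongrightarrow> M.prob (space M - N) + 0"
      by (rule tendsto_add[OF tendsto_const lim0])
    have "(LINT \<omega>|M. g i \<omega>) \<le> M.prob (space M - N) + (LINT \<omega>|M. indicator N \<omega> * g i \<omega>)" for i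
    proof -
      have int_Ng: "integrable M (\<lambda>\<omega>. indicator N \<omega> * g i \<omega>)"
        using g01 by (intro M.integrable_const_bound[where B=1]) (auto simp: indicator_def)
      have int_N: "integrable M (\<lambda>\<omega>. indicator (space M - N) \<omega> :: real)" by (simp add: M.emeasure_eq_measure)
      have "(LINT \<omega>|M. g i \<omega>) \<le> (LINT \<omega>|M. indicator (space M - N) \<omega> + indicator N \<omega> * g i \<omega>)"
        using g01 by (intro integral_mono int_g Bochner_Integration.integrable_add int_Ng int_N) (auto simp: indicator_def)
      also have "\<dots> = M.prob (space M - N) + (LINT \<omega>|M. indicator N \<omega> * g i \<omega>)"
        using Bochner_Integration.integral_add[OF int_N int_Ng] Bochner_Integration.integral_indicator[of M "space M - N"]
        by (simp only: Int_absorb2 Diff_subset)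
      finally show ?thesis .
    qed
    then have le: "exp (- (LINT x|\<alpha>. ln (1 + 2 * u * \<bar>x\<bar>))) \<le> M.prob (space M - N) + (LINT \<omega>|M. indicator N \<omega> * g i \<omega>)" for i
      using step[of i] by (rule order_trans[rotated])
    have "exp (- (LINT x|\<alpha>. ln (1 + 2 * u * \<bar>x\<bar>))) \<le> M.prob (space M - N) + 0"
      by (rule LIMSEQ_le_const[OF lim], intro exI[of _ 0] allI impI, rule le)
    then show ?thesis by (simp only: add_0_right)
  qed
  have "(\<lambda>n. LINT x|\<alpha>. ln (1 + 2 * (1 / real (Suc n)) * \<bar>x\<bar>)) \<longlonglongrightarrow> (LINT x|\<alpha>. 0)"
  proof (rule integral_dominated_convergence[where w="\<lambda>x. ln 2 + ln (1 + \<bar>x\<bar>)"])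
    show "AE x in \<alpha>. (\<lambda>n. ln (1 + 2 * (1 / real (Suc n)) * \<bar>x\<bar>)) \<longlonglongrightarrow> 0"
    proof (intro AE_I2)
      fix x
      have "(\<lambda>n. 1 / real (Suc n)) \<longlonglongrightarrow> 0" by (rule LIMSEQ_inverse_real_of_nat[unfolded inverse_eq_divide])
      then have "(\<lambda>n. ln (1 + 2 * (1 / real (Suc n)) * \<bar>x\<bar>)) \<longlonglongrightarrow> ln (1 + 2 * 0 * \<bar>x\<bar>)"
        by (intro tendsto_intros) auto
      then show "(\<lambda>n. ln (1 + 2 * (1 / real (Suc n)) * \<bar>x\<bar>)) \<longlonglongrightarrow> 0" by simp
    qed
    show "AE x in \<alpha>. norm (ln (1 + 2 * (1 / real (Suc n)) * \<bar>x\<bar>)) \<le> ln 2 + ln (1 + \<bar>x\<bar>)" for n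
      using int2'[of "1 / real (Suc n)"] by simp
  qed (use int_ln in auto)
  then have "(\<lambda>n. exp (- (LINT x|\<alpha>. ln (1 + 2 * (1 / real (Suc n)) * \<bar>x\<bar>)))) \<longlonglongrightarrow> exp (- 0)"
    by (intro tendsto_intros) simp
  then have "1 \<le> M.prob (space M - N)"
  proof -
    assume lim: "(\<lambda>n. exp (- (LINT x|\<alpha>. ln (1 + 2 * (1 / real (Suc n)) * \<bar>x\<bar>)))) \<longlonglongrightarrow> exp (- 0)"
    have "exp (- 0) \<le> M.prob (space M - N)"
      by (rule LIMSEQ_le_const2[OF lim], intro exI[of _ 0] allI impI, rule lower) auto
    then show ?thesis by simp
  qed
  then have "M.prob (space M - N) = 1" using M.prob_le_1 antisym by blast
  then have "AE \<omega> in M. \<omega> \<in> space M - N" by (rule M.AE_prob_1)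
  then show ?thesis
  proof eventually_elim
    case (elim \<omega>)
    then have "(\<integral>\<^sup>+x. ennreal (norm x) \<partial>\<phi> \<omega>) < \<infinity>" by (simp add: N_def less_top)
    moreover have "(\<lambda>x. x) \<in> borel_measurable (\<phi> \<omega>)"
    proof -
      have "\<omega> \<in> space M" using elim by blast
      then show ?thesis by (simp only: measurable_cong_sets[OF \<phi>_space(1) refl] measurable_ident_sets)
    qed
    ultimately show ?case by (simp only: integrable_iff_bounded)
  qed
qed

text \<open>Approximate the identity function by simple functions \<open>F i\<close> with \<open>\<bar>F i x\<bar> \<le> 2 \<bar>x\<bar>\<close>. On the left
  their integrals converge almost surely since the mean exists and the power has modulus at most 1;
  on the right the logarithms are dominated because of the logarithmic moment.\<close>

lemma markov_krein_dirichlet: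
  assumes "a > 0" and \<alpha>: "\<alpha> \<in> log_finite_measures a" and dp: "dirichlet_process M \<phi> \<alpha>"
  shows "(LINT x|mean_distribution M \<phi>. (1 + \<i> * complex_of_real u * complex_of_real x) powr (- complex_of_real a)) =
    exp (- (LINT x|\<alpha>. Ln (1 + \<i> * complex_of_real u * complex_of_real x)))"
proof -
  have sets_\<alpha>: "sets \<alpha> = sets borel" and fin: "finite_measure \<alpha>" and a: "measure \<alpha> UNIV = a"
    and int_ln: "integrable \<alpha> (\<lambda>x. ln (1 + \<bar>x\<bar>))"
    using \<alpha> by (auto simp: log_finite_measures_def)
  interpret M: prob_space M using dp by (simp add: dirichlet_process_def)
  interpret \<alpha>: finite_measure \<alpha> by fact
  note [measurable_cong] = sets_\<alpha>
  have \<phi> [measurable]: "\<phi> \<in> M \<rightarrow>\<^sub>M prob_algebra borel" using dp by (simp add: dirichlet_process_def)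
  have \<phi>' [measurable]: "\<phi> \<in> M \<rightarrow>\<^sub>M subprob_algebra borel" using \<phi> by (rule measurable_prob_algebraD)
  have \<phi>_space: "sets (\<phi> \<omega>) = sets borel" "prob_space (\<phi> \<omega>)" if "\<omega> \<in> space M" for \<omega>
    using measurable_space[OF \<phi> that] by (auto simp: space_prob_algebra)
  obtain F :: "nat \<Rightarrow> real \<Rightarrow> real" where F: "\<And>i. simple_function borel (F i)"
    "\<And>x. (\<lambda>i. F i x) \<longlonglongrightarrow> x" "\<And>i x. \<bar>F i x\<bar> \<le> 2 * \<bar>x\<bar>"
    using borel_measurable_implies_sequence_metric[of "\<lambda>x::real. x" borel 0] by auto
  have [measurable]: "F i \<in> borel_measurable borel" for i using F(1) by (rule borel_measurable_simple_function)
  let ?k = "\<lambda>x. (1 + \<i> * complex_of_real u * complex_of_real x) powr (- complex_of_real a)"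
  have cont_k: "continuous_on UNIV ?k"
    by (intro continuous_intros) (auto simp: complex_nonpos_Reals_iff complex_eq_iff)
  have norm_k: "norm (?k x) \<le> 1" for x
  proof -
    have "1 \<le> cmod (1 + \<i> * complex_of_real u * complex_of_real x)"
      using abs_Re_le_cmod[of "1 + \<i> * complex_of_real u * complex_of_real x"] by simp
    from powr_mono2'[OF _ _ this, of "- a"] show ?thesis
      using \<open>a > 0\<close> norm_powr_real_powr'[of "- complex_of_real a"] by simp
  qed
  have [measurable]: "?k \<in> borel_measurable borel" by (rule borel_measurable_continuous_onI[OF cont_k])
  have lhs: "(\<lambda>i. LINT \<omega>|M. ?k (LINT x|\<phi> \<omega>. F i x)) \<longlonglongrightarrow> (LINT \<omega>|M. ?k (LINT x|\<phi> \<omega>. x))"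
  proof (rule integral_dominated_convergence[where w="\<lambda>_. 1"])
    show "AE \<omega> in M. (\<lambda>i. ?k (LINT x|\<phi> \<omega>. F i x)) \<longlonglongrightarrow> ?k (LINT x|\<phi> \<omega>. x)"
      using dirichlet_process_integrable_mean[OF assms] AE_space[of M]
    proof eventually_elim
      case (elim \<omega>)
      have "(\<lambda>i. LINT x|\<phi> \<omega>. F i x) \<longlonglongrightarrow> (LINT x|\<phi> \<omega>. x)"
      proof (rule integral_dominated_convergence[where w="\<lambda>x. 2 * \<bar>x\<bar>"])
        show "integrable (\<phi> \<omega>) (\<lambda>x. 2 * \<bar>x\<bar>)" using elim(1) by auto
        show "AE x in \<phi> \<omega>. (\<lambda>i. F i x) \<longlonglongrightarrow> x" using F(2) by simp
        show "AE x in \<phi> \<omega>. norm (F i x) \<le> 2 * \<bar>x\<bar>" for i using F(3) by simp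
      qed (simp_all add: measurable_cong_sets[OF \<phi>_space(1)[OF elim(2)] refl])
      then show ?case by (rule continuous_on_tendsto_compose[OF cont_k]) auto
    qed
  qed (use norm_k in auto)
  have rhs: "(\<lambda>i. LINT x|\<alpha>. Ln (1 + \<i> * complex_of_real u * complex_of_real (F i x)))
      \<longlonglongrightarrow> (LINT x|\<alpha>. Ln (1 + \<i> * complex_of_real u * complex_of_real x))"
  proof (rule integral_dominated_convergence[where w="\<lambda>x. ln (1 + 2 * \<bar>u\<bar>) + ln (1 + \<bar>x\<bar>) + pi"])
    show "integrable \<alpha> (\<lambda>x. ln (1 + 2 * \<bar>u\<bar>) + ln (1 + \<bar>x\<bar>) + pi)"
      using int_ln by auto
    have cont: "continuous_on UNIV (\<lambda>x. Ln (1 + \<i> * complex_of_real u * complex_of_real x))"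
      by (intro continuous_intros) (auto simp: complex_nonpos_Reals_iff)
    then have [measurable]: "(\<lambda>x. Ln (1 + \<i> * complex_of_real u * complex_of_real x)) \<in> borel_measurable borel"
      by (rule borel_measurable_continuous_onI)
    show "(\<lambda>x. Ln (1 + \<i> * complex_of_real u * complex_of_real x)) \<in> borel_measurable \<alpha>" by measurable
    show "(\<lambda>x. Ln (1 + \<i> * complex_of_real u * complex_of_real (F i x))) \<in> borel_measurable \<alpha>" for i
      by measurable
    show "AE x in \<alpha>. (\<lambda>i. Ln (1 + \<i> * complex_of_real u * complex_of_real (F i x)))
        \<longlonglongrightarrow> Ln (1 + \<i> * complex_of_real u * complex_of_real x)"
      using F(2) by (intro AE_I2 continuous_on_tendsto_compose[OF cont]) auto
    show "AE x in \<alpha>. norm (Ln (1 + \<i> * complex_of_real u * complex_of_real (F i x))) \<le> ln (1 + 2 * \<bar>u\<bar>) + ln (1 + \<bar>x\<bar>) + pi" for i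
    proof (intro AE_I2)
      fix x
      let ?v = "1 + \<i> * complex_of_real u * complex_of_real (F i x)"
      have "1 \<le> norm ?v" using abs_Re_le_cmod[of ?v] by simp
      moreover have "norm ?v \<le> (1 + 2 * \<bar>u\<bar>) * (1 + \<bar>x\<bar>)"
      proof -
        have "norm ?v \<le> 1 + \<bar>u\<bar> * \<bar>F i x\<bar>" by (rule order_trans[OF norm_triangle_ineq]) (simp add: norm_mult)
        also have "\<dots> \<le> 1 + \<bar>u\<bar> * (2 * \<bar>x\<bar>)" using F(3) by (intro add_left_mono mult_left_mono) auto
        also have "\<dots> \<le> (1 + 2 * \<bar>u\<bar>) * (1 + \<bar>x\<bar>)" by (simp add: algebra_simps)
        finally show ?thesis .
      qed
      ultimately have n: "0 < norm ?v" "0 < (1 + 2 * \<bar>u\<bar>) * (1 + \<bar>x\<bar>)" "norm ?v \<le> (1 + 2 * \<bar>u\<bar>) * (1 + \<bar>x\<bar>)"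
        by linarith+
      have "ln (norm ?v) \<le> ln ((1 + 2 * \<bar>u\<bar>) * (1 + \<bar>x\<bar>))"
        using n by (simp only: ln_le_cancel_iff)
      moreover have "0 \<le> ln (norm ?v)" using \<open>1 \<le> norm ?v\<close> by (rule ln_ge_zero)
      ultimately have "\<bar>ln (norm ?v)\<bar> \<le> ln ((1 + 2 * \<bar>u\<bar>) * (1 + \<bar>x\<bar>))" by linarith
      moreover have "ln ((1 + 2 * \<bar>u\<bar>) * (1 + \<bar>x\<bar>)) = ln (1 + 2 * \<bar>u\<bar>) + ln (1 + \<bar>x\<bar>)"
        by (intro ln_mult_pos) auto
      moreover have "?v \<noteq> 0" using \<open>1 \<le> norm ?v\<close> by force
      ultimately show "norm (Ln ?v) \<le> ln (1 + 2 * \<bar>u\<bar>) + ln (1 + \<bar>x\<bar>) + pi"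
        using norm_Ln_le[of ?v] by linarith
    qed
  qed
  have eq: "(LINT \<omega>|M. ?k (LINT x|\<phi> \<omega>. F i x)) = exp (- (LINT x|\<alpha>. Ln (1 + \<i> * complex_of_real u * complex_of_real (F i x))))" for i
    by (intro dirichlet_process_simple_transform[OF dp sets_\<alpha> fin a \<open>a > 0\<close> F(1)]) simp
  have "(LINT x|mean_distribution M \<phi>. ?k x) = (LINT \<omega>|M. ?k (LINT x|\<phi> \<omega>. x))"
    unfolding mean_distribution_def by (subst integral_distr) auto
  also have "\<dots> = exp (- (LINT x|\<alpha>. Ln (1 + \<i> * complex_of_real u * complex_of_real x)))"
  proof (rule LIMSEQ_unique[OF lhs])
    show "(\<lambda>i. LINT \<omega>|M. ?k (LINT x|\<phi> \<omega>. F i x)) \<longlonglongrightarrow> exp (- (LINT x|\<alpha>. Ln (1 + \<i> * complex_of_real u * complex_of_real x)))"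
      unfolding eq by (intro tendsto_intros rhs)
  qed
  finally show ?thesis .
qed

lemma mean_distribution_prob_space:
  assumes dp: "dirichlet_process M \<phi> \<alpha>"
  shows "prob_space (mean_distribution M \<phi>)" and "sets (mean_distribution M \<phi>) = sets borel"
proof -
  interpret M: prob_space M using dp by (simp add: dirichlet_process_def)
  have \<phi> [measurable]: "\<phi> \<in> M \<rightarrow>\<^sub>M subprob_algebra borel"
    using dp by (intro measurable_prob_algebraD) (simp add: dirichlet_process_def)
  show "prob_space (mean_distribution M \<phi>)"
    unfolding mean_distribution_def by (rule M.prob_space_distr) measurable
qed (simp add: mean_distribution_def)

section \<open>Loops in the slit half-plane\<close>

definition slit_half_plane :: "complex set" where
  "slit_half_plane = {w. 0 < Re w \<and> w \<notin> closed_segment 0 1}"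

text \<open>The sign \<open>\<sigma>\<close> is 1 for the upper and -1 for the lower quadrant; near 0 the slit half-plane consists of
  these two pieces.\<close>

definition quadrant :: "real \<Rightarrow> complex set" where
  "quadrant \<sigma> = {w. 0 < Re w \<and> 0 < \<sigma> * Im w}"

lemma slit_half_plane_iff: "w \<in> slit_half_plane \<longleftrightarrow> 0 < Re w \<and> (Im w \<noteq> 0 \<or> 1 < Re w)"
proof -
  have "w \<in> closed_segment 0 1 \<longleftrightarrow> w \<in> of_real ` {0..1::real}"
    using closed_segment_of_real[of 0 1, where ?'a=complex] closed_segment_eq_real_ivl[of 0 "1::real"] by simp
  also have "\<dots> \<longleftrightarrow> Im w = 0 \<and> 0 \<le> Re w \<and> Re w \<le> 1"
    by (auto simp: image_iff complex_eq_iff)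
  finally show ?thesis by (auto simp: slit_half_plane_def)
qed

lemma open_slit_half_plane: "open slit_half_plane"
proof -
  have "slit_half_plane = {w. 0 < Re w} - closed_segment 0 1" by (auto simp: slit_half_plane_def)
  then show ?thesis by (metis open_Diff open_halfspace_Re_gt closed_segment)
qed

text \<open>The slit joins the boundary of the half-plane to 1, so every point is visible from 2. This is what
  provides primitives.\<close>

lemma starlike_slit_half_plane: "starlike slit_half_plane"
  unfolding starlike_def
proof (intro bexI ballI subsetI)
  show "2 \<in> slit_half_plane" by (simp add: slit_half_plane_iff)
  fix x y assume x: "x \<in> slit_half_plane" and "y \<in> closed_segment 2 x"
  then obtain u where u: "0 \<le> u" "u \<le> 1" "y = (1 - u) *\<^sub>R 2 + u *\<^sub>R x"
    by (auto simp: closed_segment_def)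
  have re: "Re y = (1 - u) * 2 + u * Re x" and im: "Im y = u * Im x" using u by simp_all
  show "y \<in> slit_half_plane"
  proof (cases "u = 0")
    case True
    then show ?thesis using re im by (simp add: slit_half_plane_iff)
  next
    case False
    then have pos: "u * Re x > 0" using x u by (simp add: slit_half_plane_iff)
    have nonneg: "(1 - u) * 2 \<ge> 0" using u by simp
    have "1 < Re y" if "1 < Re x"
    proof -
      have "u * 1 < u * Re x" using that False u by (intro mult_strict_left_mono) auto
      then show ?thesis using u(1,2) unfolding re by (simp add: algebra_simps)
    qed
    moreover have "0 < Re y" unfolding re using pos nonneg by linarith
    moreover have "Im x \<noteq> 0 \<Longrightarrow> Im y \<noteq> 0" using im False by simp
    ultimately show ?thesis using x unfolding slit_half_plane_iff by blast
  qed
qed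

lemma convex_quadrant: "convex (quadrant \<sigma>)"
proof -
  have "quadrant \<sigma> = {w. 0 < Re w} \<inter> {w. inner (\<i> * of_real \<sigma>) w > 0}"
    by (auto simp: quadrant_def inner_complex_def)
  then show ?thesis by (simp add: convex_Int convex_halfspace_Re_gt convex_halfspace_gt)
qed

lemma quadrant_subset_slit: "quadrant \<sigma> \<subseteq> slit_half_plane"
  by (auto simp: quadrant_def slit_half_plane_iff)

lemma holomorphic_primitive_starlike:
  assumes "f holomorphic_on S" "open S" "starlike S"
  obtains G where "\<And>w. w \<in> S \<Longrightarrow> (G has_field_derivative f w) (at w)"
proof -
  have "f field_differentiable at x" if "x \<in> S - {}" for x
    using that assms by (auto simp: holomorphic_on_open field_differentiable_def)
  from holomorphic_starlike_primitive[OF holomorphic_on_imp_continuous_on[OF assms(1)] assms(3,2) finite.emptyI this]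
  show ?thesis using that by blast
qed

text \<open>A mean value inequality along a curve, with a comparison function \<open>\<phi>\<close> in place of a constant
  bound, for estimates of primitives whose derivative is unbounded.\<close>

lemma primitive_curve_bound:
  fixes G :: "complex \<Rightarrow> complex" and c :: "real \<Rightarrow> complex"
  assumes "a \<le> b"
    and c: "\<And>x. a \<le> x \<Longrightarrow> x \<le> b \<Longrightarrow> (c has_vector_derivative c' x) (at x)"
    and G: "\<And>x. a \<le> x \<Longrightarrow> x \<le> b \<Longrightarrow> (G has_field_derivative f (c x)) (at (c x))"
    and \<phi>: "\<And>x. a \<le> x \<Longrightarrow> x \<le> b \<Longrightarrow> (\<phi> has_real_derivative \<phi>' x) (at x)"
    and bd: "\<And>x. a \<le> x \<Longrightarrow> x \<le> b \<Longrightarrow> norm (c' x * f (c x)) \<le> \<phi>' x"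
  shows "norm (G (c b) - G (c a)) \<le> \<phi> b - \<phi> a"
proof (cases "a = b")
  case False
  have d: "((\<lambda>x. G (c x)) has_vector_derivative c' x * f (c x)) (at x)" if "a \<le> x" "x \<le> b" for x
    using field_vector_diff_chain_at[OF c[OF that] G[OF that]] by (simp add: o_def)
  show ?thesis
  proof (rule differentiable_bound_general[of a b "\<lambda>x. G (c x)" \<phi> "\<lambda>x. c' x * f (c x)" \<phi>'])
    show "continuous_on {a..b} (\<lambda>x. G (c x))"
      using d by (meson atLeastAtMost_iff continuous_at_imp_continuous_on has_vector_derivative_continuous)
    show "continuous_on {a..b} \<phi>"
      using \<phi> by (meson atLeastAtMost_iff continuous_at_imp_continuous_on DERIV_isCont)
  qed (use assms False d in \<open>auto simp: has_real_derivative_iff_has_vector_derivative\<close>)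
qed simp

lemma has_vector_derivative_arc:
  "((\<lambda>\<theta>. z0 + complex_of_real \<rho> * cis (\<sigma> * \<theta>)) has_vector_derivative
     (complex_of_real \<rho> * (\<i> * of_real \<sigma> * cis (\<sigma> * \<theta>)))) (at \<theta>)"
proof -
  have "((\<lambda>w. z0 + complex_of_real \<rho> * exp (\<i> * of_real \<sigma> * w)) has_field_derivative
     (complex_of_real \<rho> * (\<i> * of_real \<sigma> * exp (\<i> * of_real \<sigma> * of_real \<theta>)))) (at (of_real \<theta>))"
    by (auto intro!: derivative_eq_intros)
  from has_vector_derivative_real_field[OF this]
  show ?thesis by (simp add: cis_conv_exp mult.assoc)
qed

lemma primitive_arc_bound:
  fixes G :: "complex \<Rightarrow> complex"
  assumes "\<alpha> \<le> \<beta>" "\<rho> \<ge> 0" "\<bar>\<sigma>\<bar> = 1"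
    and G: "\<And>\<theta>. \<alpha> \<le> \<theta> \<Longrightarrow> \<theta> \<le> \<beta> \<Longrightarrow>
          (G has_field_derivative f (z0 + complex_of_real \<rho> * cis (\<sigma> * \<theta>))) (at (z0 + complex_of_real \<rho> * cis (\<sigma> * \<theta>)))"
    and bd: "\<And>\<theta>. \<alpha> \<le> \<theta> \<Longrightarrow> \<theta> \<le> \<beta> \<Longrightarrow> norm (f (z0 + complex_of_real \<rho> * cis (\<sigma> * \<theta>))) \<le> B"
  shows "norm (G (z0 + complex_of_real \<rho> * cis (\<sigma> * \<beta>)) - G (z0 + complex_of_real \<rho> * cis (\<sigma> * \<alpha>))) \<le> \<rho> * B * (\<beta> - \<alpha>)"
proof -
  have "norm (G (z0 + complex_of_real \<rho> * cis (\<sigma> * \<beta>)) - G (z0 + complex_of_real \<rho> * cis (\<sigma> * \<alpha>)))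
      \<le> \<rho> * B * \<beta> - \<rho> * B * \<alpha>"
  proof (rule primitive_curve_bound[where \<phi>="\<lambda>\<theta>. \<rho> * B * \<theta>" and \<phi>'="\<lambda>_. \<rho> * B"
        and c="\<lambda>\<theta>. z0 + complex_of_real \<rho> * cis (\<sigma> * \<theta>)"])
    show "((\<lambda>\<theta>. z0 + complex_of_real \<rho> * cis (\<sigma> * \<theta>)) has_vector_derivative
     (complex_of_real \<rho> * (\<i> * of_real \<sigma> * cis (\<sigma> * \<theta>)))) (at \<theta>)" for \<theta>
      by (rule has_vector_derivative_arc)
    show "((\<lambda>\<theta>. \<rho> * B * \<theta>) has_real_derivative \<rho> * B) (at x)" for x
      by (auto intro!: derivative_eq_intros)
    show "norm (complex_of_real \<rho> * (\<i> * of_real \<sigma> * cis (\<sigma> * \<theta>)) * f (z0 + complex_of_real \<rho> * cis (\<sigma> * \<theta>))) \<le> \<rho> * B"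
      if "\<alpha> \<le> \<theta>" "\<theta> \<le> \<beta>" for \<theta>
      using bd[OF that] assms by (simp add: norm_mult mult_left_mono)
  qed (use assms in auto)
  then show ?thesis by (simp add: algebra_simps)
qed

lemma quadrant_polar:
  assumes \<sigma>: "\<sigma> = 1 \<or> \<sigma> = -1" and w: "w \<in> quadrant \<sigma>"
  obtains \<theta> where "0 < \<theta>" "\<theta> < pi / 2" "w = complex_of_real (norm w) * cis (\<sigma> * \<theta>)"
proof -
  have nz: "w \<noteq> 0" and re: "Re w > 0" and im: "\<sigma> * Im w > 0" using w by (auto simp: quadrant_def)
  have a: "\<bar>Arg w\<bar> < pi / 2" using re Arg_Re_pos by blast
  have polar: "w = complex_of_real (norm w) * cis (Arg w)"
    using rcis_cmod_Arg[of w] by (simp add: rcis_def)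
  have im': "Im w = norm w * sin (Arg w)" using arg_cong[OF polar, of Im] by simp
  have "\<sigma> * sin (Arg w) > 0"
  proof -
    have "0 < norm w * (\<sigma> * sin (Arg w))" using im unfolding im' by (simp only: mult_ac)
    then show ?thesis by (rule zero_less_mult_pos) (use nz in simp)
  qed
  then have "0 < \<sigma> * Arg w"
  proof -
    assume s: "0 < \<sigma> * sin (Arg w)"
    show ?thesis
    proof (rule ccontr)
      assume "\<not> ?thesis"
      then have "0 \<le> - (\<sigma> * Arg w)" "- (\<sigma> * Arg w) \<le> pi" using a \<sigma> by auto
      then have "sin (- (\<sigma> * Arg w)) \<ge> 0" by (rule sin_ge_zero)
      with s \<sigma> show False by auto
    qed
  qed
  moreover have "\<sigma> * Arg w < pi / 2" using a \<sigma> by auto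
  moreover have "w = complex_of_real (norm w) * cis (\<sigma> * (\<sigma> * Arg w))" using \<sigma> polar by auto
  ultimately show ?thesis by (rule that)
qed

lemma polar_in_quadrant:
  assumes "\<sigma> = 1 \<or> \<sigma> = -1" "0 < \<theta>" "\<theta> < pi / 2" "\<rho> > 0"
  shows "complex_of_real \<rho> * cis (\<sigma> * \<theta>) \<in> quadrant \<sigma>"
proof -
  have "cos \<theta> > 0" "sin \<theta> > 0" using assms by (auto intro: cos_gt_zero sin_gt_zero)
  then show ?thesis using assms by (auto simp: quadrant_def)
qed

text \<open>A primitive that converges along the diagonal ray converges as 0 is approached in any way within
  the open quadrant. The bound on \<open>f\<close> blows up at the imaginary axis, but like the inverse square
  root of \<open>cos \<theta>\<close>, which is integrable over the arc of radius \<open>\<rho>\<close>; so the primitive varies by at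
  most a multiple of \<open>\<rho> powr c\<close> along such an arc.\<close>

lemma primitive_limit_in_quadrant:
  fixes G f :: "complex \<Rightarrow> complex"
  assumes \<sigma>: "\<sigma> = 1 \<or> \<sigma> = -1" and "c > 0" "r0 > 0" "C \<ge> 0"
    and G: "\<And>w. w \<in> quadrant \<sigma> \<Longrightarrow> (G has_field_derivative f w) (at w)"
    and bd: "\<And>w. w \<in> quadrant \<sigma> \<Longrightarrow> norm w < r0 \<Longrightarrow> norm (f w) \<le> C * norm w powr (c - 1) * sqrt (norm w / Re w)"
    and ray: "((\<lambda>s. G (complex_of_real s * cis (\<sigma> * (pi / 4)))) \<longlongrightarrow> l) (at_right 0)"
  shows "(G \<longlongrightarrow> l) (at 0 within quadrant \<sigma>)"
proof -
  define K where "K = 4 * C * (pi / 2 + 1)"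
  have step: "norm (G (complex_of_real \<rho> * cis (\<sigma> * \<beta>)) - G (complex_of_real \<rho> * cis (\<sigma> * \<alpha>))) \<le> K * \<rho> powr c"
    if \<rho>: "0 < \<rho>" "\<rho> < r0" and ab: "0 < \<alpha>" "\<alpha> \<le> \<beta>" "\<beta> < pi / 2" for \<rho> \<alpha> \<beta>
  proof -
    let ?c = "\<lambda>\<theta>. complex_of_real \<rho> * cis (\<sigma> * \<theta>)"
    \<comment> \<open>The term \<open>- sqrt (cos \<theta>)\<close> has derivative \<open>sin \<theta> / (2 * sqrt (cos \<theta>))\<close>, which matches the
      singularity at \<open>\<pi> / 2\<close>; the term \<open>\<theta>\<close> takes over where \<open>sin \<theta>\<close> is small.\<close>
    let ?\<phi> = "\<lambda>\<theta>. 4 * C * \<rho> powr c * (\<theta> - sqrt (cos \<theta>))"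
    let ?\<phi>' = "\<lambda>\<theta>. 4 * C * \<rho> powr c * (1 + sin \<theta> / (2 * sqrt (cos \<theta>)))"
    have "norm (G (?c \<beta>) - G (?c \<alpha>)) \<le> ?\<phi> \<beta> - ?\<phi> \<alpha>"
    proof (rule primitive_curve_bound[where c="?c" and \<phi>="?\<phi>" and \<phi>'="?\<phi>'"])
      fix \<theta> assume \<theta>: "\<alpha> \<le> \<theta>" "\<theta> \<le> \<beta>"
      then have \<theta>': "0 < \<theta>" "\<theta> < pi / 2" using ab by auto
      have cs: "cos \<theta> > 0" "sin \<theta> > 0" using \<theta>' by (auto intro: cos_gt_zero sin_gt_zero)
      show "(?c has_vector_derivative (complex_of_real \<rho> * (\<i> * of_real \<sigma> * cis (\<sigma> * \<theta>)))) (at \<theta>)"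
        using has_vector_derivative_arc[of 0] by simp
      have q: "?c \<theta> \<in> quadrant \<sigma>" by (rule polar_in_quadrant[OF \<sigma> \<theta>' \<rho>(1)])
      then show "(G has_field_derivative f (?c \<theta>)) (at (?c \<theta>))" by (rule G)
      show "(?\<phi> has_real_derivative ?\<phi>' \<theta>) (at \<theta>)"
        using cs by (auto intro!: derivative_eq_intros simp: field_simps)
      have nc: "norm (?c \<theta>) = \<rho>" using \<rho> by (simp add: norm_mult)
      have rc: "Re (?c \<theta>) = \<rho> * cos \<theta>" using \<sigma> by auto
      have "norm (complex_of_real \<rho> * (\<i> * of_real \<sigma> * cis (\<sigma> * \<theta>)) * f (?c \<theta>)) = \<rho> * norm (f (?c \<theta>))"
        using \<rho> \<sigma> by (auto simp: norm_mult)
      also have "\<dots> \<le> \<rho> * (C * \<rho> powr (c - 1) * sqrt (1 / cos \<theta>))"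
        using bd[OF q] \<rho> unfolding nc rc by (intro mult_left_mono) auto
      also have "\<dots> = C * \<rho> powr c * (1 / sqrt (cos \<theta>))"
        using \<rho> by (simp add: real_sqrt_divide powr_mult_base[symmetric] powr_diff)
      also have "\<dots> \<le> C * \<rho> powr c * (4 * (1 + sin \<theta> / (2 * sqrt (cos \<theta>))))"
      proof (intro mult_left_mono)
        let ?x = "sqrt (cos \<theta>)"
        have x: "?x > 0" using cs by simp
        have "cos \<theta> \<le> ?x" using cs(1) cos_le_one[of \<theta>] by (intro real_le_rsqrt) (simp add: power2_eq_square mult_left_le)
        moreover have "1 \<le> cos \<theta> + sin \<theta>"
        proof -
          have "(cos \<theta> + sin \<theta>)\<^sup>2 = 1 + 2 * cos \<theta> * sin \<theta>"
            by (simp add: power2_sum)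
          then have "1\<^sup>2 \<le> (cos \<theta> + sin \<theta>)\<^sup>2" using cs by simp
          then show ?thesis using cs by (intro power2_le_imp_le[of 1]) auto
        qed
        ultimately have "1 \<le> 4 * ?x + 2 * sin \<theta>" using cs by linarith
        then have "1 / ?x \<le> (4 * ?x + 2 * sin \<theta>) / ?x" using x by (intro divide_right_mono) auto
        also have "\<dots> = 4 * (1 + sin \<theta> / (2 * ?x))" using x by (simp add: field_simps)
        finally show "1 / ?x \<le> 4 * (1 + sin \<theta> / (2 * ?x))" .
      qed (use \<open>C \<ge> 0\<close> in simp)
      finally show "norm (complex_of_real \<rho> * (\<i> * of_real \<sigma> * cis (\<sigma> * \<theta>)) * f (?c \<theta>)) \<le> ?\<phi>' \<theta>"
        by (simp add: mult_ac)
    qed (use ab in auto)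
    also have "\<dots> = 4 * C * \<rho> powr c * ((\<beta> - \<alpha>) + (sqrt (cos \<alpha>) - sqrt (cos \<beta>)))" by (simp add: algebra_simps)
    also have "\<dots> \<le> 4 * C * \<rho> powr c * (pi / 2 + 1)"
    proof (intro mult_left_mono)
      have "0 \<le> cos \<beta>" using ab by (intro cos_ge_zero) auto
      moreover have "sqrt (cos \<alpha>) \<le> 1" by simp
      ultimately have "sqrt (cos \<alpha>) - sqrt (cos \<beta>) \<le> 1" using real_sqrt_ge_zero[of "cos \<beta>"] by linarith
      then show "(\<beta> - \<alpha>) + (sqrt (cos \<alpha>) - sqrt (cos \<beta>)) \<le> pi / 2 + 1" using ab by linarith
    qed (use \<open>C \<ge> 0\<close> in simp)
    finally show ?thesis by (simp add: K_def mult_ac)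
  qed
  have diff: "norm (G w - G (complex_of_real (norm w) * cis (\<sigma> * (pi / 4)))) \<le> K * norm w powr c"
    if w: "w \<in> quadrant \<sigma>" "norm w < r0" for w
  proof -
    obtain \<theta> where \<theta>: "0 < \<theta>" "\<theta> < pi / 2" "w = complex_of_real (norm w) * cis (\<sigma> * \<theta>)"
      using quadrant_polar[OF \<sigma> w(1)] by blast
    have nw: "norm w > 0" using w by (auto simp: quadrant_def)
    show ?thesis
    proof (cases "\<theta> \<le> pi / 4")
      case True
      have "norm (G (complex_of_real (norm w) * cis (\<sigma> * (pi / 4))) - G (complex_of_real (norm w) * cis (\<sigma> * \<theta>))) \<le> K * norm w powr c"
        using True \<theta> nw w by (intro step) auto
      then show ?thesis unfolding \<theta>(3)[symmetric] by (simp add: norm_minus_commute)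
    next
      case False
      have "norm (G (complex_of_real (norm w) * cis (\<sigma> * \<theta>)) - G (complex_of_real (norm w) * cis (\<sigma> * (pi / 4)))) \<le> K * norm w powr c"
        using False \<theta> nw w by (intro step) auto
      then show ?thesis unfolding \<theta>(3)[symmetric] .
    qed
  qed
  have norm0: "((\<lambda>w::complex. norm w) \<longlongrightarrow> 0) (at 0 within quadrant \<sigma>)"
    by (rule tendsto_norm_zero) (rule tendsto_ident_at)
  have near: "\<forall>\<^sub>F w in at 0 within quadrant \<sigma>. w \<in> quadrant \<sigma> \<and> norm w < r0"
    using \<open>r0 > 0\<close> by (auto simp: eventually_at dist_norm intro!: exI[of _ r0])
  have "filterlim (\<lambda>w::complex. norm w) (at_right 0) (at 0 within quadrant \<sigma>)"
    unfolding filterlim_at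
  proof
    show "\<forall>\<^sub>F w in at 0 within quadrant \<sigma>. norm w \<in> {0<..} \<and> norm w \<noteq> 0"
      using near by eventually_elim (auto simp: quadrant_def)
  qed (rule norm0)
  then have lim1: "((\<lambda>w. G (complex_of_real (norm w) * cis (\<sigma> * (pi / 4)))) \<longlongrightarrow> l) (at 0 within quadrant \<sigma>)"
    by (rule filterlim_compose[OF ray])
  have lim2: "((\<lambda>w. G w - G (complex_of_real (norm w) * cis (\<sigma> * (pi / 4)))) \<longlongrightarrow> 0) (at 0 within quadrant \<sigma>)"
  proof (rule Lim_null_comparison)
    show "\<forall>\<^sub>F w in at 0 within quadrant \<sigma>. norm (G w - G (complex_of_real (norm w) * cis (\<sigma> * (pi / 4)))) \<le> K * norm w powr c"
      using near by eventually_elim (use diff in blast)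
    have "((\<lambda>w::complex. norm w powr c) \<longlongrightarrow> 0) (at 0 within quadrant \<sigma>)"
      using \<open>c > 0\<close> by (intro tendsto_zero_powrI[OF norm0 tendsto_const]) auto
    from tendsto_mult_left[OF this, of K] show "((\<lambda>w::complex. K * norm w powr c) \<longlongrightarrow> 0) (at 0 within quadrant \<sigma>)" by simp
  qed
  from tendsto_add[OF lim1 lim2] show ?thesis by simp
qed

text \<open>Within the unit disc the slit half-plane misses the real line, so a path there cannot change from
  one quadrant to the other.\<close>

lemma path_side_of_slit:
  assumes I: "connected I" "I \<noteq> {}" and cont: "continuous_on I \<gamma>"
    and \<gamma>: "\<And>s. s \<in> I \<Longrightarrow> \<gamma> s \<in> slit_half_plane \<and> norm (\<gamma> s) < 1"
  obtains \<sigma> :: real where "\<sigma> = 1 \<or> \<sigma> = -1" "\<And>s. s \<in> I \<Longrightarrow> \<gamma> s \<in> quadrant \<sigma>"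
proof -
  have im: "Im (\<gamma> s) \<noteq> 0" "Re (\<gamma> s) > 0" if "s \<in> I" for s
    using \<gamma>[OF that] complex_Re_le_cmod[of "\<gamma> s"] by (auto simp: slit_half_plane_iff)
  have conn: "connected ((\<lambda>s. Im (\<gamma> s)) ` I)"
    by (intro connected_continuous_image I continuous_intros cont)
  obtain s0 where s0: "s0 \<in> I" using I by blast
  define \<sigma> where "\<sigma> = sgn (Im (\<gamma> s0))"
  have \<sigma>: "\<sigma> = 1 \<or> \<sigma> = -1" using im(1)[OF s0] by (auto simp: \<sigma>_def sgn_if)
  have "\<sigma> * Im (\<gamma> s) > 0" if s: "s \<in> I" for s
  proof (rule ccontr)
    assume "\<not> ?thesis"
    then have "\<sigma> * Im (\<gamma> s) < 0" using im(1)[OF s] \<sigma> by (auto simp: not_less)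
    then have "min (Im (\<gamma> s)) (Im (\<gamma> s0)) \<le> 0" "0 \<le> max (Im (\<gamma> s)) (Im (\<gamma> s0))"
      using \<sigma> by (auto simp: \<sigma>_def sgn_if split: if_splits)
    moreover have "min (Im (\<gamma> s)) (Im (\<gamma> s0)) \<in> (\<lambda>s. Im (\<gamma> s)) ` I" "max (Im (\<gamma> s)) (Im (\<gamma> s0)) \<in> (\<lambda>s. Im (\<gamma> s)) ` I"
      using s s0 by (auto simp: min_def max_def)
    ultimately have "0 \<in> (\<lambda>s. Im (\<gamma> s)) ` I"
      using connected_contains_Icc[OF conn] by (meson atLeastAtMost_iff subsetD)
    then show False using im(1) by auto
  qed
  then show ?thesis using that[OF \<sigma>] im(2) by (auto simp: quadrant_def)
qed

text \<open>The fundamental theorem of calculus for a path whose endpoints lie on the boundary of the domain: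
  the primitive is extended along the path by its limits. The gauge integral suits this situation
  because it asks only for continuity of the primitive at the endpoints.\<close>

lemma contour_integral_via_boundary_limits:
  fixes G f :: "complex \<Rightarrow> complex" and l :: "real \<Rightarrow> complex"
  assumes vp: "valid_path \<gamma>" and ends: "pathstart \<gamma> = 0" "pathfinish \<gamma> = 0"
    and inside: "\<And>s. 0 < s \<Longrightarrow> s < 1 \<Longrightarrow> \<gamma> s \<in> slit_half_plane"
    and start: "\<forall>\<^sub>F s in at_right 0. \<gamma> s \<in> quadrant \<sigma>0" and finish: "\<forall>\<^sub>F s in at_left 1. \<gamma> s \<in> quadrant \<sigma>1"
    and G: "\<And>w. w \<in> slit_half_plane \<Longrightarrow> (G has_field_derivative f w) (at w)"
    and l0: "(G \<longlongrightarrow> l \<sigma>0) (at 0 within quadrant \<sigma>0)" and l1: "(G \<longlongrightarrow> l \<sigma>1) (at 0 within quadrant \<sigma>1)"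
  shows "(f has_contour_integral (l \<sigma>1 - l \<sigma>0)) \<gamma>"
proof -
  define h where "h s = (if s \<le> 0 then l \<sigma>0 else if s \<ge> 1 then l \<sigma>1 else G (\<gamma> s))" for s
  have cont: "continuous_on {0..1} \<gamma>" using vp by (simp add: path_def valid_path_imp_path[unfolded path_def])
  have g01: "\<gamma> 0 = 0" "\<gamma> 1 = 0" using ends by (auto simp: pathstart_def pathfinish_def)
  have nz: "w \<noteq> 0" if "w \<in> quadrant \<sigma>" for w \<sigma> using that by (auto simp: quadrant_def)
  have h_open: "h s = G (\<gamma> s)" if "0 < s" "s < 1" for s using that by (simp add: h_def)
  obtain S where S: "finite S" "\<gamma> C1_differentiable_on {0..1} - S"
    using vp by (auto simp: valid_path_def piecewise_C1_differentiable_on_def)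
  have hcont: "continuous_on {0..1} h"
  proof (rule continuous_on_IccI)
    have lim: "(\<gamma> \<longlongrightarrow> 0) (at_right 0)"
      using continuous_on_Icc_at_rightD[OF cont] g01 by simp
    have "filterlim \<gamma> (at 0 within quadrant \<sigma>0) (at_right 0)"
      unfolding filterlim_at using lim start nz by (auto elim!: eventually_mono)
    then have "((\<lambda>s. G (\<gamma> s)) \<longlongrightarrow> l \<sigma>0) (at_right 0)" by (rule filterlim_compose[OF l0])
    moreover have "\<forall>\<^sub>F s in at_right 0. h s = G (\<gamma> s)"
      using eventually_at_right_real[of 0 1] by (auto elim!: eventually_mono simp: h_open)
    ultimately show "(h \<longlongrightarrow> h 0) (at_right 0)" by (simp add: h_def[of 0] tendsto_cong)
    have lim: "(\<gamma> \<longlongrightarrow> 0) (at_left 1)"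
      using continuous_on_Icc_at_leftD[OF cont] g01 by simp
    have "filterlim \<gamma> (at 0 within quadrant \<sigma>1) (at_left 1)"
      unfolding filterlim_at using lim finish nz by (auto elim!: eventually_mono)
    then have "((\<lambda>s. G (\<gamma> s)) \<longlongrightarrow> l \<sigma>1) (at_left 1)" by (rule filterlim_compose[OF l1])
    moreover have "\<forall>\<^sub>F s in at_left 1. h s = G (\<gamma> s)"
      using eventually_at_left_real[of 0 1] by (auto elim!: eventually_mono simp: h_open)
    ultimately show "(h \<longlongrightarrow> h 1) (at_left 1)" by (simp add: h_def[of 1] tendsto_cong)
    fix x :: real assume x: "0 < x" "x < 1"
    have "isCont G (\<gamma> x)" using G[OF inside[OF x]] by (rule DERIV_isCont)
    moreover have "isCont \<gamma> x" using cont x by (simp add: continuous_on_interior)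
    ultimately have "isCont (\<lambda>s. G (\<gamma> s)) x" by (rule continuous_at_compose[unfolded o_def, rotated])
    then have "((\<lambda>s. G (\<gamma> s)) \<longlongrightarrow> h x) (at x)" using x by (simp add: isCont_def h_open)
    moreover have "\<forall>\<^sub>F s in at x. h s = G (\<gamma> s)"
      using eventually_at_in_open'[of "{0<..<1}" x] x by (auto elim!: eventually_mono simp: h_open)
    ultimately show "h \<midarrow>x\<rightarrow> h x" by (simp add: tendsto_cong)
  qed simp
  have "((\<lambda>x. f (\<gamma> x) * vector_derivative \<gamma> (at x)) has_integral (h 1 - h 0)) {0..1}"
  proof (rule fundamental_theorem_of_calculus_interior_strong[OF S(1)])
    fix x assume x: "x \<in> {0<..<1} - S"
    have "(\<gamma> has_vector_derivative vector_derivative \<gamma> (at x)) (at x)"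
      using S(2) x by (simp add: C1_differentiable_on_eq vector_derivative_works[symmetric])
    from field_vector_diff_chain_at[OF this G[OF inside]] x
    have "((\<lambda>s. G (\<gamma> s)) has_vector_derivative f (\<gamma> x) * vector_derivative \<gamma> (at x)) (at x)"
      by (simp add: o_def mult.commute)
    then show "(h has_vector_derivative f (\<gamma> x) * vector_derivative \<gamma> (at x)) (at x)"
      by (rule has_vector_derivative_transform_within_open[of _ _ _ "{0<..<1}"]) (use x in \<open>auto simp: h_open\<close>)
  qed (use hcont in auto)
  then show ?thesis by (simp add: has_contour_integral h_def)
qed

lemma Ln_minus_1_in_quadrant:
  assumes "\<sigma> = 1 \<or> \<sigma> = -1" "w \<in> quadrant \<sigma>"
  shows "Ln (w - 1) = Ln (1 - w) + \<i> * of_real (\<sigma> * pi)"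
proof -
  have "1 - w \<noteq> 0" using assms by (auto simp: quadrant_def)
  from Ln_minus[OF this] show ?thesis using assms by (auto simp: quadrant_def)
qed

lemma slit_minus_1: "w \<in> slit_half_plane \<Longrightarrow> w - 1 \<notin> \<real>\<^sub>\<le>\<^sub>0"
  by (auto simp: slit_half_plane_iff complex_nonpos_Reals_iff)

text \<open>The winding number decides on which side the loop starts and ends. The primitive \<open>Ln (w - 1)\<close> of
  \<open>1 / (w - 1)\<close> has the limits \<open>\<plusminus> \<i> \<pi>\<close> at 0 from above and below, so winding number 1 is possible only if
  the loop starts below and ends above.\<close>

lemma loop_contour_integral:
  fixes G f :: "complex \<Rightarrow> complex" and l :: "real \<Rightarrow> complex"
  assumes loop: "loop_from_0_around_1 \<gamma>"
    and G: "\<And>w. w \<in> slit_half_plane \<Longrightarrow> (G has_field_derivative f w) (at w)"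
    and l: "(G \<longlongrightarrow> l 1) (at 0 within quadrant 1)" "(G \<longlongrightarrow> l (-1)) (at 0 within quadrant (-1))"
  shows "(f has_contour_integral (l 1 - l (-1))) \<gamma>"
proof -
  have vp: "valid_path \<gamma>" and ends: "pathstart \<gamma> = 0" "pathfinish \<gamma> = 0"
    and inside: "\<And>s. 0 < s \<Longrightarrow> s < 1 \<Longrightarrow> \<gamma> s \<in> slit_half_plane" and wind: "winding_number \<gamma> 1 = 1"
    using loop by (auto simp: loop_from_0_around_1_def slit_half_plane_def)
  have cont: "continuous_on {0..1} \<gamma>" using vp by (simp add: path_def valid_path_imp_path[unfolded path_def])
  have g01: "\<gamma> 0 = 0" "\<gamma> 1 = 0" using ends by (auto simp: pathstart_def pathfinish_def)
  obtain d where d: "d > 0" "\<And>s. s \<in> {0..1} \<Longrightarrow> dist s 0 < d \<Longrightarrow> norm (\<gamma> s) < 1"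
    using cont[unfolded continuous_on_iff, rule_format, of 0 1] g01 by (auto simp: dist_norm)
  obtain d' where d': "d' > 0" "\<And>s. s \<in> {0..1} \<Longrightarrow> dist s 1 < d' \<Longrightarrow> norm (\<gamma> s) < 1"
    using cont[unfolded continuous_on_iff, rule_format, of 1 1] g01 by (auto simp: dist_norm)
  define e where "e = min (1/2) (min d d')"
  have e: "0 < e" "e \<le> 1/2" "e \<le> d" "e \<le> d'" using d d' by (auto simp: e_def)
  obtain \<sigma>0 where \<sigma>0: "\<sigma>0 = 1 \<or> \<sigma>0 = -1" "\<And>s. s \<in> {0<..<e} \<Longrightarrow> \<gamma> s \<in> quadrant \<sigma>0"
  proof (rule path_side_of_slit[of "{0<..<e}" \<gamma>])
    show "continuous_on {0<..<e} \<gamma>" using e by (intro continuous_on_subset[OF cont]) auto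
    show "\<gamma> s \<in> slit_half_plane \<and> norm (\<gamma> s) < 1" if "s \<in> {0<..<e}" for s
      using that e inside[of s] d(2)[of s] by (auto simp: dist_norm)
  qed (use e in auto)
  obtain \<sigma>1 where \<sigma>1: "\<sigma>1 = 1 \<or> \<sigma>1 = -1" "\<And>s. s \<in> {1-e<..<1} \<Longrightarrow> \<gamma> s \<in> quadrant \<sigma>1"
  proof (rule path_side_of_slit[of "{1-e<..<1}" \<gamma>])
    show "continuous_on {1-e<..<1} \<gamma>" using e by (intro continuous_on_subset[OF cont]) auto
    show "\<gamma> s \<in> slit_half_plane \<and> norm (\<gamma> s) < 1" if "s \<in> {1-e<..<1}" for s
      using that e inside[of s] d'(2)[of s] by (auto simp: dist_norm)
  qed (use e in auto)
  have start: "\<forall>\<^sub>F s in at_right 0. \<gamma> s \<in> quadrant \<sigma>0"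
    using eventually_at_right_real[of 0 e] e by (auto elim!: eventually_mono simp: \<sigma>0)
  have finish: "\<forall>\<^sub>F s in at_left 1. \<gamma> s \<in> quadrant \<sigma>1"
    using eventually_at_left_real[of "1-e" 1] e by (auto elim!: eventually_mono simp: \<sigma>1)
  have "1 \<notin> path_image \<gamma>"
  proof
    assume "1 \<in> path_image \<gamma>"
    then obtain s where s: "0 \<le> s" "s \<le> 1" "\<gamma> s = 1" by (auto simp: path_image_def)
    then have "s \<noteq> 0" "s \<noteq> 1" using g01 by auto
    then show False using s inside[of s] by (auto simp: slit_half_plane_iff)
  qed
  have Ln_lim: "((\<lambda>w. Ln (w - 1)) \<longlongrightarrow> \<i> * of_real (\<sigma> * pi)) (at 0 within quadrant \<sigma>)"
    if \<sigma>: "\<sigma> = 1 \<or> \<sigma> = -1" for \<sigma>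
  proof -
    have "((\<lambda>w. Ln (1 - w) + \<i> * of_real (\<sigma> * pi)) \<longlongrightarrow> Ln (1 - 0) + \<i> * of_real (\<sigma> * pi)) (at 0 within quadrant \<sigma>)"
      by (intro tendsto_intros) auto
    moreover have "\<forall>\<^sub>F w in at 0 within quadrant \<sigma>. Ln (w - 1) = Ln (1 - w) + \<i> * of_real (\<sigma> * pi)"
      using Ln_minus_1_in_quadrant[OF \<sigma>] by (auto simp: eventually_at_filter)
    ultimately show ?thesis by (simp add: tendsto_cong)
  qed
  have "((\<lambda>w. 1 / (w - 1)) has_contour_integral (\<i> * of_real (\<sigma>1 * pi) - \<i> * of_real (\<sigma>0 * pi))) \<gamma>"
  proof (rule contour_integral_via_boundary_limits[OF vp ends inside start finish,
        where G="\<lambda>w. Ln (w - 1)" and l="\<lambda>\<sigma>. \<i> * of_real (\<sigma> * pi)"])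
    fix w assume "w \<in> slit_half_plane"
    then show "((\<lambda>w. Ln (w - 1)) has_field_derivative 1 / (w - 1)) (at w)"
      using slit_minus_1[of w] by (auto intro!: derivative_eq_intros simp: divide_inverse)
  qed (use Ln_lim \<sigma>0 \<sigma>1 in auto)
  then have "2 * pi * \<i> = \<i> * of_real (\<sigma>1 * pi) - \<i> * of_real (\<sigma>0 * pi)"
    using has_contour_integral_winding_number[OF vp \<open>1 \<notin> path_image \<gamma>\<close>] wind
    by (metis has_contour_integral_unique mult.right_neutral)
  also have "\<dots> = (\<sigma>1 - \<sigma>0) * pi * \<i>" by (simp add: algebra_simps)
  finally have "complex_of_real 2 = complex_of_real (\<sigma>1 - \<sigma>0)" by simp
  then have "\<sigma>1 - \<sigma>0 = 2" by (simp only: of_real_eq_iff)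
  then have "\<sigma>1 = 1" "\<sigma>0 = -1" using \<sigma>0(1) \<sigma>1(1) by auto
  then show ?thesis
    using contour_integral_via_boundary_limits[OF vp ends inside start finish G] l by simp
qed

section \<open>The exponential of the integrated logarithm\<close>

text \<open>Divide by \<open>w\<close>: the real part of \<open>1 / w + \<i> y\<close> is that of \<open>1 / w\<close>, whatever the real number \<open>y\<close>.\<close>

lemma norm_one_plus_i_mult_ge:
  assumes "Re w > 0"
  shows "Re w / norm w \<le> norm (1 + \<i> * w * complex_of_real y)"
proof -
  have nz: "w \<noteq> 0" using assms by auto
  have "Re w / norm w = norm w * Re (1 / w)"
  proof -
    have "Re (1 / w) = Re w / (norm w)\<^sup>2" by (simp add: Re_divide cmod_power2)
    then show ?thesis using nz by (simp add: power2_eq_square)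
  qed
  also have "Re (1 / w) = Re (1 / w + \<i> * complex_of_real y)" by simp
  also have "norm w * \<dots> \<le> norm w * norm (1 / w + \<i> * complex_of_real y)"
    by (intro mult_left_mono complex_Re_le_cmod) auto
  also have "\<dots> = norm (1 + \<i> * w * complex_of_real y)"
  proof -
    have "1 + \<i> * w * complex_of_real y = w * (1 / w + \<i> * complex_of_real y)"
      using nz by (simp add: distrib_left mult_ac)
    then show ?thesis by (simp only: norm_mult)
  qed
  finally show ?thesis .
qed

lemma one_plus_i_mult_not_nonpos:
  assumes "Re w > 0"
  shows "1 + \<i> * w * complex_of_real y \<notin> \<real>\<^sub>\<le>\<^sub>0"
  using assms by (auto simp: complex_nonpos_Reals_iff)

lemma norm_Re_quotient_ge_1: "Re w > 0 \<Longrightarrow> 1 \<le> norm w / Re w"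
  using complex_Re_le_cmod[of w] by simp

abbreviation (input) line_factor :: "real \<Rightarrow> complex \<Rightarrow> real \<Rightarrow> complex" where
  "line_factor t w x \<equiv> 1 + \<i> * w * complex_of_real t * complex_of_real x"

definition exp_log_transform :: "real measure \<Rightarrow> real \<Rightarrow> complex \<Rightarrow> complex" where
  "exp_log_transform \<alpha> t w =
    exp (- (LINT x|\<alpha>. Ln (line_factor t w x)))"

context
  fixes \<alpha> :: "real measure" and a t :: real
  assumes \<alpha>: "\<alpha> \<in> log_finite_measures a"
begin

lemma log_finite_measure_facts:
  shows "sets \<alpha> = sets borel" "finite_measure \<alpha>" "measure \<alpha> UNIV = a"
    "integrable \<alpha> (\<lambda>x. ln (1 + \<bar>x\<bar>))" "space \<alpha> = UNIV"
  using \<alpha> sets_eq_imp_space_eq[of \<alpha> borel] by (auto simp: log_finite_measures_def)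

lemma ln_norm_line_factor_ge:
  assumes w: "Re w > 0"
  shows "0 < norm (line_factor t w x)" and "- ln (norm w / Re w) \<le> ln (norm (line_factor t w x))"
proof -
  have "norm w > 0" using w by auto
  then have pos: "0 < Re w / norm w" and eq: "- ln (norm w / Re w) = ln (Re w / norm w)"
    using w by (simp_all add: ln_div)
  have low: "Re w / norm w \<le> norm (line_factor t w x)"
    using norm_one_plus_i_mult_ge[OF w, of "t * x"] by (simp add: mult.assoc)
  with pos show v: "0 < norm (line_factor t w x)" by linarith
  show "- ln (norm w / Re w) \<le> ln (norm (line_factor t w x))"
    unfolding eq using low pos v by (simp only: ln_le_cancel_iff)
qed

lemma ln_norm_bounds:
  assumes w: "Re w > 0"
  shows "\<bar>ln (norm (line_factor t w x))\<bar> \<le>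
      ln (1 + norm w * \<bar>t\<bar>) + ln (1 + \<bar>x\<bar>) + ln (norm w / Re w)"
proof -
  let ?v = "line_factor t w x"
  have q: "1 \<le> norm w / Re w" by (rule norm_Re_quotient_ge_1[OF w])
  note vpos = ln_norm_line_factor_ge(1)[OF w, of x] and 1 = ln_norm_line_factor_ge(2)[OF w, of x]
  have "norm ?v \<le> 1 + norm w * \<bar>t\<bar> * \<bar>x\<bar>"
    by (rule order_trans[OF norm_triangle_ineq]) (simp add: norm_mult)
  also have "\<dots> \<le> (1 + norm w * \<bar>t\<bar>) * (1 + \<bar>x\<bar>)" by (simp add: algebra_simps)
  finally have up: "norm ?v \<le> (1 + norm w * \<bar>t\<bar>) * (1 + \<bar>x\<bar>)" .
  have "ln (norm ?v) \<le> ln ((1 + norm w * \<bar>t\<bar>) * (1 + \<bar>x\<bar>))"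
    using up vpos by (subst ln_le_cancel_iff) (linarith+)
  also have "\<dots> = ln (1 + norm w * \<bar>t\<bar>) + ln (1 + \<bar>x\<bar>)"
    by (rule ln_mult_pos) (auto intro: add_pos_nonneg)
  finally have 2: "ln (norm ?v) \<le> ln (1 + norm w * \<bar>t\<bar>) + ln (1 + \<bar>x\<bar>)" .
  have "0 \<le> ln (norm w / Re w)" using q by (rule ln_ge_zero)
  moreover have "0 \<le> ln (1 + norm w * \<bar>t\<bar>)" "0 \<le> ln (1 + \<bar>x\<bar>)" by auto
  ultimately show ?thesis using 1 2 by (simp only: abs_le_iff) linarith
qed

lemma norm_Ln_bound:
  assumes w: "Re w > 0"
  shows "norm (Ln (line_factor t w x)) \<le>
      ln (1 + norm w * \<bar>t\<bar>) + ln (1 + \<bar>x\<bar>) + ln (norm w / Re w) + pi"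
proof -
  have "line_factor t w x \<noteq> 0"
    using one_plus_i_mult_not_nonpos[OF w, of "t * x"] by (auto simp: mult.assoc)
  from norm_Ln_le[OF this] ln_norm_bounds[OF w, of x] show ?thesis by linarith
qed

lemma measurable_Ln_kernel:
  assumes w: "Re w > 0"
  shows "(\<lambda>x. Ln (line_factor t w x)) \<in> borel_measurable \<alpha>"
proof -
  have "continuous_on UNIV (\<lambda>x. Ln (line_factor t w x))"
    using one_plus_i_mult_not_nonpos[OF w, of "t * x" for x]
    by (intro continuous_intros) (auto simp: mult.assoc)
  then show ?thesis
    by (simp add: borel_measurable_continuous_onI measurable_cong_sets[OF log_finite_measure_facts(1) refl])
qed

lemma integrable_Ln_kernel:
  assumes w: "Re w > 0"
  shows "integrable \<alpha> (\<lambda>x. Ln (line_factor t w x))"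
proof (rule Bochner_Integration.integrable_bound)
  interpret finite_measure \<alpha> by (rule log_finite_measure_facts)
  show "integrable \<alpha> (\<lambda>x. ln (1 + norm w * \<bar>t\<bar>) + ln (1 + \<bar>x\<bar>) + ln (norm w / Re w) + pi)"
    using log_finite_measure_facts(4) by auto
  show "AE x in \<alpha>. norm (Ln (line_factor t w x))
       \<le> norm (ln (1 + norm w * \<bar>t\<bar>) + ln (1 + \<bar>x\<bar>) + ln (norm w / Re w) + pi)"
  proof (intro AE_I2)
    fix x
    show "norm (Ln (line_factor t w x))
       \<le> norm (ln (1 + norm w * \<bar>t\<bar>) + ln (1 + \<bar>x\<bar>) + ln (norm w / Re w) + pi)"
      unfolding real_norm_def by (rule order_trans[OF norm_Ln_bound[OF w] abs_ge_self])
  qed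
qed (rule measurable_Ln_kernel[OF w])

lemma exp_log_transform_holomorphic: "exp_log_transform \<alpha> t holomorphic_on {w. 0 < Re w}"
proof -
  interpret finite_measure \<alpha> by (rule log_finite_measure_facts)
  have "(\<lambda>w. LINT x|\<alpha>. Ln (line_factor t w x)) holomorphic_on {w. 0 < Re w}"
  proof (rule holomorphic_on_lebesgue_integral)
    show "(\<lambda>w. Ln (line_factor t w x)) holomorphic_on {w. 0 < Re w}" for x
      using one_plus_i_mult_not_nonpos[of _ "t * x"]
      by (intro holomorphic_intros) (auto simp: mult.assoc)
    fix z :: complex assume "z \<in> {w. 0 < Re w}"
    then have z: "Re z > 0" by simp
    define r where "r = Re z / 2"
    have r: "r > 0" using z by (simp add: r_def)
    define R where "R = norm z + r"
    have w: "Re w \<ge> r \<and> norm w \<le> R" if "w \<in> cball z r" for w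
      using half_Re_cball[OF z, of w] that by (simp add: r_def R_def)
    let ?b = "\<lambda>x. ln (1 + R * \<bar>t\<bar>) + ln (1 + \<bar>x\<bar>) + ln (R / r) + pi"
    have "integrable \<alpha> ?b" using log_finite_measure_facts(4) by auto
    moreover have "cball z r \<subseteq> {w. 0 < Re w}" using w r by force
    moreover have "norm (Ln (line_factor t v x)) \<le> ?b x" if v: "v \<in> cball z r" for v x
    proof -
      have v': "Re v > 0" "norm v > 0" "r \<le> Re v" "norm v \<le> R" using w[OF v] r by auto
      have "norm v / Re v \<le> R / r" by (rule frac_le) (use v' r in linarith)+
      moreover have "0 < norm v / Re v" using v' by simp
      ultimately have "ln (norm v / Re v) \<le> ln (R / r)" by (subst ln_le_cancel_iff) linarith+
      moreover have "ln (1 + norm v * \<bar>t\<bar>) \<le> ln (1 + R * \<bar>t\<bar>)"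
      proof -
        have "norm v * \<bar>t\<bar> \<le> R * \<bar>t\<bar>" using v' by (intro mult_right_mono) auto
        moreover have "0 \<le> norm v * \<bar>t\<bar>" by simp
        ultimately show ?thesis by (subst ln_le_cancel_iff) linarith+
      qed
      ultimately show ?thesis using norm_Ln_bound[OF v'(1), of x] by linarith
    qed
    ultimately show "\<exists>r>0. \<exists>b. integrable \<alpha> b \<and> cball z r \<subseteq> {w. 0 < Re w} \<and>
        (\<forall>w\<in>cball z r. \<forall>x\<in>space \<alpha>. norm (Ln (line_factor t w x)) \<le> b x)"
      using r by blast
  qed (use measurable_Ln_kernel in \<open>auto simp: open_halfspace_Re_gt\<close>)
  then show ?thesis
    unfolding exp_log_transform_def by (intro holomorphic_intros)
qed

lemma norm_exp_log_transform:
  assumes w: "Re w > 0"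
  shows "norm (exp_log_transform \<alpha> t w) =
      exp (- (LINT x|\<alpha>. ln (norm (line_factor t w x))))"
    and "integrable \<alpha> (\<lambda>x. ln (norm (line_factor t w x)))"
proof -
  have nz: "line_factor t w x \<noteq> 0" for x
    using one_plus_i_mult_not_nonpos[OF w, of "t * x"] by (auto simp: mult.assoc)
  have re: "Re (Ln (line_factor t w x)) =
      ln (norm (line_factor t w x))" for x
    by (rule Re_Ln[OF nz])
  show "norm (exp_log_transform \<alpha> t w) =
      exp (- (LINT x|\<alpha>. ln (norm (line_factor t w x))))"
    unfolding exp_log_transform_def norm_exp_eq_Re uminus_complex.sel integral_Re[OF integrable_Ln_kernel[OF w], symmetric] re ..
  show "integrable \<alpha> (\<lambda>x. ln (norm (line_factor t w x)))"
    using integrable_Re[OF integrable_Ln_kernel[OF w]] unfolding re .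
qed

lemma exp_log_transform_bound:
  assumes w: "Re w > 0"
  shows "norm (exp_log_transform \<alpha> t w) \<le> (norm w / Re w) powr a"
proof -
  interpret finite_measure \<alpha> by (rule log_finite_measure_facts)
  have wpos: "norm w > 0" using w by auto
  have "- (LINT x|\<alpha>. ln (norm (line_factor t w x))) =
     (LINT x|\<alpha>. - ln (norm (line_factor t w x)))" by simp
  also have "\<dots> \<le> (LINT x|\<alpha>. ln (norm w / Re w))"
  proof (rule integral_mono)
    fix x
    show "- ln (norm (line_factor t w x)) \<le> ln (norm w / Re w)"
      using ln_norm_line_factor_ge(2)[OF w, of x] by linarith
  qed (use norm_exp_log_transform(2)[OF w] in auto)
  also have "\<dots> = a * ln (norm w / Re w)" using log_finite_measure_facts by simp
  finally have "norm (exp_log_transform \<alpha> t w) \<le> exp (a * ln (norm w / Re w))"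
    unfolding norm_exp_log_transform(1)[OF w] by simp
  then show ?thesis using w wpos by (simp add: powr_def)
qed

text \<open>Near 0 the exponent \<open>a\<close> of the previous bound can be replaced by \<open>1 / 2\<close>. The factor \<open>1 + \<i> w t x\<close>
  can be small only if \<open>\<bar>w t x\<bar> > 1 / 2\<close>, and for small \<open>w\<close> the measure of these \<open>x\<close> is below \<open>1 / 2\<close>.
  Any exponent below 1 would make the bound integrable over quarter circles.\<close>

lemma exp_log_transform_near_0:
  obtains r where "r > 0"
    "\<And>w. 0 < Re w \<Longrightarrow> norm w < r \<Longrightarrow> norm (exp_log_transform \<alpha> t w) \<le> 2 powr a * sqrt (norm w / Re w)"
proof -
  interpret finite_measure \<alpha> by (rule log_finite_measure_facts)
  note [measurable_cong] = log_finite_measure_facts(1)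
  define A where "A n = {x. 1 < 2 * (1 / real (Suc n)) * \<bar>t\<bar> * \<bar>x\<bar>}" for n
  have A_sets: "A n \<in> sets \<alpha>" for n
  proof -
    have "A n = {x \<in> space \<alpha>. 1 < 2 * (1 / real (Suc n)) * \<bar>t\<bar> * \<bar>x\<bar>}" by (auto simp: A_def log_finite_measure_facts)
    also have "\<dots> \<in> sets \<alpha>" by measurable
    finally show ?thesis .
  qed
  have dec: "decseq A"
    unfolding decseq_def
  proof (intro allI impI subsetI)
    fix m n :: nat and x assume mn: "m \<le> n" "x \<in> A n"
    have "2 * (1 / real (Suc n)) * \<bar>t\<bar> * \<bar>x\<bar> \<le> 2 * (1 / real (Suc m)) * \<bar>t\<bar> * \<bar>x\<bar>"
      using mn by (intro mult_right_mono mult_left_mono frac_le) auto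
    then show "x \<in> A m" using mn(2) unfolding A_def mem_Collect_eq by linarith
  qed
  have "(\<lambda>n. measure \<alpha> (A n)) \<longlonglongrightarrow> measure \<alpha> (\<Inter>n. A n)"
    using A_sets dec by (intro finite_Lim_measure_decseq) auto
  also have "(\<Inter>n. A n) = {}"
  proof -
    have "x \<notin> (\<Inter>n. A n)" for x
    proof -
      obtain n where n: "2 * \<bar>t\<bar> * \<bar>x\<bar> < real n" using reals_Archimedean2 by blast
      then have "2 * \<bar>t\<bar> * \<bar>x\<bar> / real (Suc n) \<le> 1" by simp
      then have "x \<notin> A n" by (simp add: A_def)
      then show ?thesis by blast
    qed
    then show ?thesis by blast
  qed
  finally have "(\<lambda>n. measure \<alpha> (A n)) \<longlonglongrightarrow> 0" by simp
  then have "\<forall>\<^sub>F n in sequentially. measure \<alpha> (A n) < 1 / 2"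
    by (rule order_tendstoD) simp
  then obtain n where n: "measure \<alpha> (A n) < 1 / 2" by (auto simp: eventually_sequentially)
  define r where "r = 1 / real (Suc n)"
  show ?thesis
  proof
    show "r > 0" by (simp add: r_def)
    fix w :: complex assume w: "0 < Re w" "norm w < r"
    have wpos: "norm w > 0" using w by auto
    let ?L = "ln (norm w / Re w)"
    have L: "?L \<ge> 0" using norm_Re_quotient_ge_1[OF w(1)] by (rule ln_ge_zero)
    have "- (LINT x|\<alpha>. ln (norm (line_factor t w x))) =
       (LINT x|\<alpha>. - ln (norm (line_factor t w x)))" by simp
    also have "\<dots> \<le> (LINT x|\<alpha>. ln 2 + indicator (A n) x * ?L)"
    proof (rule integral_mono)
      show "integrable \<alpha> (\<lambda>x. ln 2 + indicator (A n) x * ?L)"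
        using A_sets by (auto intro!: integrable_mult_left simp: emeasure_eq_measure)
      fix x
      let ?v = "line_factor t w x"
      note vpos = ln_norm_line_factor_ge(1)[OF w(1), of x]
      show "- ln (norm ?v) \<le> ln 2 + indicator (A n) x * ?L"
      proof (cases "x \<in> A n")
        case True
        have "- ?L \<le> ln (norm ?v)" by (rule ln_norm_line_factor_ge(2)[OF w(1)])
        moreover have "0 < ln (2::real)" by simp
        moreover have "indicator (A n) x * ?L = ?L" using True by simp
        ultimately show ?thesis by linarith
      next
        case False
        then have "r * (\<bar>t\<bar> * \<bar>x\<bar>) \<le> 1 / 2" by (simp add: A_def r_def)
        moreover have "norm w * (\<bar>t\<bar> * \<bar>x\<bar>) \<le> r * (\<bar>t\<bar> * \<bar>x\<bar>)" using w by (intro mult_right_mono) auto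
        moreover have "norm (1::complex) - norm (\<i> * w * complex_of_real t * complex_of_real x) \<le> norm ?v"
          by (rule norm_diff_ineq)
        ultimately have "1 / 2 \<le> norm ?v" by (simp add: norm_mult mult.assoc)
        then have "ln (1 / 2) \<le> ln (norm ?v)" using vpos by (subst ln_le_cancel_iff) auto
        then show ?thesis using False by (simp add: ln_div)
      qed
    qed (use norm_exp_log_transform(2)[OF w(1)] in auto)
    also have "\<dots> = a * ln 2 + measure \<alpha> (A n) * ?L"
      using A_sets log_finite_measure_facts
      by (subst Bochner_Integration.integral_add)
        (auto intro!: integrable_mult_left simp: emeasure_eq_measure)
    also have "\<dots> \<le> a * ln 2 + 1 / 2 * ?L"
      using n L by (intro add_left_mono mult_right_mono) auto
    finally have "norm (exp_log_transform \<alpha> t w) \<le> exp (a * ln 2 + 1 / 2 * ?L)"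
      unfolding norm_exp_log_transform(1)[OF w(1)] by simp
    also have "\<dots> = 2 powr a * (norm w / Re w) powr (1 / 2)"
      using w wpos by (simp add: powr_def exp_add)
    also have "(norm w / Re w) powr (1 / 2) = sqrt (norm w / Re w)"
      using w wpos by (simp add: powr_half_sqrt)
    finally show "norm (exp_log_transform \<alpha> t w) \<le> 2 powr a * sqrt (norm w / Re w)" .
  qed
qed

end

section \<open>Triangular and collapsed contours\<close>

definition corner :: "real \<Rightarrow> complex" where
  "corner \<sigma> = Complex 2 (2 * \<sigma>)"

text \<open>The integrand of the contour integral over the triangle from 0 to \<open>2 - 2 \<i>\<close>, to \<open>2 + 2 \<i>\<close> and back
  to 0, with the three sides parametrised over the same unit interval and added up. The triangle
  stays in a sector around the positive axis, so that estimates are uniform.\<close>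

definition triangle_integrand :: "(complex \<Rightarrow> complex) \<Rightarrow> real \<Rightarrow> complex" where
  "triangle_integrand f s =
    corner (-1) * f (of_real s * corner (-1))
    + (corner 1 - corner (-1)) * f (corner (-1) + of_real s * (corner 1 - corner (-1)))
    - corner 1 * f (of_real s * corner 1)"

lemma ray_in_quadrant:
  assumes "\<sigma> = 1 \<or> \<sigma> = -1" "s > 0"
  shows "complex_of_real s * corner \<sigma> \<in> quadrant \<sigma>"
  using assms by (auto simp: quadrant_def corner_def)

lemma corner_edge: "corner (-1) + of_real s * (corner 1 - corner (-1)) = Complex 2 (4 * s - 2)"
  by (simp add: corner_def complex_eq_iff)

lemma edge_in_slit: "Complex 2 y \<in> slit_half_plane"
  by (simp add: slit_half_plane_iff)

lemma FTC_line:
  fixes G f :: "complex \<Rightarrow> complex"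
  assumes "a \<le> b" and G: "\<And>s. a \<le> s \<Longrightarrow> s \<le> b \<Longrightarrow> (G has_field_derivative f (p + of_real s * v)) (at (p + of_real s * v))"
  shows "((\<lambda>s. v * f (p + of_real s * v)) has_integral (G (p + of_real b * v) - G (p + of_real a * v))) {a..b}"
proof (rule fundamental_theorem_of_calculus[OF \<open>a \<le> b\<close>])
  fix s assume s: "s \<in> {a..b}"
  have "((\<lambda>w. p + w * v) has_field_derivative v) (at (of_real s))"
    by (auto intro!: derivative_eq_intros)
  from has_vector_derivative_real_field[OF this]
  have "((\<lambda>s. p + of_real s * v) has_vector_derivative v) (at s)" .
  from field_vector_diff_chain_at[OF this G] s
  show "((\<lambda>s. G (p + of_real s * v)) has_vector_derivative v * f (p + of_real s * v)) (at s within {a..b})"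
    by (auto simp: o_def intro: has_vector_derivative_at_within)
qed

text \<open>Integrability on the two rays gives the limits of the primitive along the rays, and
  \<open>primitive_limit_in_quadrant\<close> extends them to the quadrants.\<close>

lemma slit_primitive_limits:
  fixes f :: "complex \<Rightarrow> complex"
  assumes hol: "f holomorphic_on slit_half_plane" and "c > 0" "r0 > 0" "C \<ge> 0"
    and bd: "\<And>\<sigma> w. \<sigma> = 1 \<or> \<sigma> = -1 \<Longrightarrow> w \<in> quadrant \<sigma> \<Longrightarrow> norm w < r0 \<Longrightarrow>
               norm (f w) \<le> C * norm w powr (c - 1) * sqrt (norm w / Re w)"
    and ray_int: "\<And>\<sigma>. \<sigma> = 1 \<or> \<sigma> = -1 \<Longrightarrow> (\<lambda>s. f (of_real s * corner \<sigma>)) integrable_on {0..1}"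
  obtains G :: "complex \<Rightarrow> complex" and l :: "real \<Rightarrow> complex"
    where "\<And>w. w \<in> slit_half_plane \<Longrightarrow> (G has_field_derivative f w) (at w)"
      "\<And>\<sigma>. \<sigma> = 1 \<or> \<sigma> = -1 \<Longrightarrow> (G \<longlongrightarrow> l \<sigma>) (at 0 within quadrant \<sigma>)"
      "l 1 - l (-1) = integral {0..1} (triangle_integrand f)"
proof -
  obtain G where G: "\<And>w. w \<in> slit_half_plane \<Longrightarrow> (G has_field_derivative f w) (at w)"
    using holomorphic_primitive_starlike[OF hol open_slit_half_plane starlike_slit_half_plane] by blast
  define I where "I \<sigma> = integral {0..1} (\<lambda>s. corner \<sigma> * f (of_real s * corner \<sigma>))" for \<sigma>
  define l where "l \<sigma> = G (corner \<sigma>) - I \<sigma>" for \<sigma>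
  have int: "(\<lambda>s. corner \<sigma> * f (of_real s * corner \<sigma>)) integrable_on {0..1}" if "\<sigma> = 1 \<or> \<sigma> = -1" for \<sigma>
    using ray_int[OF that] by (rule integrable_on_mult_right)
  have lim: "(G \<longlongrightarrow> l \<sigma>) (at 0 within quadrant \<sigma>)" if \<sigma>: "\<sigma> = 1 \<or> \<sigma> = -1" for \<sigma>
  proof (rule primitive_limit_in_quadrant[OF \<sigma> \<open>c > 0\<close> \<open>r0 > 0\<close> \<open>C \<ge> 0\<close> _ bd[OF \<sigma>]])
    show "(G has_field_derivative f w) (at w)" if "w \<in> quadrant \<sigma>" for w
      using that quadrant_subset_slit by (intro G) blast
    have eq: "G (of_real s * corner \<sigma>) = G (corner \<sigma>) - integral {s..1} (\<lambda>s. corner \<sigma> * f (of_real s * corner \<sigma>))"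
      if s: "0 < s" "s < 1" for s
    proof -
      have "((\<lambda>s. corner \<sigma> * f (0 + of_real s * corner \<sigma>)) has_integral
          (G (0 + of_real 1 * corner \<sigma>) - G (0 + of_real s * corner \<sigma>))) {s..1}"
      proof (intro FTC_line G)
        fix x assume "s \<le> x"
        then have "of_real x * corner \<sigma> \<in> quadrant \<sigma>" using s by (intro ray_in_quadrant[OF \<sigma>]) linarith
        then show "0 + of_real x * corner \<sigma> \<in> slit_half_plane" using quadrant_subset_slit by auto
      qed (use s in simp)
      then have "integral {s..1} (\<lambda>s. corner \<sigma> * f (of_real s * corner \<sigma>)) = G (corner \<sigma>) - G (of_real s * corner \<sigma>)"
        by (intro integral_unique) simp
      then show ?thesis by simp
    qed
    have "((\<lambda>s. integral {s..1} (\<lambda>s. corner \<sigma> * f (of_real s * corner \<sigma>))) \<longlongrightarrow> I \<sigma>) (at_right 0)"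
      unfolding I_def
      by (rule continuous_on_Icc_at_rightD[OF indefinite_integral_continuous_1'[OF int[OF \<sigma>]]]) simp
    then have "((\<lambda>s. G (corner \<sigma>) - integral {s..1} (\<lambda>s. corner \<sigma> * f (of_real s * corner \<sigma>))) \<longlongrightarrow> l \<sigma>) (at_right 0)"
      unfolding l_def by (intro tendsto_intros)
    moreover have "\<forall>\<^sub>F s in at_right 0. G (of_real s * corner \<sigma>) = G (corner \<sigma>) - integral {s..1} (\<lambda>s. corner \<sigma> * f (of_real s * corner \<sigma>))"
      using eventually_at_right_real[of 0 1] by (auto elim!: eventually_mono simp: eq)
    ultimately have 1: "((\<lambda>s. G (of_real s * corner \<sigma>)) \<longlongrightarrow> l \<sigma>) (at_right 0)"
      by (simp add: tendsto_cong)
    have "filterlim (\<lambda>s. (1 / (2 * sqrt 2)) * s) (at_right ((1 / (2 * sqrt 2)) * 0)) (at_right (0::real))"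
      by (rule filterlim_times_pos[OF filterlim_ident]) auto
    then have 2: "filterlim (\<lambda>s. (1 / (2 * sqrt 2)) * s) (at_right 0) (at_right (0::real))" by simp
    have "complex_of_real ((1 / (2 * sqrt 2)) * s) * corner \<sigma> = of_real s * cis (\<sigma> * (pi / 4))" for s
    proof -
      have "2 / (2 * sqrt 2) = sqrt 2 / (2::real)" by (simp add: real_div_sqrt)
      then show ?thesis using \<sigma> by (auto simp: corner_def complex_eq_iff cos_45 sin_45 field_simps)
    qed
    then show "((\<lambda>s. G (of_real s * cis (\<sigma> * (pi / 4)))) \<longlongrightarrow> l \<sigma>) (at_right 0)"
      using filterlim_compose[OF 1 2] by simp
  qed
  have edge: "((\<lambda>s. (corner 1 - corner (-1)) * f (corner (-1) + of_real s * (corner 1 - corner (-1)))) has_integral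
      (G (corner (-1) + of_real 1 * (corner 1 - corner (-1))) - G (corner (-1) + of_real 0 * (corner 1 - corner (-1))))) {0..1}"
    by (rule FTC_line) (simp_all only: corner_edge G[OF edge_in_slit] zero_le_one)
  have "(triangle_integrand f has_integral (I (-1) + (G (corner 1) - G (corner (-1))) - I 1)) {0..1}"
    unfolding triangle_integrand_def[abs_def] I_def
    using edge int[of 1] int[of "-1"]
    by (intro has_integral_add has_integral_diff integrable_integral) auto
  then have "integral {0..1} (triangle_integrand f) = l 1 - l (-1)"
    by (auto simp: l_def dest: integral_unique)
  then show ?thesis using that[OF G lim] by simp
qed

text \<open>The domain of \<open>(1 - w) powr (q - 1)\<close>, in which the segment from 0 to 1 is not cut.\<close>

lemma starlike_right_slit: "starlike {w. 0 < Re w \<and> (Im w \<noteq> 0 \<or> Re w < 1)}"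
  unfolding starlike_def
proof (intro bexI ballI subsetI)
  show "1/2 \<in> {w. 0 < Re w \<and> (Im w \<noteq> 0 \<or> Re w < 1)}" by simp
  fix x y assume x: "x \<in> {w. 0 < Re w \<and> (Im w \<noteq> 0 \<or> Re w < 1)}" and "y \<in> closed_segment (1/2) x"
  then obtain u where u: "0 \<le> u" "u \<le> 1" "y = (1 - u) *\<^sub>R (1/2) + u *\<^sub>R x"
    by (auto simp: closed_segment_def)
  have re: "Re y = (1 - u) * (1/2) + u * Re x" and im: "Im y = u * Im x" using u by simp_all
  show "y \<in> {w. 0 < Re w \<and> (Im w \<noteq> 0 \<or> Re w < 1)}"
  proof (cases "u = 0")
    case True
    then show ?thesis using re im by simp
  next
    case False
    then have pos: "u * Re x > 0" using x u by simp
    have nonneg: "(1 - u) * (1/2) \<ge> 0" using u by simp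
    have "Re y < 1" if "Re x < 1"
    proof -
      have "u * Re x < u * 1" using that False u by (intro mult_strict_left_mono) auto
      moreover have "(1 - u) * (1/2) = 1/2 - u/2" by (simp add: field_simps)
      ultimately show ?thesis using u(2) unfolding re by linarith
    qed
    moreover have "0 < Re y" unfolding re using pos nonneg by linarith
    moreover have "Im x \<noteq> 0 \<Longrightarrow> Im y \<noteq> 0" using im False by simp
    ultimately show ?thesis using x by blast
  qed
qed

text \<open>Let \<open>K\<close> be a primitive of \<open>k w * (1 - w) powr (q - 1)\<close>. On each quadrant the integrand of the loop
  is this function times a phase \<open>E \<sigma>\<close>, so there \<open>G\<close> and \<open>E \<sigma> * K\<close> differ by a constant. Compare
  the increments of \<open>G\<close> and \<open>K\<close> from \<open>B \<sigma> r\<close> near 0 to \<open>A \<sigma> r\<close> near 1. Small arcs around 1 and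
  around 0 connect these points with each other and with the segment, and contribute
  \<open>O(r powr q)\<close> and \<open>O(r powr c)\<close>; this is where \<open>q > 0\<close> enters.\<close>

lemma collapse_onto_segment:
  fixes k G :: "complex \<Rightarrow> complex" and l :: "real \<Rightarrow> complex" and c q C :: real
  assumes hol: "k holomorphic_on {w. 0 < Re w}" and "c > 0" "q > 0"
    and bd: "\<And>w. 0 < Re w \<Longrightarrow> \<bar>Im w\<bar> \<le> Re w \<Longrightarrow> norm w \<le> 1 \<Longrightarrow> norm (k w) \<le> C * norm w powr (c - 1)"
    and int: "(\<lambda>u. k (of_real u) * of_real ((1 - u) powr (q - 1))) integrable_on {0..1}"
    and G: "\<And>w. w \<in> slit_half_plane \<Longrightarrow> (G has_field_derivative k w * (w - 1) powr of_real (q - 1)) (at w)"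
    and l: "\<And>\<sigma>. \<sigma> = 1 \<or> \<sigma> = -1 \<Longrightarrow> (G \<longlongrightarrow> l \<sigma>) (at 0 within quadrant \<sigma>)"
  shows "l 1 - l (-1) = 2 * \<i> * of_real (sin (pi * q)) *
           integral {0..1} (\<lambda>u. k (of_real u) * of_real ((1 - u) powr (q - 1)))"
proof -
  let ?S = "{w. 0 < Re w \<and> (Im w \<noteq> 0 \<or> Re w < 1)}"
  define I where "I = integral {0..1} (\<lambda>u. k (of_real u) * of_real ((1 - u) powr (q - 1)))"
  have S_open: "open ?S"
  proof -
    have "?S = {w. 0 < Re w} \<inter> ({w. Im w \<noteq> 0} \<union> {w. Re w < 1})" by auto
    also have "open \<dots>"
      by (intro open_Int open_Un open_halfspace_Re_gt open_halfspace_Re_lt open_Collect_neq continuous_intros)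
    finally show ?thesis .
  qed
  have not_nonpos: "1 - w \<notin> \<real>\<^sub>\<le>\<^sub>0" if "w \<in> ?S" for w using that by (auto simp: complex_nonpos_Reals_iff)
  have "(\<lambda>w. k w * (1 - w) powr of_real (q - 1)) holomorphic_on ?S"
    using not_nonpos by (intro holomorphic_intros holomorphic_on_subset[OF hol]) auto
  from holomorphic_primitive_starlike[OF this S_open starlike_right_slit]
  obtain K where K: "\<And>w. w \<in> ?S \<Longrightarrow> (K has_field_derivative k w * (1 - w) powr of_real (q - 1)) (at w)"
    by blast
  define E where "E \<sigma> = exp (\<i> * of_real (\<sigma> * pi * (q - 1)))" for \<sigma>
  have Q_sub: "quadrant \<sigma> \<subseteq> ?S" for \<sigma> by (auto simp: quadrant_def)
  have GK: "G w2 - G w1 = E \<sigma> * (K w2 - K w1)"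
    if \<sigma>: "\<sigma> = 1 \<or> \<sigma> = -1" and w: "w1 \<in> quadrant \<sigma>" "w2 \<in> quadrant \<sigma>" for \<sigma> w1 w2
  proof -
    have "((\<lambda>w. G w - E \<sigma> * K w) has_field_derivative 0) (at w within quadrant \<sigma>)" if w: "w \<in> quadrant \<sigma>" for w
    proof -
      have "w \<in> slit_half_plane" "w \<in> ?S" using w quadrant_subset_slit Q_sub by blast+
      then have d: "((\<lambda>w. G w - E \<sigma> * K w) has_field_derivative
          (k w * (w - 1) powr of_real (q - 1) - E \<sigma> * (k w * (1 - w) powr of_real (q - 1)))) (at w)"
        using G K by (auto intro!: derivative_eq_intros)
      have "w - 1 \<noteq> 0" "1 - w \<noteq> 0" using w by (auto simp: quadrant_def)
      moreover have "of_real (q - 1) * Ln (w - 1) = \<i> * of_real (\<sigma> * pi * (q - 1)) + of_real (q - 1) * Ln (1 - w)"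
        unfolding Ln_minus_1_in_quadrant[OF \<sigma> w] by (simp add: algebra_simps)
      ultimately have eq: "(w - 1) powr of_real (q - 1) = E \<sigma> * (1 - w) powr of_real (q - 1)"
        unfolding powr_def E_def by (simp only: if_False exp_add)
      have "k w * (w - 1) powr of_real (q - 1) - E \<sigma> * (k w * (1 - w) powr of_real (q - 1)) = 0"
        unfolding eq by (simp only: mult.left_commute diff_self)
      with d have "((\<lambda>w. G w - E \<sigma> * K w) has_field_derivative 0) (at w)" by (simp only:)
      then show ?thesis by (rule has_field_derivative_at_within)
    qed
    from has_field_derivative_zero_constant[OF convex_quadrant this]
    obtain b where b: "\<And>w. w \<in> quadrant \<sigma> \<Longrightarrow> G w - E \<sigma> * K w = b" by blast
    have "G w2 - E \<sigma> * K w2 = G w1 - E \<sigma> * K w1" using b[OF w(1)] b[OF w(2)] by simp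
    then show ?thesis by (simp add: algebra_simps)
  qed
  obtain M where M: "\<And>w. w \<in> cball 1 (1/2) \<Longrightarrow> norm (k w) \<le> M"
  proof -
    have sub: "cball 1 (1/2) \<subseteq> {w. 0 < Re w}"
    proof
      fix w :: complex assume "w \<in> cball 1 (1/2)"
      then have "\<bar>Re (1 - w)\<bar> \<le> 1/2" using abs_Re_le_cmod[of "1 - w"] by (simp add: dist_norm)
      then have "Re (1 - w) \<le> 1/2" by (rule abs_le_D1)
      then show "w \<in> {w. 0 < Re w}" by simp
    qed
    have "bounded (k ` cball 1 (1/2))"
      using sub hol by (intro compact_imp_bounded compact_continuous_image compact_cball)
        (meson continuous_on_subset holomorphic_on_imp_continuous_on)
    then obtain M where "\<forall>w\<in>cball 1 (1/2). norm (k w) \<le> M" unfolding bounded_iff by blast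
    then show ?thesis using that by blast
  qed
  define A where "A \<sigma> r = 1 + complex_of_real r * cis (\<sigma> * (pi / 2))" for \<sigma> r
  define B where "B \<sigma> r = complex_of_real r * cis (\<sigma> * (pi / 4))" for \<sigma> r
  have A_Q: "A \<sigma> r \<in> quadrant \<sigma>" if "\<sigma> = 1 \<or> \<sigma> = -1" "r > 0" for \<sigma> r
    using that by (auto simp: A_def quadrant_def)
  have B_Q: "B \<sigma> r \<in> quadrant \<sigma>" if "\<sigma> = 1 \<or> \<sigma> = -1" "r > 0" for \<sigma> r
    unfolding B_def using that by (intro polar_in_quadrant) auto
  have kbd: "norm (k (1 + complex_of_real r * cis \<theta>)) * norm (v powr of_real (q - 1)) \<le> M * r powr (q - 1)"
    if "norm v = r" "0 < r" "r < 1/2" for r \<theta> and v :: complex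
  proof -
    have "norm (v powr of_real (q - 1)) = r powr (q - 1)"
      using that by (simp add: norm_powr_real_powr')
    moreover have "norm (k (1 + complex_of_real r * cis \<theta>)) \<le> M"
      using that by (intro M) (auto simp: dist_norm norm_mult)
    ultimately show ?thesis by (simp add: mult_right_mono)
  qed
  have G_arc: "norm (G (A 1 r) - G (A (-1) r)) \<le> M * pi * r powr q" if r: "0 < r" "r < 1/2" for r
  proof -
    have "norm (G (1 + complex_of_real r * cis (1 * (pi/2))) - G (1 + complex_of_real r * cis (1 * (-pi/2))))
        \<le> r * (M * r powr (q - 1)) * (pi/2 - (-pi/2))"
    proof (rule primitive_arc_bound)
      fix \<theta> assume \<theta>: "-pi/2 \<le> \<theta>" "\<theta> \<le> pi/2"
      have "0 \<le> cos \<theta>" using \<theta> by (intro cos_ge_zero) auto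
      moreover have "1 < 1 + r * cos \<theta>" if "r * sin \<theta> = 0"
      proof -
        have "sin \<theta> = 0" using that r by simp
        then have "cos \<theta> \<noteq> 0" using sin_cos_squared_add[of \<theta>] by auto
        then show ?thesis using r \<open>0 \<le> cos \<theta>\<close> by simp
      qed
      ultimately have "1 + complex_of_real r * cis (1 * \<theta>) \<in> slit_half_plane"
        using r by (auto simp: slit_half_plane_iff intro: add_pos_nonneg)
      then show "(G has_field_derivative k (1 + complex_of_real r * cis (1 * \<theta>)) * (1 + complex_of_real r * cis (1 * \<theta>) - 1) powr of_real (q - 1))
          (at (1 + complex_of_real r * cis (1 * \<theta>)))" by (rule G)
      show "norm (k (1 + complex_of_real r * cis (1 * \<theta>)) * (1 + complex_of_real r * cis (1 * \<theta>) - 1) powr of_real (q - 1)) \<le> M * r powr (q - 1)"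
        unfolding norm_mult mult_1 using r by (intro kbd) (auto simp: norm_mult)
    qed (use r in auto)
    also have "\<dots> = M * pi * r powr q" using r by (simp add: powr_diff)
    finally show ?thesis by (simp add: A_def)
  qed
  have K_arc_1: "norm (K (1 - complex_of_real r) - K (A \<sigma> r)) \<le> M * (pi/2) * r powr q"
    if \<sigma>: "\<sigma> = 1 \<or> \<sigma> = -1" and r: "0 < r" "r < 1/2" for \<sigma> r
  proof -
    have "norm (K (1 + complex_of_real r * cis (\<sigma> * pi)) - K (1 + complex_of_real r * cis (\<sigma> * (pi/2))))
        \<le> r * (M * r powr (q - 1)) * (pi - pi/2)"
    proof (rule primitive_arc_bound)
      fix \<theta> assume \<theta>: "pi/2 \<le> \<theta>" "\<theta> \<le> pi"
      have "0 \<le> cos (pi - \<theta>)" using \<theta> by (intro cos_ge_zero) auto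
      then have c0: "cos \<theta> \<le> 0" by simp
      have "r * cos \<theta> \<ge> r * (-1)" using r cos_ge_minus_one by (intro mult_left_mono) auto
      then have re: "0 < 1 + r * cos \<theta>" using r by linarith
      have "1 + r * cos \<theta> < 1" if "r * sin \<theta> = 0"
      proof -
        have "sin \<theta> = 0" using that r by simp
        then have "cos \<theta> \<noteq> 0" using sin_cos_squared_add[of \<theta>] by auto
        then have "cos \<theta> < 0" using c0 by simp
        then show ?thesis using r by (simp add: mult_pos_neg)
      qed
      then have "1 + complex_of_real r * cis (\<sigma> * \<theta>) \<in> ?S"
        using r re \<sigma> by auto
      then show "(K has_field_derivative k (1 + complex_of_real r * cis (\<sigma> * \<theta>)) * (1 - (1 + complex_of_real r * cis (\<sigma> * \<theta>))) powr of_real (q - 1))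
          (at (1 + complex_of_real r * cis (\<sigma> * \<theta>)))" by (rule K)
      show "norm (k (1 + complex_of_real r * cis (\<sigma> * \<theta>)) * (1 - (1 + complex_of_real r * cis (\<sigma> * \<theta>))) powr of_real (q - 1)) \<le> M * r powr (q - 1)"
        unfolding norm_mult using r by (intro kbd) (auto simp: norm_mult)
    qed (use r \<sigma> in auto)
    also have "\<dots> = M * (pi/2) * r powr q" using r by (simp add: powr_diff)
    also have "cis (\<sigma> * pi) = -1" using \<sigma> by (auto simp: complex_eq_iff)
    finally show ?thesis by (simp add: A_def)
  qed
  define D where "D = (1/2) powr (q - 1) + (3/2) powr (q - 1)"
  have D: "x powr (q - 1) \<le> D" if "1/2 \<le> x" "x \<le> 3/2" for x
  proof (cases "q \<ge> 1")
    case True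
    then have "x powr (q - 1) \<le> (3/2) powr (q - 1)" using that by (intro powr_mono2) auto
    then show ?thesis by (simp add: D_def add_increasing)
  next
    case False
    then have "x powr (q - 1) \<le> (1/2) powr (q - 1)" using that by (intro powr_mono2') auto
    then show ?thesis by (simp add: D_def add_increasing2)
  qed
  have K_arc_0: "norm (K (B \<sigma> r) - K (complex_of_real r)) \<le> C * D * (pi/4) * r powr c"
    if \<sigma>: "\<sigma> = 1 \<or> \<sigma> = -1" and r: "0 < r" "r < 1/2" for \<sigma> r
  proof -
    have "norm (K (0 + complex_of_real r * cis (\<sigma> * (pi/4))) - K (0 + complex_of_real r * cis (\<sigma> * 0)))
        \<le> r * (C * D * r powr (c - 1)) * (pi/4 - 0)"
    proof (rule primitive_arc_bound)
      fix \<theta> :: real assume \<theta>: "0 \<le> \<theta>" "\<theta> \<le> pi/4"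
      let ?w = "0 + complex_of_real r * cis (\<sigma> * \<theta>)"
      have "cos \<theta> > 0" using \<theta> pi_gt_zero by (intro cos_gt_zero_pi) linarith+
      have "cos (pi/4) \<le> cos \<theta>" using \<theta> by (intro cos_monotone_0_pi_le) auto
      have "sin \<theta> \<le> sin (pi/4)" using \<theta> by (intro sin_monotone_2pi_le) auto
      then have sc: "0 \<le> sin \<theta>" "sin \<theta> \<le> cos \<theta>"
        using \<open>cos (pi/4) \<le> cos \<theta>\<close> \<theta> by (auto simp: sin_45 cos_45 intro: sin_ge_zero)
      have re: "Re ?w = r * cos \<theta>" and im: "\<bar>Im ?w\<bar> = r * sin \<theta>"
        using \<sigma> r sc by (auto simp: abs_mult)
      have nw: "norm ?w = r" using r by (simp add: norm_mult)
      have re_pos: "Re ?w > 0" unfolding re using r \<open>cos \<theta> > 0\<close> by simp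
      have re_le: "Re ?w \<le> r" using complex_Re_le_cmod[of ?w] unfolding nw .
      then have "Re ?w < 1" using r by linarith
      then have "?w \<in> ?S" using re_pos by blast
      then show "(K has_field_derivative k ?w * (1 - ?w) powr of_real (q - 1)) (at ?w)" by (rule K)
      have "norm (k ?w) \<le> C * norm ?w powr (c - 1)"
      proof (rule bd[OF re_pos])
        show "\<bar>Im ?w\<bar> \<le> Re ?w" unfolding re im using sc r by (intro mult_left_mono) auto
        show "norm ?w \<le> 1" unfolding nw using r by simp
      qed
      then have k1: "norm (k ?w) \<le> C * r powr (c - 1)" unfolding nw .
      have "norm ((1 - ?w) powr of_real (q - 1)) = norm (1 - ?w) powr (q - 1)"
        by (simp add: norm_powr_real_powr')
      also have "\<dots> \<le> D"
      proof (rule D)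
        show "1/2 \<le> norm (1 - ?w)" using norm_triangle_ineq2[of 1 ?w] nw r by simp
        show "norm (1 - ?w) \<le> 3/2" using norm_triangle_ineq4[of 1 ?w] nw r by simp
      qed
      finally have "norm (k ?w) * norm ((1 - ?w) powr of_real (q - 1)) \<le> (C * r powr (c - 1)) * D"
        using k1 by (intro mult_mono order_trans[OF norm_ge_zero k1]) auto
      then show "norm (k ?w * (1 - ?w) powr of_real (q - 1)) \<le> C * D * r powr (c - 1)"
        by (simp add: norm_mult mult_ac)
    qed (use r \<sigma> in auto)
    also have "\<dots> = C * D * (pi/4) * r powr c" using r by (simp add: powr_diff)
    finally show ?thesis by (simp add: B_def)
  qed
  have near: "\<forall>\<^sub>F r in at_right 0. r \<in> {0<..<1/2::real}"
    by (rule eventually_at_right_real) simp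
  have null: "(g \<longlongrightarrow> 0) (at_right 0)" if "\<And>r. 0 < r \<Longrightarrow> r < 1/2 \<Longrightarrow> norm (g r) \<le> N * r powr e" "e > 0"
    for g :: "real \<Rightarrow> complex" and N e
  proof (rule Lim_null_comparison)
    show "\<forall>\<^sub>F r in at_right 0. norm (g r) \<le> N * r powr e"
      using near by eventually_elim (use that in auto)
    have "((\<lambda>r::real. r powr e) \<longlongrightarrow> 0) (at_right 0)"
      using \<open>e > 0\<close> by (intro tendsto_zero_powrI[OF tendsto_ident_at tendsto_const]) (auto intro: eventually_mono[OF near])
    from tendsto_mult_left[OF this, of N] show "((\<lambda>r. N * r powr e) \<longlongrightarrow> 0) (at_right 0)" by simp
  qed
  have lim_G_arc: "((\<lambda>r. G (A 1 r) - G (A (-1) r)) \<longlongrightarrow> 0) (at_right 0)"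
    using G_arc \<open>q > 0\<close> by (rule null)
  have lim_K_arc_1: "((\<lambda>r. K (1 - complex_of_real r) - K (A \<sigma> r)) \<longlongrightarrow> 0) (at_right 0)" if "\<sigma> = 1 \<or> \<sigma> = -1" for \<sigma>
    using K_arc_1[OF that] \<open>q > 0\<close> by (rule null)
  have lim_K_arc_0: "((\<lambda>r. K (B \<sigma> r) - K (complex_of_real r)) \<longlongrightarrow> 0) (at_right 0)" if "\<sigma> = 1 \<or> \<sigma> = -1" for \<sigma>
    using K_arc_0[OF that] \<open>c > 0\<close> by (rule null)
  have lim_l: "((\<lambda>r. G (B \<sigma> r)) \<longlongrightarrow> l \<sigma>) (at_right 0)" if \<sigma>: "\<sigma> = 1 \<or> \<sigma> = -1" for \<sigma>
  proof (rule filterlim_compose[OF l[OF \<sigma>]])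
    have "((\<lambda>r. complex_of_real r * cis (\<sigma> * (pi / 4))) \<longlongrightarrow> of_real 0 * cis (\<sigma> * (pi / 4))) (at_right 0)"
      by (intro tendsto_intros)
    moreover have "\<forall>\<^sub>F r in at_right 0. B \<sigma> r \<in> quadrant \<sigma> \<and> B \<sigma> r \<noteq> 0"
      using near by eventually_elim (use B_Q[OF \<sigma>] in \<open>auto simp: B_def\<close>)
    ultimately show "filterlim (B \<sigma>) (at 0 within quadrant \<sigma>) (at_right 0)"
      unfolding filterlim_at B_def by simp
  qed
  have lim_I: "((\<lambda>r. K (1 - complex_of_real r) - K (complex_of_real r)) \<longlongrightarrow> I) (at_right 0)"
  proof -
    let ?h = "\<lambda>u. k (of_real u) * of_real ((1 - u) powr (q - 1))"
    define J where "J x = integral {0..x} ?h" for x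
    have Jcont: "continuous_on {0..1} J"
      unfolding J_def by (rule indefinite_integral_continuous_1[OF int])
    have "(J \<longlongrightarrow> J 0) (at_right 0)" by (rule continuous_on_Icc_at_rightD[OF Jcont]) simp
    moreover have "(J \<longlongrightarrow> J 1) (at_left 1)" by (rule continuous_on_Icc_at_leftD[OF Jcont]) simp
    then have "((\<lambda>r. J (1 - r)) \<longlongrightarrow> J 1) (at_right 0)"
    proof (rule filterlim_compose)
      have "((\<lambda>r. 1 - r) \<longlongrightarrow> 1 - 0) (at_right (0::real))" by (intro tendsto_intros)
      then show "filterlim (\<lambda>r. 1 - r) (at_left 1) (at_right (0::real))"
        unfolding filterlim_at using near by (auto elim!: eventually_mono)
    qed
    ultimately have "((\<lambda>r. J (1 - r) - J r) \<longlongrightarrow> J 1 - J 0) (at_right 0)" by (intro tendsto_diff)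
    moreover have "\<forall>\<^sub>F r in at_right 0. K (1 - complex_of_real r) - K (complex_of_real r) = J (1 - r) - J r"
      using near
    proof eventually_elim
      case (elim r)
      then have r: "0 < r" "r < 1/2" by auto
      let ?g = "\<lambda>w. k w * (1 - w) powr of_real (q - 1)"
      have "((\<lambda>s. 1 * ?g (0 + of_real s * 1)) has_integral
          (K (0 + of_real (1 - r) * 1) - K (0 + of_real r * 1))) {r..1 - r}"
        using r by (intro FTC_line K) auto
      then have 1: "((\<lambda>s. ?g (of_real s)) has_integral (K (1 - of_real r) - K (of_real r))) {r..1 - r}"
        by simp
      have "?g (of_real s) = ?h s" if "s \<in> {r..1 - r}" for s
      proof -
        have "complex_of_real (1 - s) powr of_real (q - 1) = of_real ((1 - s) powr (q - 1))"
          using that r by (intro powr_of_real) auto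
        then show ?thesis by simp
      qed
      with 1 have "(?h has_integral (K (1 - of_real r) - K (of_real r))) {r..1 - r}"
        by (rule has_integral_eq[rotated]) 
      then have 2: "integral {r..1 - r} ?h = K (1 - of_real r) - K (of_real r)" by (rule integral_unique)
      have "J r + integral {r..1 - r} ?h = J (1 - r)"
        unfolding J_def using r
        by (intro Henstock_Kurzweil_Integration.integral_combine integrable_subinterval_real[OF int]) auto
      then show ?case unfolding 2 by (simp add: algebra_simps)
    qed
    moreover have "J 1 - J 0 = I" by (simp add: J_def I_def)
    ultimately show ?thesis by (simp add: tendsto_cong)
  qed
  define X where "X r = (G (A 1 r) - G (A (-1) r)) - (G (B 1 r) - G (B (-1) r))" for r
  have X1: "(X \<longlongrightarrow> 0 - (l 1 - l (-1))) (at_right 0)"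
    unfolding X_def by (intro tendsto_diff lim_G_arc lim_l) auto
  have KAB: "((\<lambda>r. K (A \<sigma> r) - K (B \<sigma> r)) \<longlongrightarrow> I - 0 - 0) (at_right 0)" if "\<sigma> = 1 \<or> \<sigma> = -1" for \<sigma>
  proof -
    have "((\<lambda>r. (K (1 - complex_of_real r) - K (complex_of_real r)) - (K (1 - complex_of_real r) - K (A \<sigma> r))
        - (K (B \<sigma> r) - K (complex_of_real r))) \<longlongrightarrow> I - 0 - 0) (at_right 0)"
      by (intro tendsto_diff lim_I lim_K_arc_1 lim_K_arc_0 that)
    then show ?thesis by (simp add: algebra_simps)
  qed
  have X2: "(X \<longlongrightarrow> E 1 * (I - 0 - 0) - E (-1) * (I - 0 - 0)) (at_right 0)"
  proof -
    have "((\<lambda>r. E 1 * (K (A 1 r) - K (B 1 r)) - E (-1) * (K (A (-1) r) - K (B (-1) r))) \<longlongrightarrow>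
        E 1 * (I - 0 - 0) - E (-1) * (I - 0 - 0)) (at_right 0)"
      by (intro tendsto_diff tendsto_mult tendsto_const KAB) auto
    moreover have "\<forall>\<^sub>F r in at_right 0. X r = E 1 * (K (A 1 r) - K (B 1 r)) - E (-1) * (K (A (-1) r) - K (B (-1) r))"
      using near
    proof eventually_elim
      case (elim r)
      then have r: "r > 0" by simp
      have "G (A 1 r) - G (B 1 r) = E 1 * (K (A 1 r) - K (B 1 r))"
        using r by (intro GK A_Q B_Q) auto
      moreover have "G (A (-1) r) - G (B (-1) r) = E (-1) * (K (A (-1) r) - K (B (-1) r))"
        using r by (intro GK A_Q B_Q) auto
      ultimately show ?case unfolding X_def by (simp add: algebra_simps)
    qed
    ultimately show ?thesis by (simp add: tendsto_cong)
  qed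
  have "0 - (l 1 - l (-1)) = E 1 * (I - 0 - 0) - E (-1) * (I - 0 - 0)"
    using tendsto_unique[OF trivial_limit_at_right_real X1 X2] .
  then have "l 1 - l (-1) = (E (-1) - E 1) * I" by (simp add: algebra_simps)
  also have "E (-1) - E 1 = 2 * \<i> * of_real (sin (pi * q))"
  proof -
    have "E \<sigma> = cis (\<sigma> * pi * (q - 1))" for \<sigma> by (simp add: E_def cis_conv_exp)
    moreover have "cos (pi * (q - 1)) = - cos (pi * q)" "sin (pi * (q - 1)) = - sin (pi * q)"
      by (simp_all add: right_diff_distrib cos_diff sin_diff)
    ultimately show ?thesis by (simp add: complex_eq_iff)
  qed
  finally show ?thesis unfolding I_def .
qed

section \<open>The loop integral as a function of the exponent\<close>

definition loop_kernel :: "real measure \<Rightarrow> real \<Rightarrow> real \<Rightarrow> complex \<Rightarrow> complex \<Rightarrow> complex" where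
  "loop_kernel \<alpha> a t c w =
    exp_log_transform \<alpha> t w * w powr (c - 1) * (w - 1) powr (of_real a - c - 1)"

text \<open>All powers on the triangle have a base of modulus between \<open>1 / 4\<close> and 4, apart from the factor
  \<open>s powr (c - 1)\<close> that comes from the corner at 0.\<close>

lemma norm_powr_bounded_base:
  fixes u e :: complex
  assumes "1/4 \<le> norm u" "norm u \<le> 4"
  shows "norm (u powr e) \<le> exp (norm e * (ln 4 + pi))"
proof -
  have u: "u \<noteq> 0" "norm u > 0" using assms by auto
  have "ln (1/4) \<le> ln (norm u)" using assms u by (subst ln_le_cancel_iff) auto
  moreover have "ln (norm u) \<le> ln 4" using assms u by (subst ln_le_cancel_iff) auto
  ultimately have "\<bar>ln (norm u)\<bar> \<le> ln 4" by (auto simp: ln_div abs_le_iff)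
  then have "norm (Ln u) \<le> ln 4 + pi" using norm_Ln_le[OF u(1)] by linarith
  then have "norm (e * Ln u) \<le> norm e * (ln 4 + pi)" unfolding norm_mult by (rule mult_left_mono) simp
  then have "Re (e * Ln u) \<le> norm e * (ln 4 + pi)" using complex_Re_le_cmod order_trans by blast
  then show ?thesis using u by (simp add: powr_def)
qed

lemma norm_corner: "norm (corner 1) = sqrt 8" "norm (corner (-1)) = sqrt 8"
  by (simp_all add: corner_def cmod_def)

lemma sqrt_8_bounds: "1/4 \<le> sqrt 8" "sqrt 8 \<le> (3::real)"
  by (rule real_le_rsqrt, simp add: power2_eq_square) (rule real_le_lsqrt, simp_all add: power2_eq_square)

lemma norm_powr_ray:
  assumes \<sigma>: "\<sigma> = 1 \<or> \<sigma> = -1" and s: "s > 0"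
  shows "norm ((complex_of_real s * corner \<sigma>) powr e) \<le> exp (norm e * (ln 4 + pi)) * s powr Re e"
proof -
  have nz: "corner \<sigma> \<noteq> 0" by (simp add: corner_def complex_eq_iff)
  have "(complex_of_real s * corner \<sigma>) powr e = exp (e * of_real (ln s)) * corner \<sigma> powr e"
    using nz s by (simp add: powr_def Ln_times_of_real Ln_of_real distrib_left exp_add)
  moreover have "norm (exp (e * complex_of_real (ln s))) = s powr Re e" using s by (simp add: powr_def)
  moreover have "norm (corner \<sigma> powr e) \<le> exp (norm e * (ln 4 + pi))"
    using \<sigma> norm_corner sqrt_8_bounds by (intro norm_powr_bounded_base) auto
  ultimately show ?thesis by (simp only: norm_mult mult.commute[of _ "s powr Re e"] mult_left_mono powr_ge_zero)
qed

lemma set_integrable_powr_bound: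
  fixes h :: "real \<Rightarrow> complex"
  assumes "c > 0" and cont: "continuous_on {0<..<1} h"
    and bd: "\<And>s. 0 < s \<Longrightarrow> s < 1 \<Longrightarrow> norm (h s) \<le> B * (s powr (c - 1) + 1)"
  shows "set_integrable lborel {0<..<1} h"
proof -
  have "set_integrable lborel {0..1} (\<lambda>s. s powr (c - 1) * (1 - s) powr (1 - 1))"
    using \<open>c > 0\<close> by (intro integrable_Beta) auto
  then have "set_integrable lborel {0<..<1} (\<lambda>s. s powr (c - 1) * (1 - s) powr (1 - 1))"
    by (rule set_integrable_subset) auto
  then have "set_integrable lborel {0<..<1} (\<lambda>s. s powr (c - 1))"
    by (rule set_integrable_cong[THEN iffD1, rotated -1]) auto
  moreover have "set_integrable lborel {0<..<1::real} (\<lambda>s. 1::real)"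
    by (simp add: set_integrable_def)
  ultimately have "set_integrable lborel {0<..<1} (\<lambda>s. B * (s powr (c - 1) + 1))"
    by (intro set_integrable_mult_right set_integral_add) auto
  then show ?thesis
    unfolding set_integrable_def
  proof (rule Bochner_Integration.integrable_bound)
    show "(\<lambda>x. indicator {0<..<1} x *\<^sub>R h x) \<in> borel_measurable lborel"
      using borel_measurable_continuous_on_indicator[OF _ cont] by simp
    show "AE x in lborel. norm (indicator {0<..<1} x *\<^sub>R h x) \<le> norm (indicator {0<..<1} x *\<^sub>R (B * (x powr (c - 1) + 1)))"
    proof (intro AE_I2)
      fix x :: real
      show "norm (indicator {0<..<1} x *\<^sub>R h x) \<le> norm (indicator {0<..<1} x *\<^sub>R (B * (x powr (c - 1) + 1)))"
        using bd[of x] by (auto simp: indicator_def intro: order_trans[OF _ abs_ge_self])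
    qed
  qed
qed

lemma set_integrable_Ioo_imp_HK:
  fixes h :: "real \<Rightarrow> complex"
  assumes "set_integrable lborel {0<..<1} h"
  shows "h integrable_on {0..1}" and "integral {0..1} h = (LINT s:{0<..<1}|lborel. h s)"
proof -
  show "h integrable_on {0..1}"
    using set_borel_integral_eq_integral(1)[OF assms] by (simp add: integrable_on_Icc_iff_Ioo)
  show "integral {0..1} h = (LINT s:{0<..<1}|lborel. h s)"
    using set_borel_integral_eq_integral(2)[OF assms] by (simp add: integral_open_interval_real)
qed

context
  fixes \<alpha> :: "real measure" and a t :: real
  assumes a: "a > 0" and \<alpha>: "\<alpha> \<in> log_finite_measures a"
begin

lemma loop_kernel_holomorphic: "loop_kernel \<alpha> a t c holomorphic_on slit_half_plane"
  unfolding loop_kernel_def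
  using slit_minus_1
  by (intro holomorphic_intros holomorphic_on_subset[OF exp_log_transform_holomorphic[OF \<alpha>]])
    (auto simp: slit_half_plane_iff complex_nonpos_Reals_iff)

lemma loop_kernel_holomorphic_exponent:
  assumes "w \<in> slit_half_plane"
  shows "(\<lambda>c. loop_kernel \<alpha> a t c w) holomorphic_on S"
proof -
  have "w \<noteq> 0" "w - 1 \<noteq> 0" using assms slit_minus_1[OF assms] by (auto simp: slit_half_plane_iff)
  then show ?thesis
    unfolding loop_kernel_def powr_def by (simp only: if_False) (intro holomorphic_intros)
qed

lemma loop_kernel_ray_bound:
  assumes \<sigma>: "\<sigma> = 1 \<or> \<sigma> = -1" and s: "0 < s" "s < 1"
  shows "norm (loop_kernel \<alpha> a t c (of_real s * corner \<sigma>)) \<le>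
     sqrt 2 powr a * exp ((norm (c - 1) + norm (of_real a - c - 1)) * (ln 4 + pi)) * s powr (Re c - 1)"
proof -
  let ?w = "complex_of_real s * corner \<sigma>"
  have re: "Re ?w = 2 * s" and im: "Im ?w = 2 * \<sigma> * s" by (simp_all add: corner_def)
  have nw: "norm ?w = s * sqrt 8" using \<sigma> s norm_corner by (auto simp: norm_mult)
  have q: "norm ?w / Re ?w = sqrt 2"
  proof -
    have "sqrt 8 = 2 * sqrt 2" using real_sqrt_mult[of 4 2] by simp
    then show ?thesis unfolding nw re using s by simp
  qed
  have F: "norm (exp_log_transform \<alpha> t ?w) \<le> sqrt 2 powr a"
  proof -
    have "0 < Re ?w" unfolding re using s by simp
    from exp_log_transform_bound[OF \<alpha> this, of t] show ?thesis unfolding q .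
  qed
  have p1: "norm (?w powr (c - 1)) \<le> exp (norm (c - 1) * (ln 4 + pi)) * s powr (Re c - 1)"
    using norm_powr_ray[OF \<sigma> s(1), of "c - 1"] by simp
  have p2: "norm ((?w - 1) powr (of_real a - c - 1)) \<le> exp (norm (of_real a - c - 1) * (ln 4 + pi))"
  proof (rule norm_powr_bounded_base)
    have "(1/4)\<^sup>2 \<le> (norm (?w - 1))\<^sup>2"
    proof -
      have "(norm (?w - 1))\<^sup>2 = (2 * s - 1)\<^sup>2 + (2 * \<sigma> * s)\<^sup>2"
        unfolding cmod_power2 minus_complex.sel one_complex.sel re im by simp
      also have "(2 * \<sigma> * s)\<^sup>2 = (2 * s)\<^sup>2" using \<sigma> by auto
      also have "(2 * s - 1)\<^sup>2 + (2 * s)\<^sup>2 = 1/2 + 2 * (2 * s - 1/2)\<^sup>2" by (simp add: power2_eq_square algebra_simps)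
      finally show ?thesis using zero_le_power2[of "2 * s - 1/2"] by (simp add: power2_eq_square)
    qed
    then show "1/4 \<le> norm (?w - 1)" by (rule power2_le_imp_le) simp
    have "norm (?w - 1) \<le> norm ?w + 1" using norm_triangle_ineq4[of ?w 1] by simp
    moreover have "s * sqrt 8 \<le> 1 * 3" using s sqrt_8_bounds by (intro mult_mono) auto
    ultimately show "norm (?w - 1) \<le> 4" unfolding nw by linarith
  qed
  have "norm (loop_kernel \<alpha> a t c ?w) \<le>
      sqrt 2 powr a * (exp (norm (c - 1) * (ln 4 + pi)) * s powr (Re c - 1)) * exp (norm (of_real a - c - 1) * (ln 4 + pi))"
    unfolding loop_kernel_def norm_mult[of "_ * _"] norm_mult[of "exp_log_transform \<alpha> t ?w"]
    by (intro mult_mono F p1 p2) auto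
  then show ?thesis
    unfolding distrib_right[of "norm (c - 1)"] exp_add by (simp only: mult_ac)
qed

lemma loop_kernel_edge_bound:
  assumes y: "\<bar>y\<bar> \<le> 2"
  shows "norm (loop_kernel \<alpha> a t c (Complex 2 y)) \<le>
     sqrt 2 powr a * exp ((norm (c - 1) + norm (of_real a - c - 1)) * (ln 4 + pi))"
proof -
  let ?w = "Complex 2 y"
  have y2: "y\<^sup>2 \<le> 4" using y abs_le_square_iff[of y 2] by simp
  have nw: "norm ?w = sqrt (4 + y\<^sup>2)" "norm (?w - 1) = sqrt (1 + y\<^sup>2)" by (simp_all add: cmod_def)
  have w_le: "norm ?w \<le> sqrt 8" unfolding nw using y2 by simp
  have w_ge: "1 \<le> norm ?w" unfolding nw by simp
  have w1_le: "norm (?w - 1) \<le> sqrt 8" unfolding nw using y2 by simp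
  have w1_ge: "1 \<le> norm (?w - 1)" unfolding nw by simp
  have q: "norm ?w / 2 \<le> sqrt 2"
  proof -
    have "sqrt 8 = 2 * sqrt 2" using real_sqrt_mult[of 4 2] by simp
    then show ?thesis using w_le by simp
  qed
  have "norm (exp_log_transform \<alpha> t ?w) \<le> (norm ?w / 2) powr a"
    using exp_log_transform_bound[OF \<alpha>, of ?w t] by simp
  also have "\<dots> \<le> sqrt 2 powr a" using q a by (intro powr_mono2) auto
  finally have F: "norm (exp_log_transform \<alpha> t ?w) \<le> sqrt 2 powr a" .
  have p1: "norm (?w powr (c - 1)) \<le> exp (norm (c - 1) * (ln 4 + pi))"
    using w_le w_ge sqrt_8_bounds by (intro norm_powr_bounded_base) linarith+
  have p2: "norm ((?w - 1) powr (of_real a - c - 1)) \<le> exp (norm (of_real a - c - 1) * (ln 4 + pi))"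
    using w1_le w1_ge sqrt_8_bounds by (intro norm_powr_bounded_base) linarith+
  have "norm (loop_kernel \<alpha> a t c ?w) \<le>
      sqrt 2 powr a * exp (norm (c - 1) * (ln 4 + pi)) * exp (norm (of_real a - c - 1) * (ln 4 + pi))"
    unfolding loop_kernel_def norm_mult[of "_ * _"] norm_mult[of "exp_log_transform \<alpha> t ?w"]
    by (intro mult_mono F p1 p2) auto
  then show ?thesis
    unfolding distrib_right[of "norm (c - 1)"] exp_add by (simp only: mult_ac)
qed

lemma triangle_points_in_slit:
  assumes "0 < s"
  shows "of_real s * corner 1 \<in> slit_half_plane" "of_real s * corner (-1) \<in> slit_half_plane"
    "corner (-1) + of_real s * (corner 1 - corner (-1)) \<in> slit_half_plane"
  using ray_in_quadrant[OF _ assms] quadrant_subset_slit edge_in_slit unfolding corner_edge by blast+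

lemma triangle_integrand_bound:
  assumes s: "0 < s" "s < 1"
  shows "norm (triangle_integrand (loop_kernel \<alpha> a t c) s) \<le>
     8 * sqrt 2 powr a * exp ((norm (c - 1) + norm (of_real a - c - 1)) * (ln 4 + pi)) * (s powr (Re c - 1) + 1)"
proof -
  define N where "N = sqrt 2 powr a * exp ((norm (c - 1) + norm (of_real a - c - 1)) * (ln 4 + pi))"
  have N: "N \<ge> 0" by (simp add: N_def)
  let ?K = "loop_kernel \<alpha> a t c"
  have c4: "norm (corner 1) \<le> 4" "norm (corner (-1)) \<le> 4" "norm (corner 1 - corner (-1)) \<le> 4"
    unfolding norm_corner using sqrt_8_bounds by (auto simp: corner_def cmod_def)
  have "norm (triangle_integrand ?K s) \<le>
      norm (corner (-1) * ?K (of_real s * corner (-1)))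
      + norm ((corner 1 - corner (-1)) * ?K (corner (-1) + of_real s * (corner 1 - corner (-1))))
      + norm (corner 1 * ?K (of_real s * corner 1))"
    unfolding triangle_integrand_def
    by (rule order_trans[OF norm_triangle_ineq4 add_right_mono[OF norm_triangle_ineq]])
  also have "\<dots> \<le> 4 * (N * s powr (Re c - 1)) + 4 * N + 4 * (N * s powr (Re c - 1))"
    unfolding norm_mult[of _ "?K _"] N_def
  proof (intro add_mono mult_mono c4)
    show "norm (?K (corner (-1) + of_real s * (corner 1 - corner (-1)))) \<le>
       sqrt 2 powr a * exp ((norm (c - 1) + norm (of_real a - c - 1)) * (ln 4 + pi))"
      unfolding corner_edge using s by (intro loop_kernel_edge_bound) auto
  qed (use s in \<open>auto intro!: loop_kernel_ray_bound\<close>)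
  also have "\<dots> \<le> 8 * N * (s powr (Re c - 1) + 1)" using N by (simp add: algebra_simps)
  finally show ?thesis by (simp add: N_def mult_ac)
qed

lemma continuous_on_ray: 
  assumes "\<sigma> = 1 \<or> \<sigma> = -1"
  shows "continuous_on {0<..<1} (\<lambda>s. loop_kernel \<alpha> a t c (of_real s * corner \<sigma>))"
  using assms triangle_points_in_slit
  by (intro continuous_on_compose2[OF holomorphic_on_imp_continuous_on[OF loop_kernel_holomorphic]] continuous_intros) auto

lemma continuous_on_triangle_integrand:
  "continuous_on {0<..<1} (triangle_integrand (loop_kernel \<alpha> a t c))"
proof -
  have "continuous_on {0<..<1} (\<lambda>s::real. loop_kernel \<alpha> a t c (corner (-1) + of_real s * (corner 1 - corner (-1))))"
    using triangle_points_in_slit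
    by (intro continuous_on_compose2[OF holomorphic_on_imp_continuous_on[OF loop_kernel_holomorphic]] continuous_intros) auto
  then show ?thesis
    unfolding triangle_integrand_def[abs_def] by (intro continuous_intros continuous_on_ray) auto
qed

lemma set_integrable_triangle:
  assumes "Re c > 0"
  shows "set_integrable lborel {0<..<1} (triangle_integrand (loop_kernel \<alpha> a t c))"
  using assms triangle_integrand_bound
  by (intro set_integrable_powr_bound[where c="Re c"] continuous_on_triangle_integrand) auto

definition triangle_integral :: "complex \<Rightarrow> complex" where
  "triangle_integral c = (LINT s:{0<..<1}|lborel. triangle_integrand (loop_kernel \<alpha> a t c) s)"

text \<open>The exponents enter the bound on the integrand only through their norms and through
  \<open>s powr (Re c - 1)\<close>, so one integrable bound serves all exponents in a small disc.\<close>

lemma triangle_integral_holomorphic: "triangle_integral holomorphic_on {c. 0 < Re c}"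
proof -
  let ?\<mu> = "restrict_space lborel {0<..<1::real}"
  let ?T = "\<lambda>c. triangle_integrand (loop_kernel \<alpha> a t c)"
  have sp: "space ?\<mu> = {0<..<1}" by (simp add: space_restrict_space)
  have "(\<lambda>c. LINT s|?\<mu>. ?T c s) holomorphic_on {c. 0 < Re c}"
  proof (rule holomorphic_on_lebesgue_integral)
    show "?T c \<in> borel_measurable ?\<mu>" for c
      using borel_measurable_continuous_on_restrict[OF continuous_on_triangle_integrand[of c]]
      by (simp add: measurable_cong_sets[OF sets_restrict_space_cong[OF sets_lborel] refl])
    show "(\<lambda>c. ?T c s) holomorphic_on {c. 0 < Re c}" if "s \<in> space ?\<mu>" for s
      using that triangle_points_in_slit[of s] unfolding sp triangle_integrand_def
      by (intro holomorphic_intros loop_kernel_holomorphic_exponent) auto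
    fix z :: complex assume "z \<in> {c. 0 < Re c}"
    then have z: "Re z > 0" by simp
    define r where "r = Re z / 2"
    have r: "r > 0" using z by (simp add: r_def)
    define B where "B = 8 * sqrt 2 powr a * exp ((norm z + r + 1 + (a + norm z + r + 1)) * (ln 4 + pi))"
    have w: "Re w \<ge> r \<and> norm w \<le> norm z + r" if "w \<in> cball z r" for w
      using half_Re_cball[OF z, of w] that by (simp add: r_def)
    have "set_integrable lborel {0<..<1} (\<lambda>s. complex_of_real (B * (s powr (r - 1) + 1)))"
      using r by (intro set_integrable_powr_bound[where c=r and B=B] continuous_intros)
        (auto simp: B_def norm_mult simp del: of_real_add of_real_mult)
    then have "integrable ?\<mu> (\<lambda>s. complex_of_real (B * (s powr (r - 1) + 1)))"
      by (subst integrable_restrict_space) (auto simp: set_integrable_def)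
    then have "integrable ?\<mu> (\<lambda>s. B * (s powr (r - 1) + 1))"
      by (simp only: complex_of_real_integrable_eq)
    moreover have "cball z r \<subseteq> {c. 0 < Re c}" using w r by force
    moreover have "norm (?T v s) \<le> B * (s powr (r - 1) + 1)" if v: "v \<in> cball z r" and "s \<in> space ?\<mu>" for v s
    proof -
      have s: "0 < s" "s < 1" using that sp by auto
      have nv: "norm v \<le> norm z + r" "Re v \<ge> r" using w[OF v] by auto
      have "norm (v - 1) \<le> norm z + r + 1" using norm_triangle_ineq4[of v 1] nv by simp
      moreover have "norm (of_real a - v - 1) \<le> a + norm z + r + 1"
        using norm_triangle_ineq4[of "of_real a - v" 1] norm_triangle_ineq4[of "of_real a" v] nv a by simp
      ultimately have "(norm (v - 1) + norm (of_real a - v - 1)) * (ln 4 + pi) \<le> (norm z + r + 1 + (a + norm z + r + 1)) * (ln 4 + pi)"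
        by (intro mult_right_mono add_mono) (auto intro: add_nonneg_nonneg)
      moreover have "s powr (Re v - 1) \<le> s powr (r - 1)"
        using s nv by (intro powr_mono') auto
      ultimately have "8 * sqrt 2 powr a * exp ((norm (v - 1) + norm (of_real a - v - 1)) * (ln 4 + pi)) * (s powr (Re v - 1) + 1)
          \<le> B * (s powr (r - 1) + 1)"
        unfolding B_def by (intro mult_mono mult_left_mono add_mono) auto
      with triangle_integrand_bound[OF s, of v] show ?thesis by (rule order_trans)
    qed
    ultimately show "\<exists>r>0. \<exists>b. integrable ?\<mu> b \<and> cball z r \<subseteq> {c. 0 < Re c} \<and>
        (\<forall>w\<in>cball z r. \<forall>x\<in>space ?\<mu>. norm (?T w x) \<le> b x)"
      using r by blast
  qed (simp add: open_halfspace_Re_gt)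
  moreover have "(LINT s|?\<mu>. ?T c s) = triangle_integral c" for c
    unfolding triangle_integral_def set_lebesgue_integral_def by (subst integral_restrict_space) auto
  ultimately show ?thesis by simp
qed

lemma loop_kernel_primitive:
  fixes c :: real
  assumes c: "c > 0"
  obtains G :: "complex \<Rightarrow> complex" and l :: "real \<Rightarrow> complex"
    where "\<And>w. w \<in> slit_half_plane \<Longrightarrow> (G has_field_derivative loop_kernel \<alpha> a t (of_real c) w) (at w)"
      "\<And>\<sigma>. \<sigma> = 1 \<or> \<sigma> = -1 \<Longrightarrow> (G \<longlongrightarrow> l \<sigma>) (at 0 within quadrant \<sigma>)"
      "l 1 - l (-1) = triangle_integral (of_real c)"
proof -
  obtain r where r: "r > 0" "\<And>w. 0 < Re w \<Longrightarrow> norm w < r \<Longrightarrow>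
      norm (exp_log_transform \<alpha> t w) \<le> 2 powr a * sqrt (norm w / Re w)"
    using exp_log_transform_near_0[OF \<alpha>, of t] by blast
  define C where "C = 2 powr a * exp (norm (complex_of_real a - of_real c - 1) * (ln 4 + pi))"
  have r0: "0 < min r (1/2)" and C: "0 \<le> C" using r by (auto simp: C_def)
  have bd: "norm (loop_kernel \<alpha> a t (of_real c) w) \<le> C * norm w powr (c - 1) * sqrt (norm w / Re w)"
      if "\<sigma> = 1 \<or> \<sigma> = -1" and w: "w \<in> quadrant \<sigma>" "norm w < min r (1/2)" for \<sigma> w
  proof -
      have F: "norm (exp_log_transform \<alpha> t w) \<le> 2 powr a * sqrt (norm w / Re w)"
        using w by (intro r) (auto simp: quadrant_def)
      have p1: "norm (w powr (of_real c - 1)) = norm w powr (c - 1)"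
        using norm_powr_real_powr'[of "of_real c - 1" w] by simp
      have p2: "norm ((w - 1) powr (of_real a - of_real c - 1)) \<le> exp (norm (complex_of_real a - of_real c - 1) * (ln 4 + pi))"
      proof (rule norm_powr_bounded_base)
        have "1 - norm w \<le> norm (w - 1)" using norm_triangle_ineq2[of 1 w] by (simp add: norm_minus_commute)
        then show "1/4 \<le> norm (w - 1)" using w by simp
        show "norm (w - 1) \<le> 4" using norm_triangle_ineq4[of w 1] w by simp
      qed
      have "norm (loop_kernel \<alpha> a t (of_real c) w) \<le>
          2 powr a * sqrt (norm w / Re w) * norm w powr (c - 1) * exp (norm (complex_of_real a - of_real c - 1) * (ln 4 + pi))"
        unfolding loop_kernel_def norm_mult[of "_ * _"] norm_mult[of "exp_log_transform \<alpha> t w"] p1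
        using w by (intro mult_mono F p2) (auto simp: quadrant_def)
      then show ?thesis by (simp add: C_def mult_ac)
  qed
  have ray: "(\<lambda>s. loop_kernel \<alpha> a t (of_real c) (of_real s * corner \<sigma>)) integrable_on {0..1}"
    if \<sigma>: "\<sigma> = 1 \<or> \<sigma> = -1" for \<sigma>
  proof -
    have "set_integrable lborel {0<..<1} (\<lambda>s. loop_kernel \<alpha> a t (of_real c) (of_real s * corner \<sigma>))"
    proof (rule set_integrable_powr_bound[OF c continuous_on_ray[OF \<sigma>]])
      fix s :: real assume s: "0 < s" "s < 1"
      let ?N = "sqrt 2 powr a * exp ((norm (complex_of_real c - 1) + norm (complex_of_real a - of_real c - 1)) * (ln 4 + pi))"
      have "norm (loop_kernel \<alpha> a t (of_real c) (of_real s * corner \<sigma>)) \<le> ?N * s powr (c - 1)"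
        using loop_kernel_ray_bound[OF \<sigma> s, of "of_real c"] by simp
      also have "\<dots> \<le> ?N * (s powr (c - 1) + 1)" by (intro mult_left_mono) auto
      finally show "norm (loop_kernel \<alpha> a t (of_real c) (of_real s * corner \<sigma>)) \<le> ?N * (s powr (c - 1) + 1)" .
    qed
    then show ?thesis by (rule set_integrable_Ioo_imp_HK)
  qed
  have "integral {0..1} (triangle_integrand (loop_kernel \<alpha> a t (of_real c))) = triangle_integral (of_real c)"
    unfolding triangle_integral_def using c by (intro set_integrable_Ioo_imp_HK set_integrable_triangle) auto
  note tri = this
  show ?thesis
  proof (rule slit_primitive_limits[OF loop_kernel_holomorphic c r0 C])
    fix G :: "complex \<Rightarrow> complex" and l :: "real \<Rightarrow> complex"
    assume "\<And>w. w \<in> slit_half_plane \<Longrightarrow> (G has_field_derivative loop_kernel \<alpha> a t (of_real c) w) (at w)"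
      "\<And>\<sigma>. \<sigma> = 1 \<or> \<sigma> = -1 \<Longrightarrow> (G \<longlongrightarrow> l \<sigma>) (at 0 within quadrant \<sigma>)"
      "l 1 - l (-1) = integral {0..1} (triangle_integrand (loop_kernel \<alpha> a t (of_real c)))"
    then show thesis unfolding tri by (rule that)
  qed (fact bd ray)+
qed

lemma loop_integral_eq_triangle_integral:
  fixes c :: real
  assumes "c > 0" "loop_from_0_around_1 \<gamma>"
  shows "(loop_kernel \<alpha> a t (of_real c) has_contour_integral triangle_integral (of_real c)) \<gamma>"
proof -
  obtain G l where G: "\<And>w. w \<in> slit_half_plane \<Longrightarrow> (G has_field_derivative loop_kernel \<alpha> a t (of_real c) w) (at w)"
      "\<And>\<sigma>. \<sigma> = 1 \<or> \<sigma> = -1 \<Longrightarrow> (G \<longlongrightarrow> l \<sigma>) (at 0 within quadrant \<sigma>)"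
      "l 1 - l (-1) = triangle_integral (of_real c)"
    using loop_kernel_primitive[OF assms(1)] by blast
  show ?thesis
    using loop_contour_integral[OF assms(2) G(1) G(2)[of 1] G(2)[of "-1"]] by (simp add: G(3))
qed

end

section \<open>The transform of the law of the mean\<close>

lemma exp_log_transform_markov_krein:
  assumes "a > 0" "\<alpha> \<in> log_finite_measures a" "dirichlet_process M \<phi> \<alpha>"
  shows "exp_log_transform \<alpha> t (of_real u) =
    (LINT x|mean_distribution M \<phi>. (1 + \<i> * complex_of_real (t * u * x)) powr (- complex_of_real a))"
  using markov_krein_dirichlet[OF assms, of "t * u"]
  by (simp add: exp_log_transform_def mult_ac)

lemma norm_one_plus_i_powr_le:
  assumes "p \<ge> 0" shows "norm ((1 + \<i> * complex_of_real y) powr (- complex_of_real p)) \<le> 1"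
proof -
  have "1 \<le> cmod (1 + \<i> * complex_of_real y)"
    using abs_Re_le_cmod[of "1 + \<i> * complex_of_real y"] by simp
  from powr_mono2'[OF _ _ this, of "- p"] show ?thesis
    using assms norm_powr_real_powr'[of "- complex_of_real p"] by simp
qed

lemma measurable_one_plus_i_powr [measurable]:
  "(\<lambda>y. (1 + \<i> * complex_of_real y) powr e) \<in> borel_measurable borel"
  by (intro borel_measurable_continuous_onI continuous_intros) (auto simp: complex_nonpos_Reals_iff complex_eq_iff)

lemma mean_transform_beta:
  assumes a: "a > 0" and \<alpha>: "\<alpha> \<in> log_finite_measures a" and dp: "dirichlet_process M \<phi> \<alpha>"
    and c: "0 < c" "c < a"
  shows "integrable (beta_measure c (a - c)) (\<lambda>u. exp_log_transform \<alpha> t (of_real u))"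
    and "(LINT x|mean_distribution M \<phi>. (1 + \<i> * complex_of_real (t * x)) powr (- complex_of_real c)) =
      (LINT u|beta_measure c (a - c). exp_log_transform \<alpha> t (of_real u))"
proof -
  let ?\<mu> = "mean_distribution M \<phi>" and ?B = "beta_measure c (a - c)"
  note [measurable_cong] = mean_distribution_prob_space(2)[OF dp]
  interpret \<mu>: prob_space ?\<mu> by (rule mean_distribution_prob_space(1)[OF dp])
  interpret B: prob_space ?B using c by (intro prob_space_beta_measure) auto
  interpret B\<mu>: pair_prob_space ?B ?\<mu> ..
  let ?k = "\<lambda>y. (1 + \<i> * complex_of_real y) powr (- complex_of_real a)"
  have eq: "exp_log_transform \<alpha> t (of_real u) = (LINT x|?\<mu>. ?k (t * u * x))" for u
    by (rule exp_log_transform_markov_krein[OF a \<alpha> dp])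
  have int: "integrable (?B \<Otimes>\<^sub>M ?\<mu>) (\<lambda>(u, x). ?k (t * u * x))"
    using a by (intro B\<mu>.integrable_const_bound[where B=1]) (auto intro!: norm_one_plus_i_powr_le simp: case_prod_beta simp del: of_real_mult)
  show "integrable ?B (\<lambda>u. exp_log_transform \<alpha> t (of_real u))"
    unfolding eq by (rule B\<mu>.integrable_fst[OF int])
  have "(LINT x|?\<mu>. (1 + \<i> * complex_of_real (t * x)) powr (- complex_of_real c)) = (LINT x|?\<mu>. LINT u|?B. ?k (t * u * x))"
  proof (intro Bochner_Integration.integral_cong refl)
    fix x
    show "(1 + \<i> * complex_of_real (t * x)) powr (- complex_of_real c) = (LINT u|?B. ?k (t * u * x))"
      using beta_integral_powr[of c "a - c" "\<i> * complex_of_real (t * x)"] c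
      by (simp add: mult_ac)
  qed
  also have "\<dots> = (LINT u|?B. LINT x|?\<mu>. ?k (t * u * x))"
    by (rule B\<mu>.Fubini_integral[OF int])
  finally show "(LINT x|?\<mu>. (1 + \<i> * complex_of_real (t * x)) powr (- complex_of_real c)) =
      (LINT u|?B. exp_log_transform \<alpha> t (of_real u))" unfolding eq .
qed

lemma mean_transform_le:
  assumes a: "a > 0" and \<alpha>: "\<alpha> \<in> log_finite_measures a" and dp: "dirichlet_process M \<phi> \<alpha>"
    and c: "0 < c" "c \<le> a"
  shows "(LINT x|mean_distribution M \<phi>. (1 + \<i> * complex_of_real (t * x)) powr (- complex_of_real c)) =
      (LINT u:{0..1}|beta_measure c (a - c). exp_log_transform \<alpha> t (of_real u))"
proof (cases "c = a")
  case False
  then have ca: "c < a" using c by simp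
  have "(LINT u|beta_measure c (a - c). exp_log_transform \<alpha> t (of_real u)) =
      (LINT u:{0..1}|beta_measure c (a - c). exp_log_transform \<alpha> t (of_real u))"
    unfolding set_lebesgue_integral_def
  proof (rule integral_cong_AE)
    show [measurable]: "(\<lambda>u. exp_log_transform \<alpha> t (of_real u)) \<in> borel_measurable (beta_measure c (a - c))"
      using mean_transform_beta(1)[OF a \<alpha> dp c(1) ca] by (rule borel_measurable_integrable)
    show "(\<lambda>u. indicator {0..1} u *\<^sub>R exp_log_transform \<alpha> t (of_real u)) \<in> borel_measurable (beta_measure c (a - c))"
      by measurable
    have "a - c \<noteq> 0" using ca by simp
    from AE_beta_measure[OF this, of c]
    show "AE u in beta_measure c (a - c). exp_log_transform \<alpha> t (of_real u) = indicator {0..1} u *\<^sub>R exp_log_transform \<alpha> t (of_real u)"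
      by eventually_elim auto
  qed
  then show ?thesis using mean_transform_beta(2)[OF a \<alpha> dp c(1) ca] by simp
next
  case True
  let ?\<mu> = "mean_distribution M \<phi>"
  note [measurable_cong] = mean_distribution_prob_space(2)[OF dp]
  interpret \<mu>: prob_space ?\<mu> by (rule mean_distribution_prob_space(1)[OF dp])
  have "(\<lambda>u. LINT x|?\<mu>. (1 + \<i> * complex_of_real (t * u * x)) powr (- complex_of_real a)) \<in> borel_measurable borel"
    by measurable
  then have [measurable]: "(\<lambda>u. exp_log_transform \<alpha> t (of_real u)) \<in> borel_measurable borel"
    unfolding exp_log_transform_markov_krein[OF a \<alpha> dp] .
  have "(LINT u:{0..1}|beta_measure c (a - c). exp_log_transform \<alpha> t (of_real u)) = exp_log_transform \<alpha> t (of_real 1)"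
    unfolding set_lebesgue_integral_def beta_measure_def using True
    by (simp add: integral_return)
  also have "\<dots> = (LINT x|?\<mu>. (1 + \<i> * complex_of_real (t * x)) powr (- complex_of_real c))"
    unfolding exp_log_transform_markov_krein[OF a \<alpha> dp] using True by simp
  finally show ?thesis ..
qed

lemma mean_transform_holomorphic:
  assumes dp: "dirichlet_process M \<phi> \<alpha>"
  shows "(\<lambda>c. LINT x|mean_distribution M \<phi>. (1 + \<i> * complex_of_real (t * x)) powr (- c)) holomorphic_on {c. 0 < Re c}"
proof (rule holomorphic_on_lebesgue_integral)
  let ?\<mu> = "mean_distribution M \<phi>"
  note [measurable_cong] = mean_distribution_prob_space(2)[OF dp]
  interpret \<mu>: prob_space ?\<mu> by (rule mean_distribution_prob_space(1)[OF dp])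
  have nz: "1 + \<i> * complex_of_real y \<noteq> 0" for y by (simp add: complex_eq_iff)
  show "(\<lambda>x. (1 + \<i> * complex_of_real (t * x)) powr (- c)) \<in> borel_measurable ?\<mu>" for c by measurable
  show "(\<lambda>c. (1 + \<i> * complex_of_real (t * x)) powr (- c)) holomorphic_on {c. 0 < Re c}" for x
    unfolding powr_def if_not_P[OF nz] by (intro holomorphic_intros)
  fix z :: complex assume "z \<in> {c. 0 < Re c}"
  then have z: "Re z > 0" by simp
  define r where "r = Re z / 2"
  have r: "r > 0" using z by (simp add: r_def)
  have w: "Re w \<ge> r \<and> norm w \<le> norm z + r" if "w \<in> cball z r" for w
    using half_Re_cball[OF z, of w] that by (simp add: r_def)
  have "norm ((1 + \<i> * complex_of_real y) powr (- v)) \<le> exp ((norm z + r) * pi)" if v: "v \<in> cball z r" for v y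
  proof -
    let ?u = "1 + \<i> * complex_of_real y"
    have "1 \<le> norm ?u" using abs_Re_le_cmod[of ?u] by simp
    then have "0 \<le> ln (norm ?u)" by (rule ln_ge_zero)
    then have 1: "0 \<le> Re v * Re (Ln ?u)" using w[OF v] r nz by simp
    have "\<bar>Im (Ln ?u)\<bar> \<le> pi" using mpi_less_Im_Ln[OF nz, of y] Im_Ln_le_pi[OF nz, of y] unfolding abs_le_iff by linarith
    moreover have "\<bar>Im v\<bar> \<le> norm z + r" using w[OF v] abs_Im_le_cmod[of v] by linarith
    ultimately have "\<bar>Im v * Im (Ln ?u)\<bar> \<le> (norm z + r) * pi" unfolding abs_mult by (intro mult_mono) auto
    then have "Im v * Im (Ln ?u) \<le> (norm z + r) * pi" by (rule abs_le_D1)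
    then have "Re (- v * Ln ?u) \<le> (norm z + r) * pi" using 1 by simp
    then show ?thesis using nz by (simp add: powr_def)
  qed
  moreover have "cball z r \<subseteq> {c. 0 < Re c}" using w r by force
  moreover have "integrable ?\<mu> (\<lambda>_. exp ((norm z + r) * pi))" by simp
  ultimately show "\<exists>r>0. \<exists>b. integrable ?\<mu> b \<and> cball z r \<subseteq> {c. 0 < Re c} \<and>
      (\<forall>w\<in>cball z r. \<forall>x\<in>space ?\<mu>. norm ((1 + \<i> * complex_of_real (t * x)) powr (- w)) \<le> b x)"
    using r by (intro exI[of _ r] conjI exI[of _ "\<lambda>_. exp ((norm z + r) * pi)"] ballI) (auto simp del: of_real_mult)
qed (simp add: open_halfspace_Re_gt)

text \<open>For exponents just below \<open>a\<close> the loop collapses onto the segment, and the resulting integral is the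
  beta mean up to its normalising constant.\<close>

lemma triangle_integral_collapse:
  assumes a: "a > 0" and \<alpha>: "\<alpha> \<in> log_finite_measures a" and dp: "dirichlet_process M \<phi> \<alpha>"
    and c: "0 < c" "c < a" "a - 1 < c"
  shows "triangle_integral \<alpha> a t (of_real c) =
     2 * \<i> * of_real (sin (pi * (a - c))) * of_real (Gamma c * Gamma (a - c) / Gamma a) *
     (LINT u|beta_measure c (a - c). exp_log_transform \<alpha> t (of_real u))"
proof -
  define q where "q = a - c"
  have q: "0 < q" "q < 1" "c + q = a" using c by (auto simp: q_def)
  define A where "A = Gamma a / (Gamma c * Gamma q)"
  have A: "A > 0" using a c q by (simp add: A_def)
  let ?F = "exp_log_transform \<alpha> t"
  define k where "k w = ?F w * w powr (of_real c - 1)" for w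
  define d where "d u = (if 0 < u \<and> u < 1 then A * u powr (c - 1) * (1 - u) powr (q - 1) else 0)" for u :: real
  have d0: "d u \<ge> 0" for u using A by (simp add: d_def)
  have beta: "beta_measure c q = density lborel (\<lambda>u. ennreal (d u))"
    using q by (simp add: beta_measure_def d_def A_def cong: if_cong)
  have [measurable]: "d \<in> borel_measurable borel" unfolding d_def by measurable
  have intF: "integrable (beta_measure c q) (\<lambda>u. ?F (of_real u))"
    unfolding q_def by (rule mean_transform_beta(1)[OF a \<alpha> dp c(1,2)])
  have [measurable]: "(\<lambda>u. ?F (of_real u)) \<in> borel_measurable borel"
    using borel_measurable_integrable[OF intF] by (simp add: measurable_cong_sets[OF sets_beta_measure refl])
  define h where "h u = k (of_real u) * of_real ((1 - u) powr (q - 1))" for u :: real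
  have dh: "d u *\<^sub>R ?F (of_real u) = indicator {0<..<1} u *\<^sub>R (of_real A * h u)" for u
  proof (cases "0 < u \<and> u < 1")
    case True
    then have "complex_of_real u powr (of_real c - 1) = of_real (u powr (c - 1))"
      using powr_of_real[of u "c - 1"] by simp
    then show ?thesis using True by (simp add: d_def h_def k_def scaleR_conv_of_real mult_ac)
  qed (auto simp: d_def)
  have "integrable lborel (\<lambda>u. d u *\<^sub>R ?F (of_real u))"
    using intF unfolding beta by (subst (asm) integrable_density) (auto simp: d0)
  then have "set_integrable lborel {0<..<1} (\<lambda>u. of_real A * h u)"
    unfolding dh set_integrable_def .
  then have h_int: "set_integrable lborel {0<..<1} h" using A by simp
  have "(LINT u|beta_measure c q. ?F (of_real u)) = (LINT u|lborel. d u *\<^sub>R ?F (of_real u))"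
    unfolding beta by (subst integral_density) (auto simp: d0)
  also have "\<dots> = (LINT u:{0<..<1}|lborel. of_real A * h u)"
    unfolding dh set_lebesgue_integral_def ..
  also have "\<dots> = of_real A * integral {0..1} h"
    using set_integrable_Ioo_imp_HK(2)[OF h_int] by simp
  finally have LB: "(LINT u|beta_measure c q. ?F (of_real u)) = of_real A * integral {0..1} h" .
  obtain G l where G: "\<And>w. w \<in> slit_half_plane \<Longrightarrow> (G has_field_derivative loop_kernel \<alpha> a t (of_real c) w) (at w)"
      "\<And>\<sigma>. \<sigma> = 1 \<or> \<sigma> = -1 \<Longrightarrow> (G \<longlongrightarrow> l \<sigma>) (at 0 within quadrant \<sigma>)"
      "l 1 - l (-1) = triangle_integral \<alpha> a t (of_real c)"
    using loop_kernel_primitive[OF a \<alpha> c(1)] by blast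
  have "l 1 - l (-1) = 2 * \<i> * of_real (sin (pi * q)) * integral {0..1} (\<lambda>u. k (of_real u) * of_real ((1 - u) powr (q - 1)))"
  proof (rule collapse_onto_segment[where C="sqrt 2 powr a" and c=c])
    show "k holomorphic_on {w. 0 < Re w}"
      unfolding k_def
      by (intro holomorphic_intros exp_log_transform_holomorphic[OF \<alpha>]) (auto simp: complex_nonpos_Reals_iff)
    show "norm (k w) \<le> sqrt 2 powr a * norm w powr (c - 1)" if w: "0 < Re w" "\<bar>Im w\<bar> \<le> Re w" for w
    proof -
      have "(Im w)\<^sup>2 \<le> (Re w)\<^sup>2" using w by (simp add: abs_le_square_iff[symmetric])
      then have "(norm w)\<^sup>2 \<le> (sqrt 2 * Re w)\<^sup>2" by (simp add: cmod_power2 power_mult_distrib)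
      then have "norm w \<le> sqrt 2 * Re w" by (rule power2_le_imp_le) (use w in simp)
      then have "norm w / Re w \<le> sqrt 2" using w by (simp add: pos_divide_le_eq)
      then have "(norm w / Re w) powr a \<le> sqrt 2 powr a" using w a by (intro powr_mono2) auto
      then have "norm (?F w) \<le> sqrt 2 powr a"
        using exp_log_transform_bound[OF \<alpha> w(1), of t] by linarith
      moreover have "norm (w powr (of_real c - 1)) = norm w powr (c - 1)"
        using norm_powr_real_powr'[of "of_real c - 1" w] by simp
      ultimately show ?thesis unfolding k_def norm_mult by (simp add: mult_right_mono)
    qed
    show "(\<lambda>u. k (of_real u) * of_real ((1 - u) powr (q - 1))) integrable_on {0..1}"
      using set_integrable_Ioo_imp_HK(1)[OF h_int] unfolding h_def .
    show "(G has_field_derivative k w * (w - 1) powr of_real (q - 1)) (at w)" if "w \<in> slit_half_plane" for w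
      using G(1)[OF that] unfolding loop_kernel_def k_def q_def by simp
  qed (use c q G in auto)
  then have tri: "triangle_integral \<alpha> a t (of_real c) = 2 * \<i> * of_real (sin (pi * q)) * integral {0..1} h"
    unfolding G(3) h_def .
  have "integral {0..1} h = of_real (1 / A) * (LINT u|beta_measure c q. ?F (of_real u))"
    unfolding LB using A by simp
  moreover have "1 / A = Gamma c * Gamma q / Gamma a" by (simp add: A_def)
  ultimately show ?thesis unfolding tri q_def by (simp only: mult.assoc)
qed

text \<open>Both sides are holomorphic in \<open>c\<close> for \<open>Re c > max 0 (a - 1)\<close>: the lower bound \<open>a - 1\<close> keeps the
  argument \<open>c - a + 1\<close> of the gamma function away from its poles. Below \<open>a\<close> they agree by the
  collapse, the beta case and the reflection formula.\<close>

lemma mean_transform_gt: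
  assumes a: "a > 0" and \<alpha>: "\<alpha> \<in> log_finite_measures a" and dp: "dirichlet_process M \<phi> \<alpha>"
    and c: "a < c"
  shows "(LINT x|mean_distribution M \<phi>. (1 + \<i> * complex_of_real (t * x)) powr (- complex_of_real c)) =
     complex_of_real (Gamma (c - a + 1) * Gamma a) / (2 * complex_of_real pi * \<i> * complex_of_real (Gamma c)) *
     triangle_integral \<alpha> a t (of_real c)"
proof -
  define b where "b = max 0 (a - 1)"
  let ?D = "{z :: complex. b < Re z}"
  define R where "R z = Gamma (z - of_real a + 1) * of_real (Gamma a) * rGamma z / (2 * of_real pi * \<i>) * triangle_integral \<alpha> a t z" for z
  define L where "L z = (LINT x|mean_distribution M \<phi>. (1 + \<i> * complex_of_real (t * x)) powr (- z))" for z
  have R_real: "R (of_real x) = complex_of_real (Gamma (x - a + 1) * Gamma a) / (2 * complex_of_real pi * \<i> * complex_of_real (Gamma x)) *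
     triangle_integral \<alpha> a t (of_real x)" for x
  proof -
    have G: "Gamma (complex_of_real x - of_real a + 1) = of_real (Gamma (x - a + 1))"
      using Gamma_complex_of_real[of "x - a + 1"] by simp
    have rG: "rGamma (complex_of_real x) = inverse (of_real (Gamma x))"
      by (simp only: rGamma_inverse_Gamma Gamma_complex_of_real)
    show ?thesis
      unfolding R_def G rG of_real_mult divide_inverse inverse_mult_distrib by (simp only: mult_ac)
  qed
  have b: "0 \<le> b" "a - 1 \<le> b"
    unfolding b_def by (fact max.cobounded1, fact max.cobounded2)
  have D: "?D \<subseteq> {z. 0 < Re z}"
  proof
    fix z assume "z \<in> ?D"
    then have "b < Re z" by simp
    then have "0 < Re z" using b(1) by linarith
    then show "z \<in> {z. 0 < Re z}" by simp
  qed
  have "L (of_real c) - R (of_real c) = 0"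
  proof (rule analytic_continuation[of "\<lambda>z. L z - R z" ?D "complex_of_real ` {b<..<a}" "of_real ((b + a) / 2)"])
    have ba: "b < a" using a by (simp add: b_def)
    show "(\<lambda>z. L z - R z) holomorphic_on ?D"
      unfolding R_def
    proof (intro holomorphic_intros)
      show "L holomorphic_on ?D"
        unfolding L_def using mean_transform_holomorphic[OF dp] D by (rule holomorphic_on_subset)
      show "triangle_integral \<alpha> a t holomorphic_on ?D"
        using triangle_integral_holomorphic[OF a \<alpha>] D by (rule holomorphic_on_subset)
      show "z - of_real a + 1 \<notin> \<int>\<^sub>\<le>\<^sub>0" if "z \<in> ?D" for z
      proof
        assume "z - of_real a + 1 \<in> \<int>\<^sub>\<le>\<^sub>0"
        then obtain n where n: "z - of_real a + 1 = of_int n" "n \<le> 0" by (rule nonpos_Ints_cases)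
        have "Re z - a + 1 = of_int n" using arg_cong[OF n(1), of Re] by simp
        then have "Re z - a + 1 \<le> 0" using n(2) by simp
        moreover have "b < Re z" using that by simp
        ultimately show False using b(2) by linarith
      qed
    qed auto
    show "open ?D" by (rule open_halfspace_Re_gt)
    show "connected ?D" by (intro convex_connected convex_halfspace_Re_gt)
    show "complex_of_real ` {b<..<a} \<subseteq> ?D" by auto
    show "complex_of_real ((b + a) / 2) \<in> ?D" using ba by simp
    show "complex_of_real ((b + a) / 2) islimpt complex_of_real ` {b<..<a}"
      using ba by (intro islimpt_of_real_interval) auto
    show "complex_of_real c \<in> ?D" using c ba by simp
    fix z assume "z \<in> complex_of_real ` {b<..<a}"
    then obtain x where bx: "z = of_real x" "b < x" "x < a" by auto
    have "0 < x" "a - 1 < x" using bx(2) b by linarith+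
    then have x: "z = of_real x" "0 < x" "x < a" "a - 1 < x" using bx by blast+
    define q where "q = a - x"
    have q: "0 < q" "q < 1" using x by (auto simp: q_def)
    have sin: "sin (pi * q) > 0" using q by (intro sin_gt_zero) auto
    have refl: "Gamma q * Gamma (1 - q) = pi / sin (pi * q)"
    proof -
      have "complex_of_real (Gamma q * Gamma (1 - q)) = complex_of_real (pi / sin (pi * q))"
        using Gamma_reflection_complex[of "of_real q"]
        by (simp add: Gamma_complex_of_real[symmetric] sin_of_real[symmetric])
      then show ?thesis by (simp only: of_real_eq_iff)
    qed
    have "R z = of_real (Gamma (1 - q) * Gamma a) / (2 * complex_of_real pi * \<i> * complex_of_real (Gamma x)) *
      (2 * \<i> * of_real (sin (pi * q)) * of_real (Gamma x * Gamma q / Gamma a) *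
       (LINT u|beta_measure x (a - x). exp_log_transform \<alpha> t (of_real u)))"
    proof -
      have xq: "x - a + 1 = 1 - q" "a - x = q" by (simp_all add: q_def)
      show ?thesis
        unfolding x(1) R_real triangle_integral_collapse[OF a \<alpha> dp x(2,3,4)] xq ..
    qed
    also have "\<dots> = of_real ((Gamma q * Gamma (1 - q)) * sin (pi * q) / pi) *
        (LINT u|beta_measure x (a - x). exp_log_transform \<alpha> t (of_real u))"
    proof -
      have "Gamma a \<noteq> 0" "Gamma x \<noteq> 0"
        using less_imp_neq[OF Gamma_real_pos[OF a]] less_imp_neq[OF Gamma_real_pos[OF x(2)]] by simp_all
      then show ?thesis by (simp add: field_simps)
    qed
    also have "(Gamma q * Gamma (1 - q)) * sin (pi * q) / pi = 1" unfolding refl using sin by simp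
    also have "of_real 1 * (LINT u|beta_measure x (a - x). exp_log_transform \<alpha> t (of_real u)) = L z"
      unfolding L_def x(1) mean_transform_beta(2)[OF a \<alpha> dp x(2,3)] by simp
    finally show "L z - R z = 0" by simp
  qed
  then show ?thesis unfolding R_real by (simp add: L_def)
qed

theorem theorem4:
  fixes a c t :: real and \<alpha> :: "real measure"
    and M :: "'w measure" and \<phi> :: "'w \<Rightarrow> real measure"
  assumes "a > 0" and "\<alpha> \<in> log_finite_measures a" and "dirichlet_process M \<phi> \<alpha>"
  shows
    "(0 < c \<and> c \<le> a \<longrightarrow>
        (LINT x|mean_distribution M \<phi>.
           (1 + \<i> * complex_of_real t * complex_of_real x) powr (- complex_of_real c)) =
        (LINT u:{0..1}|beta_measure c (a - c).
           exp (- (LINT x|\<alpha>. Ln (1 + \<i> * complex_of_real u * complex_of_real t * complex_of_real x)))))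
     \<and>
     (a < c \<longrightarrow>
        (\<forall>\<gamma>. loop_from_0_around_1 \<gamma> \<longrightarrow>
          (let f = (\<lambda>w.
                exp (- (LINT x|\<alpha>. Ln (1 + \<i> * w * complex_of_real t * complex_of_real x))) *
                w powr complex_of_real (c - 1) * (w - 1) powr complex_of_real (a - c - 1))
           in f contour_integrable_on \<gamma> \<and>
              (LINT x|mean_distribution M \<phi>.
                 (1 + \<i> * complex_of_real t * complex_of_real x) powr (- complex_of_real c)) =
              complex_of_real (Gamma (c - a + 1) * Gamma a) /
                (2 * complex_of_real pi * \<i> * complex_of_real (Gamma c)) *
              contour_integral \<gamma> f)))"
proof (intro conjI impI allI)
  assume "0 < c \<and> c \<le> a"
  then show "(LINT x|mean_distribution M \<phi>.
           (1 + \<i> * complex_of_real t * complex_of_real x) powr (- complex_of_real c)) =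
        (LINT u:{0..1}|beta_measure c (a - c).
           exp (- (LINT x|\<alpha>. Ln (1 + \<i> * complex_of_real u * complex_of_real t * complex_of_real x))))"
    using mean_transform_le[OF assms, of c t] by (simp add: exp_log_transform_def mult.assoc)
next
  fix \<gamma> assume c: "a < c" and loop: "loop_from_0_around_1 \<gamma>"
  define f where "f = (\<lambda>w. exp (- (LINT x|\<alpha>. Ln (1 + \<i> * w * complex_of_real t * complex_of_real x))) *
                w powr complex_of_real (c - 1) * (w - 1) powr complex_of_real (a - c - 1))"
  have f: "f = loop_kernel \<alpha> a t (of_real c)"
    by (intro ext) (simp add: f_def loop_kernel_def exp_log_transform_def)
  have int: "(f has_contour_integral triangle_integral \<alpha> a t (of_real c)) \<gamma>"
    unfolding f using assms c loop by (intro loop_integral_eq_triangle_integral[where a=a]) auto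
  have "f contour_integrable_on \<gamma> \<and>
      (LINT x|mean_distribution M \<phi>. (1 + \<i> * complex_of_real t * complex_of_real x) powr (- complex_of_real c)) =
      complex_of_real (Gamma (c - a + 1) * Gamma a) /
        (2 * complex_of_real pi * \<i> * complex_of_real (Gamma c)) * contour_integral \<gamma> f"
    using int mean_transform_gt[OF assms c, of t]
    by (auto simp: contour_integral_unique mult.assoc intro: has_contour_integral_integrable)
  then show "let f = (\<lambda>w.
                exp (- (LINT x|\<alpha>. Ln (1 + \<i> * w * complex_of_real t * complex_of_real x))) *
                w powr complex_of_real (c - 1) * (w - 1) powr complex_of_real (a - c - 1))
           in f contour_integrable_on \<gamma> \<and>
              (LINT x|mean_distribution M \<phi>.
                 (1 + \<i> * complex_of_real t * complex_of_real x) powr (- complex_of_real c)) =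
              complex_of_real (Gamma (c - a + 1) * Gamma a) /
                (2 * complex_of_real pi * \<i> * complex_of_real (Gamma c)) *
              contour_integral \<gamma> f"
    unfolding Let_def f_def .
qed

end
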